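(* Let $n\ge 3$ and let $G$ be a graph on $[n]$. From the polynomial deck $\{\phi^{G\setminus i}\}_{i\in[n]}$ it is possible to determine whether $G$ has no cycles of length $4$, and, if so, whether the rank of the walk matrix $W^G$ is at most $2$. If both conditions are satisfied (that is, $G$ has no cycles of length $4$ and $\operatorname{rank}(W^G)\le 2$), then $(\phi^G,\phi^{\overline{G}})$ can be efficiently reconstructed from the polynomial deck, i.e. by an algorithm running in time polynomial in $n$. In particular: if $G$ and $H$ are graphs on $[n]$ with the same polynomial deck, then $G$ has no cycle of length $4$ if and only if $H$ has none; in that case $\operatorname{rank}(W^G)\le 2$ if and only if $\operatorname{rank}(W^H)\le 2$; and if both conditions hold then $(\phi^G,\phi^{\overline{G}})=(\phi^H,\phi^{\overline{H}})$.
   Context: Graphs are finite, simple and undirected. For a graph $G$ with vertex set $[n]=\{1,\dots,n\}$ and adjacency matrix $A$, the characteristic polynomial is $\phi^G(x)=\det(xI-A)$. $\overline{G}$ denotes the complement of $G$ and $G\setminus i$ the graph obtained by deleting vertex $i$. The polynomial deck of $G$ is the multiset $\{\phi^{G\setminus i}\}_{i\in[n]}$. The walk matrix of $G$ is $W^G=(\mathbf{1}\ \ A\mathbf{1}\ \ \cdots\ \ A^{n-1}\mathbf{1})$, where $\mathbf{1}$ is the all-ones vector; its rank is taken over $\mathbb{Q}$ (equivalently $\mathbb{R}$). A cycle of length 4 is a (not necessarily induced) subgraph isomorphic to $C_4$. *)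

theory Defs
  imports
    "Jordan_Normal_Form.Char_Poly"
    "Jordan_Normal_Form.DL_Rank"
    "HOL-Library.Multiset"
    "HOL-Library.Log_Nat"
begin

section \<open>Graphs, polynomial decks and walk matrices\<close>

record ugraph =
  verts :: "nat set"
  edges :: "nat set set"

definition simple_graph :: "ugraph \<Rightarrow> bool" where
  "simple_graph G \<longleftrightarrow> finite (verts G) \<and> (\<forall>e\<in>edges G. e \<subseteq> verts G \<and> card e = 2)"

definition graph_on :: "nat \<Rightarrow> ugraph \<Rightarrow> bool" where
  "graph_on n G \<longleftrightarrow> simple_graph G \<and> verts G = {1..n}"

definition complement :: "ugraph \<Rightarrow> ugraph" where
  "complement G = \<lparr>verts = verts G, edges = {e. e \<subseteq> verts G \<and> card e = 2} - edges G\<rparr>"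

definition delete_vertex :: "ugraph \<Rightarrow> nat \<Rightarrow> ugraph" where
  "delete_vertex G i = \<lparr>verts = verts G - {i}, edges = {e \<in> edges G. i \<notin> e}\<rparr>"

definition has_four_cycle :: "ugraph \<Rightarrow> bool" where
  "has_four_cycle G \<longleftrightarrow>
     (\<exists>a b c d. distinct [a, b, c, d] \<and> {{a, b}, {b, c}, {c, d}, {d, a}} \<subseteq> edges G)"

text \<open>Rows and columns are indexed from 0 and follow the increasing enumeration of the
  vertices.  A diagonal entry is 0 because the singleton \<open>{v}\<close> is never an edge.\<close>

definition adj_matrix :: "ugraph \<Rightarrow> 'a :: {zero,one} mat" where
  "adj_matrix G = (let vs = sorted_list_of_set (verts G) in
     mat (card (verts G)) (card (verts G))
       (\<lambda>(i, j). if {vs ! i, vs ! j} \<in> edges G then 1 else 0))"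

definition graph_poly :: "ugraph \<Rightarrow> int poly" where
  "graph_poly G = char_poly (adj_matrix G)"

definition polynomial_deck :: "ugraph \<Rightarrow> int poly multiset" where
  "polynomial_deck G = image_mset (\<lambda>i. graph_poly (delete_vertex G i)) (mset_set (verts G))"

definition walk_matrix :: "ugraph \<Rightarrow> rat mat" where
  "walk_matrix G = (let n = card (verts G) in
     mat_of_cols n (map (\<lambda>k. (adj_matrix G ^\<^sub>m k) *\<^sub>v vec n (\<lambda>_. 1)) [0..<n]))"

definition walk_rank :: "ugraph \<Rightarrow> nat" where
  "walk_rank G = vec_space.rank (card (verts G)) (walk_matrix G)"


section \<open>Programs with logarithmic cost\<close>

text \<open>The model of computation is the random access machine with the logarithmic cost
  criterion, presented as a while language.  The memory consists of integer arrays; a program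
  names only finitely many of them, and cell 0 of an array serves as a scalar variable.
  Every integer produced during a run, including constants, addresses and values read from
  memory, is charged its bit length.  Running times in this model and on Turing machines are
  polynomially related.\<close>

type_synonym state = "string \<Rightarrow> int \<Rightarrow> int"

datatype expr =
    Const int
  | Cell string expr
  | Add expr expr
  | Sub expr expr
  | Mul expr expr
  | Quo expr expr

datatype com =
    Skip
  | Store string expr expr
  | Seq com com
  | IfPos expr com com
  | WhilePos expr com

fun val :: "expr \<Rightarrow> state \<Rightarrow> int" where
  "val (Const c) s = c"
| "val (Cell x e) s = s x (val e s)"
| "val (Add e f) s = val e s + val f s"
| "val (Sub e f) s = val e s - val f s"
| "val (Mul e f) s = val e s * val f s"
| "val (Quo e f) s = val e s div val f s"

definition int_cost :: "int \<Rightarrow> nat" where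
  "int_cost z = 1 + floorlog 2 (nat \<bar>z\<bar>)"

fun expr_cost :: "expr \<Rightarrow> state \<Rightarrow> nat" where
  "expr_cost (Const c) s = int_cost c"
| "expr_cost (Cell x e) s = expr_cost e s + int_cost (val (Cell x e) s)"
| "expr_cost (Add e f) s = expr_cost e s + expr_cost f s + int_cost (val (Add e f) s)"
| "expr_cost (Sub e f) s = expr_cost e s + expr_cost f s + int_cost (val (Sub e f) s)"
| "expr_cost (Mul e f) s = expr_cost e s + expr_cost f s + int_cost (val (Mul e f) s)"
| "expr_cost (Quo e f) s = expr_cost e s + expr_cost f s + int_cost (val (Quo e f) s)"

text \<open>\<open>exec c s t s'\<close>: started in \<open>s\<close>, the program \<open>c\<close> halts in \<open>s'\<close> after time \<open>t\<close>.
  The guards of \<open>IfPos\<close> and \<open>WhilePos\<close> hold when the expression is positive.\<close>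

inductive exec :: "com \<Rightarrow> state \<Rightarrow> nat \<Rightarrow> state \<Rightarrow> bool" where
  Skip: "exec Skip s 1 s"
| Store: "exec (Store x e f) s (1 + expr_cost e s + expr_cost f s)
            (s(x := (s x)(val e s := val f s)))"
| Seq: "exec c s t s' \<Longrightarrow> exec d s' u s'' \<Longrightarrow> exec (Seq c d) s (1 + t + u) s''"
| IfTrue: "val e s > 0 \<Longrightarrow> exec c s t s' \<Longrightarrow> exec (IfPos e c d) s (1 + expr_cost e s + t) s'"
| IfFalse: "val e s \<le> 0 \<Longrightarrow> exec d s t s' \<Longrightarrow> exec (IfPos e c d) s (1 + expr_cost e s + t) s'"
| WhileFalse: "val e s \<le> 0 \<Longrightarrow> exec (WhilePos e c) s (1 + expr_cost e s) s"
| WhileTrue: "val e s > 0 \<Longrightarrow> exec c s t s' \<Longrightarrow> exec (WhilePos e c) s' u s'' \<Longrightarrow>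
     exec (WhilePos e c) s (1 + expr_cost e s + t + u) s''"

text \<open>The input is \<open>n\<close> together with a listing of the \<open>n\<close> polynomials of a deck, each given by
  its coefficients in degrees \<open>0, \<dots>, n - 1\<close>.  All other cells are initially 0.\<close>

definition deck_input :: "nat \<Rightarrow> int poly list \<Rightarrow> state" where
  "deck_input n ps = (\<lambda>x i.
     if x = ''n'' \<and> i = 0 then int n
     else if x = ''deck'' \<and> 0 \<le> i \<and> i < int (n * n)
       then coeff (ps ! (nat i div n)) (nat i mod n)
     else 0)"

definition stores_poly :: "state \<Rightarrow> string \<Rightarrow> nat \<Rightarrow> int poly \<Rightarrow> bool" where
  "stores_poly s x n p \<longleftrightarrow> (\<forall>k\<le>n. s x (int k) = coeff p k)"

text \<open>The deck is a multiset, so the program has to work for every order in which its members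
  may be listed.  One program and one time bound serve all \<open>n\<close> and all graphs.\<close>

definition efficiently_reconstructible :: "(nat \<Rightarrow> ugraph \<Rightarrow> bool) \<Rightarrow> bool" where
  "efficiently_reconstructible P \<longleftrightarrow>
     (\<exists>prog. \<exists>p :: nat poly. \<forall>n G ps.
        P n G \<longrightarrow> mset ps = polynomial_deck G \<longrightarrow>
        (\<exists>t s. exec prog (deck_input n ps) t s \<and> t \<le> poly p n \<and>
           stores_poly s ''phi'' n (graph_poly G) \<and>
           stores_poly s ''cophi'' n (graph_poly (complement G))))"

end

theory Submission
  imports Defs "HOL-Combinatorics.Permutations"
begin

text \<open>Let \<open>A\<close> be the adjacency matrix of a graph on \<open>n\<close> vertices, \<open>\<phi> = det (x I - A)\<close>, let \<open>\<one>\<close> be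
  the all-ones vector, and write \<open>w l = \<one>\<^sup>T A\<^sup>l \<one>\<close> for the number of walks of length \<open>l\<close>.

  The members of the deck are the diagonal entries of the adjugate of \<open>x I - A\<close>, and their sum
  is the derivative of \<open>\<phi>\<close>; so the deck determines these entries and all of \<open>\<phi>\<close> except its
  constant term.  Let \<open>E j\<close> be the coefficient of \<open>x ^ (n - 1 - j)\<close> in the adjugate and \<open>r j\<close>
  that of \<open>x ^ (n - j)\<close> in \<open>\<phi>\<close>.  Then \<open>E 0 = I\<close> and \<open>E (j + 1) = A E j + r (j + 1) I\<close>
  (lemma \<open>adj_coeff_0_and_Suc\<close>), and with \<open>E j = 0\<close> for \<open>j \<ge> n\<close> this includes the
  Cayley-Hamilton theorem.  Since \<open>r 1 = 0\<close>, the diagonal of \<open>E 2\<close> gives the degrees \<open>d i\<close>,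
  and the diagonal of \<open>E 4\<close> gives the numbers of closed walks of length 4 at each vertex up to
  the additive constant \<open>r 4\<close>.

  The number of closed walks of length 4 at \<open>i\<close> is the sum of the squares of the codegrees
  (numbers of common neighbours) of \<open>i\<close> with all vertices.  A graph has no 4-cycle if and only if
  distinct vertices have codegree at most 1, that is, if and only if squaring does not change
  these codegrees.  Summed over all vertices this is an identity between \<open>r 2\<close>, \<open>r 4\<close> and the
  degrees (\<open>quad_free_iff\<close>), which the deck decides when \<open>n \<noteq> 4\<close>; for \<open>n = 4\<close>, where \<open>r 4\<close> is
  the unknown constant term, a graph has a 4-cycle if and only if all its degrees are at least 2.
  Without 4-cycles, \<open>r 4\<close> is a function of the degrees for every \<open>n\<close>, and the number of closed
  walks of length 4 at \<open>i\<close> is \<open>d i ^ 2 - d i + e i\<close> with \<open>e = A\<^sup>2 \<one>\<close>.  Hence the deck determines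
  the pairs \<open>(d i, e i)\<close>.

  The walk matrix has rank at most 2 if and only if \<open>\<one>\<close>, \<open>d = A \<one>\<close> and \<open>e = A\<^sup>2 \<one>\<close> are
  linearly dependent (\<open>walk_rank_le_2_iff\<close>), which can be read off from the pairs \<open>(d i, e i)\<close>.
  In this case these pairs yield integers with \<open>D e = N d + M \<one>\<close> and \<open>D \<noteq> 0\<close>, and all walk
  numbers follow from \<open>D w (l + 2) = N w (l + 1) + M w l\<close>.  The walk numbers are all that is
  missing.  Pairing the Cayley-Hamilton identity with \<open>\<one>\<close> on both sides expresses \<open>n \<phi> 0\<close> by the
  other coefficients of \<open>\<phi>\<close> and the walk numbers (\<open>char_poly_annihilates_total_walks\<close>).
  The characteristic polynomial of the complement is \<open>(-1) ^ n\<close> times \<open>\<phi> + \<one>\<^sup>T adj (x I - A) \<one>\<close>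
  evaluated at \<open>- x - 1\<close>, because the matrix of the complement is \<open>J - I - A\<close> and \<open>det (M + J) =
  det M + \<one>\<^sup>T adj M \<one>\<close>; the coefficients of \<open>\<one>\<^sup>T adj (x I - A) \<one>\<close> are again sums of products
  of coefficients of \<open>\<phi>\<close> and walk numbers (\<open>coeff_walk_poly\<close>).

  These formulas are a program of nested counting loops.  A calculus of runs in which
  every loop makes at most \<open>n + 1\<close> passes and every cell keeps fewer than a fixed number of bits
  bounds the running time by the syntax of the program alone; what remains are the loop invariants
  and bounds on the stored values.  The program is deterministic and works for every order of the
  deck, so the characteristic polynomials of a graph and of its complement depend on the deck only
  (\<open>reconstruction_unique\<close>).\<close>

section \<open>The adjugate of the characteristic matrix\<close>

text \<open>Coefficients are indexed from the top, and by convention vanish beyond the last one, so that the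
  recursion between them continues to hold at and after step \<open>n\<close>.\<close>

definition rev_coeff :: "'a :: comm_ring_1 mat \<Rightarrow> nat \<Rightarrow> 'a" where
  "rev_coeff A j = (if j \<le> dim_row A then coeff (char_poly A) (dim_row A - j) else 0)"

definition adj_coeff :: "'a :: comm_ring_1 mat \<Rightarrow> nat \<Rightarrow> nat \<Rightarrow> nat \<Rightarrow> 'a" where
  "adj_coeff A j i k = (if j < dim_row A
     then coeff (adj_mat (char_poly_matrix A) $$ (i, k)) (dim_row A - 1 - j) else 0)"

lemma char_matrix_times_adj:
  fixes A :: "'a :: comm_ring_1 mat"
  assumes A: "A \<in> carrier_mat n n" and i: "i < n" and k: "k < n"
  defines "R \<equiv> adj_mat (char_poly_matrix A)"
  shows "pCons 0 (R $$ (i, k)) - (\<Sum>t<n. Polynomial.smult (A $$ (i, t)) (R $$ (t, k)))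
    = (if i = k then char_poly A else 0)"
proof -
  have C: "char_poly_matrix A \<in> carrier_mat n n" using A by simp
  have R: "R \<in> carrier_mat n n" unfolding R_def by (rule adj_mat(1)[OF C])
  have "(char_poly_matrix A * R) $$ (i, k) = (char_poly A \<cdot>\<^sub>m 1\<^sub>m n) $$ (i, k)"
    unfolding R_def adj_mat(2)[OF C] char_poly_def by simp
  moreover have "(char_poly_matrix A * R) $$ (i, k)
      = (\<Sum>t<n. char_poly_matrix A $$ (i, t) * R $$ (t, k))"
    using i k C R by (simp add: scalar_prod_def lessThan_atLeast0)
  moreover have "\<dots> = (\<Sum>t<n. (if t = i then pCons 0 (R $$ (i, k)) else 0)
      - Polynomial.smult (A $$ (i, t)) (R $$ (t, k)))"
    using A i by (intro sum.cong) (auto simp: char_poly_matrix_def)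
  moreover have "\<dots> = pCons 0 (R $$ (i, k)) - (\<Sum>t<n. Polynomial.smult (A $$ (i, t)) (R $$ (t, k)))"
    using i by (simp add: sum_subtractf sum.delta)
  ultimately show ?thesis using i k by simp
qed

text \<open>An entry of the adjugate is, up to sign, the determinant of a matrix of size \<open>n - 1\<close> with entries
  of degree at most 1.\<close>

lemma degree_adj_mat_char:
  fixes A :: "'a :: comm_ring_1 mat"
  assumes A: "A \<in> carrier_mat n n" and i: "i < n" and k: "k < n"
  shows "degree (adj_mat (char_poly_matrix A) $$ (i, k)) \<le> n - 1"
proof -
  have C: "char_poly_matrix A \<in> carrier_mat n n" using A by simp
  have D: "mat_delete (char_poly_matrix A) k i \<in> carrier_mat (n - 1) (n - 1)"
    by (rule mat_delete_carrier[OF C])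
  have "degree (mat_delete (char_poly_matrix A) k i $$ (a, b)) \<le> 1" if "a < n - 1" "b < n - 1" for a b
    using that C A i k by (auto simp: mat_delete_def char_poly_matrix_def)
  then have "degree (det (mat_delete (char_poly_matrix A) k i)) \<le> 1 * (n - 1)"
    by (rule degree_det_le) (use D in auto)
  moreover have "(-1) ^ (k + i) * q = Polynomial.smult ((-1) ^ (k + i)) q" for q :: "'a poly"
    by (cases "even (k + i)") auto
  ultimately show ?thesis
    using carrier_matD[OF C] i k degree_smult_le[of "(-1) ^ (k + i)"]
    by (auto simp: adj_mat_def cofactor_def intro: order_trans)
qed

text \<open>The Faddeev-LeVerrier recursion: compare coefficients in \<open>(x I - A) adj (x I - A) = \<phi> I\<close>.
  The step from \<open>j = n - 1\<close> to \<open>j = n\<close>, with left-hand side 0, is the comparison of constant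
  terms and amounts to the Cayley-Hamilton theorem.\<close>

lemma adj_coeff_0_and_Suc:
  fixes A :: "'a :: idom mat"
  assumes A: "A \<in> carrier_mat n n" and i: "i < n" and k: "k < n"
  shows "adj_coeff A 0 i k = (if i = k then 1 else 0)"
    and "adj_coeff A (Suc j) i k =
      (\<Sum>t<n. A $$ (i, t) * adj_coeff A j t k) + (if i = k then rev_coeff A (Suc j) else 0)"
proof -
  define R where "R = adj_mat (char_poly_matrix A)"
  have n: "dim_row A = n" using A by simp
  have deg: "degree (char_poly A) = n" "coeff (char_poly A) n = 1"
    using degree_monic_char_poly[OF A] by auto
  have rec: "coeff (pCons 0 (R $$ (i, k))) r
      = (\<Sum>t<n. A $$ (i, t) * coeff (R $$ (t, k)) r) + (if i = k then coeff (char_poly A) r else 0)"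
    if "i < n" for i r
    using arg_cong[OF char_matrix_times_adj[OF A that k], of "\<lambda>p. coeff p r"]
    by (auto simp: R_def coeff_sum algebra_simps)
  have n0: "n > 0" using i by simp
  have top: "coeff (R $$ (i, k)) n = 0" if "i < n" for i
  proof (rule coeff_eq_0)
    have "degree (R $$ (i, k)) \<le> n - 1" unfolding R_def by (rule degree_adj_mat_char[OF A that k])
    then show "degree (R $$ (i, k)) < n" using n0 by simp
  qed
  have "coeff (R $$ (i, k)) (n - 1) = coeff (pCons 0 (R $$ (i, k))) n"
    using n0 by (cases n) auto
  also have "\<dots> = (if i = k then 1 else 0)"
    unfolding rec[OF i] using top deg(2) by simp
  finally show "adj_coeff A 0 i k = (if i = k then 1 else 0)"
    using n0 unfolding adj_coeff_def n R_def by simp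
  show "adj_coeff A (Suc j) i k =
      (\<Sum>t<n. A $$ (i, t) * adj_coeff A j t k) + (if i = k then rev_coeff A (Suc j) else 0)"
  proof (cases "j < n")
    case True
    have "adj_coeff A (Suc j) i k = coeff (pCons 0 (R $$ (i, k))) (n - 1 - j)"
    proof (cases "Suc j < n")
      case True
      then have "n - 1 - j = Suc (n - 1 - Suc j)" by simp
      with True show ?thesis unfolding adj_coeff_def n R_def by simp
    next
      case False
      then have "n - 1 - j = 0" by simp
      with False show ?thesis unfolding adj_coeff_def n R_def by simp
    qed
    also have "\<dots> = (\<Sum>t<n. A $$ (i, t) * coeff (R $$ (t, k)) (n - 1 - j)) +
        (if i = k then coeff (char_poly A) (n - 1 - j) else 0)" by (rule rec[OF i])
    finally show ?thesis using True unfolding adj_coeff_def rev_coeff_def n R_def by simp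
  next
    case False
    then show ?thesis unfolding adj_coeff_def rev_coeff_def n by simp
  qed
qed

text \<open>Deleting row and column \<open>i\<close> commutes with forming the characteristic matrix; this is how
  the deck enters.\<close>

lemma adj_coeff_diag:
  fixes A :: "'a :: comm_ring_1 mat"
  assumes A: "A \<in> carrier_mat n n" and i: "i < n"
  shows "adj_coeff A j i i = (if j < n then coeff (char_poly (mat_delete A i i)) (n - 1 - j) else 0)"
proof -
  have e: "mat_delete (char_poly_matrix A) i i = char_poly_matrix (mat_delete A i i)"
    using A i by (intro eq_matI) (auto simp: mat_delete_def char_poly_matrix_def)
  have "adj_mat (char_poly_matrix A) $$ (i, i) = det (mat_delete (char_poly_matrix A) i i)"
    using carrier_matD[OF char_poly_matrix_closed[OF A]] i by (simp add: adj_mat_def cofactor_def)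
  then show ?thesis using A by (simp add: adj_coeff_def e char_poly_def)
qed

text \<open>The diagonal of the adjugate sums to the derivative of \<open>\<phi>\<close>.  The factor \<open>n - j\<close> vanishes only for the
  constant term, the one coefficient that the deck does not show.\<close>

lemma sum_adj_coeff_diag:
  fixes A :: "'a :: idom mat"
  assumes A: "A \<in> carrier_mat n n"
  shows "(\<Sum>i<n. adj_coeff A j i i) = (of_nat n - of_nat j) * rev_coeff A j"
proof (cases "j < n")
  case True
  have "(\<Sum>i<n. adj_coeff A j i i) = coeff (pderiv (char_poly A)) (n - 1 - j)"
    using True unfolding pderiv_char_poly[OF A] coeff_sum
    by (intro sum.cong) (auto simp: adj_coeff_diag[OF A])
  also have "\<dots> = of_nat (n - j) * coeff (char_poly A) (n - j)"
    using True by (simp add: coeff_pderiv Suc_diff_Suc)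
  finally show ?thesis using True A by (simp add: rev_coeff_def of_nat_diff)
next
  case False
  then show ?thesis using A by (auto simp: adj_coeff_def rev_coeff_def)
qed

text \<open>Taking traces in the recursion and inserting the previous lemma gives each coefficient from the
  preceding matrix.\<close>

lemma trace_step_rev_coeff:
  fixes A :: "'a :: idom mat"
  assumes A: "A \<in> carrier_mat n n"
  shows "of_nat (Suc j) * rev_coeff A (Suc j) = - (\<Sum>i<n. \<Sum>t<n. A $$ (i, t) * adj_coeff A j t i)"
proof -
  have "(\<Sum>i<n. adj_coeff A (Suc j) i i)
      = (\<Sum>i<n. (\<Sum>t<n. A $$ (i, t) * adj_coeff A j t i) + rev_coeff A (Suc j))"
    using adj_coeff_0_and_Suc(2)[OF A] by (intro sum.cong) auto
  also have "\<dots> = (\<Sum>i<n. \<Sum>t<n. A $$ (i, t) * adj_coeff A j t i) + of_nat n * rev_coeff A (Suc j)"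
    by (simp add: sum.distrib)
  finally have "(\<Sum>i<n. \<Sum>t<n. A $$ (i, t) * adj_coeff A j t i)
      = (of_nat n - of_nat (Suc j)) * rev_coeff A (Suc j) - of_nat n * rev_coeff A (Suc j)"
    unfolding sum_adj_coeff_diag[OF A] by simp
  then show ?thesis by (simp add: left_diff_distrib del: of_nat_Suc)
qed

text \<open>The entry at \<open>i\<close> of \<open>A\<^sup>l \<one>\<close>; for an adjacency matrix, the number of walks of length
  \<open>l\<close> that start at \<open>i\<close>.\<close>

primrec walks :: "'a :: comm_ring_1 mat \<Rightarrow> nat \<Rightarrow> nat \<Rightarrow> 'a" where
  "walks A 0 i = 1"
| "walks A (Suc l) i = (\<Sum>t<dim_row A. A $$ (i, t) * walks A l t)"

text \<open>Applied to \<open>\<one>\<close>, the recursion unrolls to \<open>E j \<one> = (\<Sum>l\<le>j. r (j - l) A\<^sup>l \<one>)\<close>.\<close>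

lemma sum_adj_coeff_row:
  fixes A :: "'a :: idom mat"
  assumes A: "A \<in> carrier_mat n n" and i: "i < n"
  shows "(\<Sum>k<n. adj_coeff A j i k) = (\<Sum>l\<le>j. rev_coeff A (j - l) * walks A l i)"
  using i
proof (induction j arbitrary: i)
  case 0
  have "rev_coeff A 0 = 1" using degree_monic_char_poly[OF A] A by (simp add: rev_coeff_def)
  then show ?case using 0 adj_coeff_0_and_Suc(1)[OF A] by simp
next
  case (Suc j)
  have n: "dim_row A = n" using A by simp
  have "(\<Sum>k<n. adj_coeff A (Suc j) i k)
      = (\<Sum>k<n. \<Sum>t<n. A $$ (i, t) * adj_coeff A j t k) + rev_coeff A (Suc j)"
    using adj_coeff_0_and_Suc(2)[OF A Suc.prems] Suc.prems by (simp add: sum.distrib)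
  also have "(\<Sum>k<n. \<Sum>t<n. A $$ (i, t) * adj_coeff A j t k)
      = (\<Sum>t<n. A $$ (i, t) * (\<Sum>k<n. adj_coeff A j t k))"
    by (subst sum.swap) (simp add: sum_distrib_left)
  also have "\<dots> = (\<Sum>t<n. \<Sum>l\<le>j. rev_coeff A (j - l) * (A $$ (i, t) * walks A l t))"
    by (intro sum.cong refl) (simp add: Suc.IH sum_distrib_left mult.left_commute)
  also have "\<dots> = (\<Sum>l\<le>j. rev_coeff A (j - l) * walks A (Suc l) i)"
    by (subst sum.swap) (simp add: n sum_distrib_left)
  finally show ?case by (simp add: sum.atMost_Suc_shift add.commute del: sum.atMost_Suc)
qed

section \<open>The characteristic polynomial of the complement\<close>

text \<open>If row \<open>k\<close> is constantly 1, adding 1 to another row means adding row \<open>k\<close> to it.\<close>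

lemma det_row_ones_add_rows:
  fixes M :: "'a :: comm_ring_1 mat"
  assumes M: "M \<in> carrier_mat n n" and k: "k < n" and l: "l \<le> k"
  shows "det (mat n n (\<lambda>(i, j). if i = k then 1 else M $$ (i, j) + (if i < l then 1 else 0)))
    = det (mat n n (\<lambda>(i, j). if i = k then 1 else M $$ (i, j)))"
  using l
proof (induction l)
  case 0
  show ?case by (rule arg_cong[of _ _ det], rule eq_matI) auto
next
  case (Suc l)
  let ?T = "\<lambda>l. mat n n (\<lambda>(i, j). if i = k then 1 else M $$ (i, j) + (if i < l then 1 else 0))"
  have "?T (Suc l) = addrow 1 l k (?T l)"
    using Suc.prems k by (intro eq_matI) (auto simp: less_Suc_eq)
  then have "det (?T (Suc l)) = det (?T l)"
    using det_addrow[of k n l "?T l" 1] k Suc.prems by simp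
  then show ?case using Suc by simp
qed

text \<open>The case \<open>u = v = \<one>\<close> of \<open>det (M + u v\<^sup>T) = det M + v\<^sup>T adj M u\<close>.  The rows of \<open>M\<close> are raised by
  \<open>\<one>\<close> one after the other; by linearity in row \<open>k\<close> each step adds the determinant of a matrix with
  row \<open>k\<close> equal to \<open>\<one>\<close>, in which the rows raised before may be restored.\<close>

lemma det_add_all_ones:
  fixes M :: "'a :: comm_ring_1 mat"
  assumes M: "M \<in> carrier_mat n n"
  shows "det (mat n n (\<lambda>(i, j). M $$ (i, j) + 1)) = det M + (\<Sum>i<n. \<Sum>j<n. cofactor M i j)"
proof -
  let ?U = "\<lambda>l. mat n n (\<lambda>(i, j). M $$ (i, j) + (if i < l then 1 else 0))"
  have step: "det (?U (Suc k)) = det (?U k) + (\<Sum>j<n. cofactor M k j)" if k: "k < n" for k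
  proof -
    let ?W = "mat n n (\<lambda>(i, j). if i = k then 1 else M $$ (i, j))"
    let ?c = "\<lambda>i. vec n (\<lambda>j. M $$ (i, j) + (if i < k then 1 else 0))"
    have "det (?U (Suc k)) = det (mat\<^sub>r n n (\<lambda>i. if i = k then ?c i + vec n (\<lambda>_. 1) else ?c i))"
      by (rule arg_cong[of _ _ det], rule eq_matI) (auto simp: less_Suc_eq)
    also have "\<dots> = det (mat\<^sub>r n n (\<lambda>i. if i = k then ?c i else ?c i)) +
        det (mat\<^sub>r n n (\<lambda>i. if i = k then vec n (\<lambda>_. 1) else ?c i))"
      by (rule det_row_add[OF _ _ _ k]) auto
    also have "mat\<^sub>r n n (\<lambda>i. if i = k then ?c i else ?c i) = ?U k"
      by (rule eq_matI) auto
    also have "mat\<^sub>r n n (\<lambda>i. if i = k then vec n (\<lambda>_. 1) else ?c i)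
        = mat n n (\<lambda>(i, j). if i = k then 1 else M $$ (i, j) + (if i < k then 1 else 0))"
      by (rule eq_matI) auto
    also have "det \<dots> = det ?W" by (rule det_row_ones_add_rows[OF M k order_refl])
    also have "\<dots> = (\<Sum>j<n. ?W $$ (k, j) * cofactor ?W k j)"
      by (rule laplace_expansion_row[OF _ k]) simp
    also have "\<dots> = (\<Sum>j<n. cofactor M k j)"
    proof (intro sum.cong refl)
      fix j assume j: "j \<in> {..<n}"
      have "mat_delete ?W k j = mat_delete M k j"
        using M k j by (intro eq_matI) (auto simp: mat_delete_def)
      then show "?W $$ (k, j) * cofactor ?W k j = cofactor M k j"
        using k j by (simp add: cofactor_def)
    qed
    finally show ?thesis .
  qed
  have "l \<le> n \<Longrightarrow> det (?U l) = det M + (\<Sum>i<l. \<Sum>j<n. cofactor M i j)" for l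
  proof (induction l)
    case 0
    have "?U 0 = M" using M by (intro eq_matI) auto
    then show ?case by simp
  next
    case (Suc l)
    then show ?case using step[of l] by (simp add: add.assoc)
  qed
  from this[of n] have "det (?U n) = det M + (\<Sum>i<n. \<Sum>j<n. cofactor M i j)" by simp
  moreover have "?U n = mat n n (\<lambda>(i, j). M $$ (i, j) + 1)" by (rule eq_matI) auto
  ultimately show ?thesis by simp
qed

text \<open>With \<open>y = - x - 1\<close> one has \<open>x I - (J - I - A) = - (y I - A + J)\<close>, and the preceding lemma
  applies to \<open>y I - A\<close>.\<close>

lemma char_poly_complement_matrix:
  fixes A :: "'a :: comm_ring_1 mat"
  assumes A: "A \<in> carrier_mat n n"
  shows "char_poly (mat n n (\<lambda>(i, j). (if i = j then 0 else 1) - A $$ (i, j)))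
    = (-1) ^ n * pcompose (char_poly A + (\<Sum>i<n. \<Sum>j<n. adj_mat (char_poly_matrix A) $$ (i, j))) [:-1, -1:]"
proof -
  let ?y = "[:-1, -1:] :: 'a poly" and ?C = "char_poly_matrix A"
  have hom: "comm_ring_hom (\<lambda>p. pcompose p ?y)" ..
  let ?M = "map_mat (\<lambda>p. pcompose p ?y) ?C"
  have C: "?C \<in> carrier_mat n n" and M: "?M \<in> carrier_mat n n" using A by auto
  have "char_poly_matrix (mat n n (\<lambda>(i, j). (if i = j then 0 else 1) - A $$ (i, j)))
      = (-1) \<cdot>\<^sub>m mat n n (\<lambda>(i, j). ?M $$ (i, j) + 1)"
    using A by (intro eq_matI)
      (auto simp: char_poly_matrix_def pcompose_pCons pcompose_diff pcompose_add one_pCons)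
  then have "char_poly (mat n n (\<lambda>(i, j). (if i = j then 0 else 1) - A $$ (i, j)))
      = (-1) ^ n * (det ?M + (\<Sum>i<n. \<Sum>j<n. cofactor ?M i j))"
    unfolding char_poly_def by (simp add: det_add_all_ones[OF M])
  moreover have "det ?M = pcompose (char_poly A) ?y"
    unfolding char_poly_def by (rule comm_ring_hom.hom_det[OF hom])
  moreover have "cofactor ?M i j = pcompose (adj_mat ?C $$ (j, i)) ?y" if "i < n" "j < n" for i j
  proof -
    have "mat_delete ?M i j = map_mat (\<lambda>p. pcompose p ?y) (mat_delete ?C i j)"
      using that C by (intro eq_matI) (auto simp: mat_delete_def)
    then show ?thesis using that C carrier_matD[OF C]
      by (simp add: cofactor_def adj_mat_def comm_ring_hom.hom_det[OF hom] pcompose_hom.hom_mult pcompose_hom.hom_power pcompose_hom.hom_uminus)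
  qed
  moreover have "(\<Sum>i<n. \<Sum>j<n. pcompose (adj_mat ?C $$ (j, i)) ?y)
      = pcompose (\<Sum>i<n. \<Sum>j<n. adj_mat ?C $$ (i, j)) ?y"
    by (subst sum.swap) (simp add: pcompose_hom.hom_sum)
  ultimately show ?thesis by (simp add: pcompose_add)
qed

text \<open>The polynomial \<open>\<phi> + \<one>\<^sup>T adj (x I - A) \<one>\<close>, which is \<open>det (x I - A + J)\<close>.\<close>

definition walk_poly :: "'a :: comm_ring_1 mat \<Rightarrow> 'a poly" where
  "walk_poly A = (let n = dim_row A in
     char_poly A + (\<Sum>i<n. \<Sum>j<n. adj_mat (char_poly_matrix A) $$ (i, j)))"

definition total_walks :: "'a :: comm_ring_1 mat \<Rightarrow> nat \<Rightarrow> 'a" where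
  "total_walks A l = (\<Sum>i<dim_row A. walks A l i)"

lemma sum_adj_coeff:
  fixes A :: "'a :: idom mat"
  assumes A: "A \<in> carrier_mat n n"
  shows "(\<Sum>i<n. \<Sum>k<n. adj_coeff A j i k) = (\<Sum>l\<le>j. rev_coeff A (j - l) * total_walks A l)"
proof -
  have "(\<Sum>i<n. \<Sum>k<n. adj_coeff A j i k) = (\<Sum>i<n. \<Sum>l\<le>j. rev_coeff A (j - l) * walks A l i)"
    by (rule sum.cong[OF refl]) (simp add: sum_adj_coeff_row[OF A])
  also have "\<dots> = (\<Sum>l\<le>j. rev_coeff A (j - l) * (\<Sum>i<n. walks A l i))"
    by (subst sum.swap) (simp add: sum_distrib_left)
  finally show ?thesis using A by (simp add: total_walks_def)
qed

text \<open>The Cayley-Hamilton theorem between \<open>\<one>\<^sup>T\<close> and \<open>\<one>\<close>, obtained from the vanishing of \<open>E n\<close>.\<close>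

lemma char_poly_annihilates_total_walks:
  fixes A :: "'a :: idom mat"
  assumes A: "A \<in> carrier_mat n n"
  shows "(\<Sum>l\<le>n. coeff (char_poly A) l * total_walks A l) = 0"
proof -
  have "(\<Sum>l\<le>n. rev_coeff A (n - l) * total_walks A l) = 0"
    using sum_adj_coeff[OF A, of n] A by (simp add: adj_coeff_def)
  moreover have "rev_coeff A (n - l) = coeff (char_poly A) l" if "l \<le> n" for l
    using A that by (simp add: rev_coeff_def)
  ultimately show ?thesis by simp
qed

lemma degree_walk_poly:
  fixes A :: "'a :: idom mat"
  assumes A: "A \<in> carrier_mat n n"
  shows "degree (walk_poly A) \<le> n"
proof -
  have "degree (adj_mat (char_poly_matrix A) $$ (i, j)) \<le> n" if "i < n" "j < n" for i j
    using degree_adj_mat_char[OF A that] by simp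
  then show ?thesis unfolding walk_poly_def
    using A degree_monic_char_poly[OF A]
    by (auto simp: Let_def intro!: degree_add_le degree_sum_le)
qed

lemma coeff_walk_poly:
  fixes A :: "'a :: idom mat"
  assumes A: "A \<in> carrier_mat n n" and k: "k \<le> n"
  shows "coeff (walk_poly A) k
    = coeff (char_poly A) k + (\<Sum>l<n. coeff (char_poly A) (k + 1 + l) * total_walks A l)"
proof -
  have n: "dim_row A = n" using A by simp
  have deg: "degree (char_poly A) = n" using degree_monic_char_poly[OF A] by simp
  have "(\<Sum>i<n. \<Sum>j<n. coeff (adj_mat (char_poly_matrix A) $$ (i, j)) k)
      = (\<Sum>l<n. coeff (char_poly A) (k + 1 + l) * total_walks A l)"
  proof (cases "k < n")
    case True
    then have "(\<Sum>i<n. \<Sum>j<n. coeff (adj_mat (char_poly_matrix A) $$ (i, j)) k)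
        = (\<Sum>i<n. \<Sum>j<n. adj_coeff A (n - 1 - k) i j)"
      by (intro sum.cong) (auto simp: adj_coeff_def n)
    also have "\<dots> = (\<Sum>l\<le>n - 1 - k. coeff (char_poly A) (k + 1 + l) * total_walks A l)"
      unfolding sum_adj_coeff[OF A] using True
      by (intro sum.cong) (auto simp: rev_coeff_def n intro!: arg_cong[of _ _ "coeff (char_poly A)"])
    also have "\<dots> = (\<Sum>l<n. coeff (char_poly A) (k + 1 + l) * total_walks A l)"
      using True deg by (intro sum.mono_neutral_left) (auto simp: coeff_eq_0)
    finally show ?thesis .
  next
    case False
    then have "coeff (adj_mat (char_poly_matrix A) $$ (i, j)) k = 0" if "i < n" "j < n" for i j
      using degree_adj_mat_char[OF A that] that by (intro coeff_eq_0) simp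
    moreover have "coeff (char_poly A) (k + 1 + l) = 0" for l
      using False deg by (intro coeff_eq_0) simp
    ultimately show ?thesis by simp
  qed
  then show ?thesis by (simp add: walk_poly_def Let_def n coeff_sum)
qed

text \<open>Horner's scheme in powers of \<open>x + 1\<close> for leading coefficients first.  The alternating signs
  turn \<open>(- x - 1) ^ k\<close>, together with the factor \<open>(-1) ^ n\<close>, into \<open>(x + 1) ^ k\<close>.\<close>

primrec horner_shift :: "(nat \<Rightarrow> int) \<Rightarrow> nat \<Rightarrow> int poly" where
  "horner_shift a 0 = 0"
| "horner_shift a (Suc t) = [:1, 1:] * horner_shift a t + [:(-1) ^ t * a t:]"

lemma horner_shift_eq:
  assumes "degree p \<le> n"
  shows "horner_shift (\<lambda>t. coeff p (n - t)) (Suc n) = (-1) ^ n * pcompose p [:-1, -1:]"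
proof -
  let ?a = "\<lambda>t. coeff p (n - t)"
  have "horner_shift ?a t = (\<Sum>s<t. Polynomial.smult ((-1) ^ s * ?a s) ([:1, 1:] ^ (t - 1 - s)))" for t
  proof (induction t)
    case (Suc t)
    have "[:1, 1:] * (\<Sum>s<t. Polynomial.smult ((-1) ^ s * ?a s) ([:1, 1:] ^ (t - 1 - s)))
        = (\<Sum>s<t. Polynomial.smult ((-1) ^ s * ?a s) ([:1, 1:] ^ Suc (t - 1 - s)))"
      unfolding sum_distrib_left by simp
    also have "\<dots> = (\<Sum>s<t. Polynomial.smult ((-1) ^ s * ?a s) ([:1, 1:] ^ (Suc t - 1 - s)))"
      by (intro sum.cong) (auto simp: Suc_diff_Suc)
    finally show ?case by (simp add: Suc.IH)
  qed simp
  then have "horner_shift ?a (Suc n) = (\<Sum>s\<le>n. Polynomial.smult ((-1) ^ s * ?a s) ([:1, 1:] ^ (n - s)))"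
    by (simp add: lessThan_Suc_atMost del: sum.lessThan_Suc)
  also have "\<dots> = (\<Sum>k\<le>n. Polynomial.smult ((-1) ^ (n - k) * coeff p k) ([:1, 1:] ^ k))"
    by (rule sum.reindex_bij_witness[of _ "\<lambda>k. n - k" "\<lambda>k. n - k"]) auto
  also have "\<dots> = (-1) ^ n * (\<Sum>k\<le>n. Polynomial.smult (coeff p k) ([:-1, -1:] ^ k))"
    unfolding sum_distrib_left
  proof (intro sum.cong refl)
    fix k assume "k \<in> {..n}"
    then have k: "(-1 :: int) ^ (n - k) = (-1) ^ n * (-1) ^ k"
      by (simp add: minus_one_power_iff)
    have y: "[:-1, -1:] = Polynomial.smult (-1) [:1, 1 :: int:]" by simp
    have s: "(-1) ^ n * q = Polynomial.smult ((-1) ^ n) q" for q :: "int poly"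
      by (cases "even n") auto
    show "Polynomial.smult ((-1) ^ (n - k) * coeff p k) ([:1, 1:] ^ k)
        = (-1) ^ n * Polynomial.smult (coeff p k) ([:-1, -1:] ^ k)"
      unfolding k y smult_power s by (simp only: smult_smult) (simp only: mult_ac)
  qed
  also have "(\<Sum>k\<le>n. Polynomial.smult (coeff p k) ([:-1, -1:] ^ k)) = pcompose p [:-1, -1:]"
  proof -
    have "pcompose p [:-1, -1:] = (\<Sum>k\<le>degree p. Polynomial.smult (coeff p k) ([:-1, -1:] ^ k))"
      by (simp add: pcompose_altdef poly_altdef coeff_map_poly degree_map_poly)
    also have "\<dots> = (\<Sum>k\<le>n. Polynomial.smult (coeff p k) ([:-1, -1:] ^ k))"
      using assms by (intro sum.mono_neutral_left) (auto simp: coeff_eq_0)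
    finally show ?thesis by simp
  qed
  finally show ?thesis .
qed

text \<open>Multiplication by \<open>x + 1\<close> at most doubles the largest coefficient.\<close>

lemma horner_shift_bound:
  assumes "\<And>t. \<bar>a t\<bar> \<le> b"
  shows "\<bar>coeff (horner_shift a t) j\<bar> \<le> 2 ^ t * b"
proof -
  have "\<bar>coeff (horner_shift a t) j\<bar> \<le> (2 ^ t - 1) * b" for t j
  proof (induction t arbitrary: j)
    case (Suc t)
    have c: "\<bar>(-1) ^ t * a t\<bar> \<le> b" using assms[of t] by (simp add: abs_mult)
    have "\<bar>coeff (horner_shift a (Suc t)) j\<bar> \<le> (2 ^ t - 1) * b + (2 ^ t - 1) * b + b"
    proof (cases j)
      case 0
      have "coeff (horner_shift a (Suc t)) 0 = coeff (horner_shift a t) 0 + (-1) ^ t * a t" by simp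
      then show ?thesis using Suc[of 0] c unfolding 0 by linarith
    next
      case (Suc i)
      have "coeff (horner_shift a (Suc t)) j = coeff (horner_shift a t) (Suc i) + coeff (horner_shift a t) i"
        using Suc by simp
      then show ?thesis using Suc.IH[of i] Suc.IH[of "Suc i"] assms[of t] by linarith
    qed
    then show ?case by (simp add: algebra_simps)
  qed simp
  moreover have "(2 ^ t - 1) * b \<le> 2 ^ t * b" using assms[of 0] by (simp add: mult_right_mono)
  ultimately show ?thesis by (rule order_trans)
qed

section \<open>Bounds on coefficients and walk numbers\<close>

text \<open>By the trace formula, \<open>r (j + 1)\<close> is at most \<open>n\<^sup>2\<close> times the largest entry of \<open>E j\<close> in absolute
  value; the recursion then bounds \<open>E (j + 1)\<close>.  So the bit lengths of the deck and of \<open>\<phi>\<close> are polynomial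
  in \<open>n\<close>.\<close>

lemma coeff_bounds:
  fixes A :: "int mat"
  assumes A: "A \<in> carrier_mat n n" and a: "\<And>i j. i < n \<Longrightarrow> j < n \<Longrightarrow> \<bar>A $$ (i, j)\<bar> \<le> 1"
  shows "\<And>i k. i < n \<Longrightarrow> k < n \<Longrightarrow> \<bar>adj_coeff A j i k\<bar> \<le> (2 * int n ^ 2) ^ j"
    and "\<bar>rev_coeff A j\<bar> \<le> (2 * int n ^ 2) ^ j"
proof -
  have "(\<forall>i<n. \<forall>k<n. \<bar>adj_coeff A j i k\<bar> \<le> (2 * int n ^ 2) ^ j) \<and> \<bar>rev_coeff A j\<bar> \<le> (2 * int n ^ 2) ^ j"
  proof (induction j)
    case 0
    show ?case using adj_coeff_0_and_Suc(1)[OF A] degree_monic_char_poly[OF A] A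
      by (simp add: rev_coeff_def)
  next
    case (Suc j)
    let ?X = "(2 * int n ^ 2) ^ j"
    have entry: "\<bar>A $$ (i, t) * adj_coeff A j t k\<bar> \<le> ?X" if "i < n" "t < n" "k < n" for i t k
      using mult_mono[OF a[OF that(1,2)] Suc[THEN conjunct1, rule_format, OF that(2,3)]]
      by (simp add: abs_mult)
    have row: "\<bar>\<Sum>t<n. A $$ (i, t) * adj_coeff A j t k\<bar> \<le> int n * ?X" if "i < n" "k < n" for i k
      using order_trans[OF sum_abs sum_bounded_above[of "{..<n}" _ ?X]] entry that by simp
    have "\<bar>\<Sum>i<n. \<Sum>t<n. A $$ (i, t) * adj_coeff A j t i\<bar> \<le> int n * (int n * ?X)"
      using order_trans[OF sum_abs sum_bounded_above[of "{..<n}" _ "int n * ?X"]] row by simp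
    then have "\<bar>int (Suc j) * rev_coeff A (Suc j)\<bar> \<le> int n ^ 2 * ?X"
      unfolding trace_step_rev_coeff[OF A] of_nat_id by (simp add: power2_eq_square mult.assoc)
    moreover have "\<bar>rev_coeff A (Suc j)\<bar> \<le> \<bar>int (Suc j) * rev_coeff A (Suc j)\<bar>"
      by (simp add: abs_mult mult_le_cancel_right1)
    ultimately have r: "\<bar>rev_coeff A (Suc j)\<bar> \<le> int n ^ 2 * ?X" by linarith
    have nn: "int n * ?X \<le> int n ^ 2 * ?X"
      by (intro mult_right_mono) (auto simp: power2_eq_square mult_le_cancel_left1)
    have "\<bar>adj_coeff A (Suc j) i k\<bar> \<le> int n ^ 2 * ?X + int n ^ 2 * ?X" if ik: "i < n" "k < n" for i k
    proof -
      have "\<bar>adj_coeff A (Suc j) i k\<bar>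
          \<le> \<bar>\<Sum>t<n. A $$ (i, t) * adj_coeff A j t k\<bar> + \<bar>rev_coeff A (Suc j)\<bar>"
        unfolding adj_coeff_0_and_Suc(2)[OF A ik] by auto
      with row[OF ik] nn r show ?thesis by linarith
    qed
    moreover have "0 \<le> int n ^ 2 * ?X" by simp
    ultimately show ?case using r by (auto simp: algebra_simps)
  qed
  then show "\<And>i k. i < n \<Longrightarrow> k < n \<Longrightarrow> \<bar>adj_coeff A j i k\<bar> \<le> (2 * int n ^ 2) ^ j"
    and "\<bar>rev_coeff A j\<bar> \<le> (2 * int n ^ 2) ^ j" by auto
qed

lemma walks_bound:
  fixes A :: "int mat"
  assumes A: "A \<in> carrier_mat n n" and a: "\<And>i j. i < n \<Longrightarrow> j < n \<Longrightarrow> \<bar>A $$ (i, j)\<bar> \<le> 1"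
    and i: "i < n"
  shows "\<bar>walks A l i\<bar> \<le> int n ^ l"
  using i
proof (induction l arbitrary: i)
  case (Suc l)
  have "\<bar>A $$ (i, t) * walks A l t\<bar> \<le> int n ^ l" if "t < n" for t
    using mult_mono[OF a[OF Suc.prems that] Suc.IH[OF that]] by (simp add: abs_mult)
  then show ?case
    using A order_trans[OF sum_abs sum_bounded_above[of "{..<n}" "\<lambda>t. \<bar>A $$ (i, t) * walks A l t\<bar>" "int n ^ l"]]
    by simp
qed simp

section \<open>Codegrees and closed walks\<close>

text \<open>The variables stand for the six possible edges on four vertices.\<close>

lemma four_vertex_arithmetic:
  fixes a b c d e f :: int
  assumes "a = 0 \<or> a = 1" "b = 0 \<or> b = 1" "c = 0 \<or> c = 1" "d = 0 \<or> d = 1" "e = 0 \<or> e = 1" "f = 0 \<or> f = 1"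
  shows "(b * d + c * e \<le> 1 \<and> a * d + c * f \<le> 1 \<and> a * e + b * f \<le> 1 \<and>
     a * b + e * f \<le> 1 \<and> a * c + d * f \<le> 1 \<and> b * c + d * e \<le> 1)
   \<longleftrightarrow> \<not> (2 \<le> a + b + c \<and> 2 \<le> a + d + e \<and> 2 \<le> b + d + f \<and> 2 \<le> c + e + f)"
  using assms(1)
proof
  assume "a = 0" with assms(2-) show ?thesis by (elim disjE; simp)
next
  assume "a = 1" with assms(2-) show ?thesis by (elim disjE; simp)
qed

locale adjacency =
  fixes A :: "int mat" and n :: nat
  assumes carrier: "A \<in> carrier_mat n n"
    and entry: "\<And>i j. i < n \<Longrightarrow> j < n \<Longrightarrow> A $$ (i, j) = 0 \<or> A $$ (i, j) = 1"
    and diag: "\<And>i. i < n \<Longrightarrow> A $$ (i, i) = 0"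
    and sym: "\<And>i j. i < n \<Longrightarrow> j < n \<Longrightarrow> A $$ (i, j) = A $$ (j, i)"
begin

abbreviation "rc \<equiv> rev_coeff A"

definition "degr i = (\<Sum>t<n. A $$ (i, t))"
definition "codeg i j = (\<Sum>t<n. A $$ (i, t) * A $$ (t, j))"
definition "closed4 i = (\<Sum>u<n. codeg i u ^ 2)"

lemma dim: "dim_row A = n" using carrier by simp

lemma abs_entry: "i < n \<Longrightarrow> j < n \<Longrightarrow> \<bar>A $$ (i, j)\<bar> \<le> 1"
  using entry[of i j] by auto

lemma walks_1: "walks A (Suc 0) i = degr i"
  by (simp add: dim degr_def)

lemma codeg_sym: "i < n \<Longrightarrow> j < n \<Longrightarrow> codeg i j = codeg j i"
  unfolding codeg_def by (intro sum.cong refl) (simp add: sym mult.commute)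

lemma codeg_diag: assumes "i < n" shows "codeg i i = degr i"
proof -
  have "A $$ (i, t) * A $$ (t, i) = A $$ (i, t)" if "t < n" for t
    using entry[OF assms that] sym[OF assms that] by auto
  then show ?thesis unfolding codeg_def degr_def by (intro sum.cong refl) blast
qed

lemma codeg_nonneg: assumes "i < n" "j < n" shows "0 \<le> codeg i j"
proof -
  have "0 \<le> A $$ (i, t) * A $$ (t, j)" if "t < n" for t
    using entry[OF assms(1) that] entry[OF that assms(2)] by auto
  then show ?thesis unfolding codeg_def by (intro sum_nonneg) auto
qed

lemma sum_codeg: "(\<Sum>u<n. codeg i u) = walks A 2 i"
proof -
  have "(\<Sum>u<n. codeg i u) = (\<Sum>t<n. \<Sum>u<n. A $$ (i, t) * A $$ (t, u))"
    unfolding codeg_def by (rule sum.swap)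
  then show ?thesis by (simp add: dim numeral_2_eq_2 sum_distrib_left)
qed

text \<open>Every vertex \<open>t\<close> is the middle of \<open>degr t ^ 2\<close> walks of length 2.\<close>

lemma sum_walks_2: "(\<Sum>i<n. walks A 2 i) = (\<Sum>i<n. degr i ^ 2)"
proof -
  have "(\<Sum>i<n. walks A 2 i) = (\<Sum>i<n. \<Sum>t<n. A $$ (i, t) * degr t)"
    by (simp add: numeral_2_eq_2 dim degr_def)
  also have "\<dots> = (\<Sum>t<n. \<Sum>i<n. A $$ (t, i) * degr t)"
    by (subst sum.swap) (simp add: sym)
  also have "\<dots> = (\<Sum>i<n. degr i ^ 2)"
    unfolding power2_eq_square by (simp add: degr_def sum_distrib_right)
  finally show ?thesis .
qed

text \<open>The trace of \<open>A\<close> is 0, so \<open>E 1 = A\<close>.\<close>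

lemma adj_coeff_1: "i < n \<Longrightarrow> k < n \<Longrightarrow> adj_coeff A (Suc 0) i k = A $$ (i, k)"
  and rev_coeff_1: "rc (Suc 0) = 0"
proof -
  show r: "rc (Suc 0) = 0"
    using trace_step_rev_coeff[OF carrier, of 0] adj_coeff_0_and_Suc(1)[OF carrier] diag
    by simp
  show "i < n \<Longrightarrow> k < n \<Longrightarrow> adj_coeff A (Suc 0) i k = A $$ (i, k)"
    using adj_coeff_0_and_Suc[OF carrier] r by (simp add: if_distrib[of "(*) _"] cong: if_cong)
qed

lemma adj_coeff_2:
  assumes "i < n" "k < n"
  shows "adj_coeff A 2 i k = codeg i k + (if i = k then rc 2 else 0)"
  using adj_coeff_0_and_Suc(2)[OF carrier assms, of 1] adj_coeff_1 assms
  by (simp add: codeg_def numeral_2_eq_2)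

lemma sum_degr: "(\<Sum>i<n. degr i) = - 2 * rc 2"
proof -
  have "2 * rc 2 = - (\<Sum>i<n. codeg i i)"
    using trace_step_rev_coeff[OF carrier, of 1] adj_coeff_1
    by (simp add: codeg_def numeral_2_eq_2)
  then show ?thesis by (simp add: codeg_diag)
qed

lemma adj_coeff_2_diag: "i < n \<Longrightarrow> adj_coeff A 2 i i = degr i + rc 2"
  by (simp add: adj_coeff_2 codeg_diag)

lemma adj_coeff_3:
  assumes "i < n" "k < n"
  shows "adj_coeff A 3 i k = (\<Sum>t<n. A $$ (i, t) * codeg t k) + rc 2 * A $$ (i, k)
    + (if i = k then rc 3 else 0)"
proof -
  have "(\<Sum>t<n. A $$ (i, t) * adj_coeff A 2 t k)
      = (\<Sum>t<n. A $$ (i, t) * codeg t k + (if t = k then rc 2 * A $$ (i, k) else 0))"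
    using assms by (intro sum.cong) (auto simp: adj_coeff_2 algebra_simps)
  also have "\<dots> = (\<Sum>t<n. A $$ (i, t) * codeg t k) + rc 2 * A $$ (i, k)"
    using assms by (simp add: sum.distrib)
  finally show ?thesis
    using adj_coeff_0_and_Suc(2)[OF carrier assms, of 2] by (simp add: numeral_2_eq_2 numeral_3_eq_3)
qed

text \<open>Unrolling the recursion four times; the terms with odd powers of \<open>A\<close> drop out, as \<open>r 1 = 0\<close> and
  \<open>A\<close> has zero diagonal.\<close>

lemma adj_coeff_4_diag:
  assumes i: "i < n"
  shows "adj_coeff A 4 i i = closed4 i + rc 2 * degr i + rc 4"
proof -
  have "(\<Sum>t<n. A $$ (i, t) * adj_coeff A 3 t i)
      = (\<Sum>t<n. A $$ (i, t) * (\<Sum>u<n. A $$ (t, u) * codeg u i)) + rc 2 * codeg i i"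
  proof -
    have "(\<Sum>t<n. A $$ (i, t) * adj_coeff A 3 t i)
        = (\<Sum>t<n. A $$ (i, t) * (\<Sum>u<n. A $$ (t, u) * codeg u i) + rc 2 * (A $$ (i, t) * A $$ (t, i)))"
      using i diag[OF i] by (intro sum.cong) (auto simp: adj_coeff_3 algebra_simps)
    then show ?thesis by (simp add: sum.distrib sum_distrib_left codeg_def)
  qed
  also have "(\<Sum>t<n. A $$ (i, t) * (\<Sum>u<n. A $$ (t, u) * codeg u i))
      = (\<Sum>u<n. \<Sum>t<n. A $$ (i, t) * A $$ (t, u) * codeg u i)"
    by (subst sum.swap) (simp add: sum_distrib_left mult.assoc)
  also have "\<dots> = (\<Sum>u<n. codeg i u * codeg u i)"
    by (simp add: codeg_def sum_distrib_right)
  also have "\<dots> = closed4 i"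
    unfolding closed4_def power2_eq_square using codeg_sym i by (intro sum.cong) auto
  finally have "(\<Sum>t<n. A $$ (i, t) * adj_coeff A 3 t i) = closed4 i + rc 2 * degr i"
    using codeg_diag[OF i] by simp
  then show ?thesis
    using adj_coeff_0_and_Suc(2)[OF carrier i i, of 3] by (simp add: eval_nat_numeral)
qed

lemma sum_closed4: "(\<Sum>i<n. closed4 i) = 2 * rc 2 ^ 2 - 4 * rc 4"
proof -
  have "(int n - 4) * rc 4 = (\<Sum>i<n. closed4 i + rc 2 * degr i + rc 4)"
    using sum_adj_coeff_diag[OF carrier, of 4] adj_coeff_4_diag by simp
  also have "\<dots> = (\<Sum>i<n. closed4 i) + rc 2 * (- 2 * rc 2) + int n * rc 4"
    by (simp add: sum.distrib sum_distrib_left[symmetric] sum_degr)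
  finally show ?thesis by (simp add: algebra_simps power2_eq_square)
qed

definition "quad_free \<longleftrightarrow> (\<forall>i<n. \<forall>u<n. i \<noteq> u \<longrightarrow> codeg i u \<le> 1)"

text \<open>Codegrees are natural numbers, so none exceeds its square, and equality means at most 1.\<close>

lemma closed4_ge:
  assumes i: "i < n"
  shows "degr i ^ 2 - degr i + walks A 2 i \<le> closed4 i"
    and "closed4 i = degr i ^ 2 - degr i + walks A 2 i \<longleftrightarrow> (\<forall>u<n. i \<noteq> u \<longrightarrow> codeg i u \<le> 1)"
proof -
  have split: "(\<Sum>u<n. f u) = f i + (\<Sum>u\<in>{..<n} - {i}. f u)" for f :: "nat \<Rightarrow> int"
    using i by (intro sum.remove) auto
  have d: "closed4 i - (degr i ^ 2 - degr i + walks A 2 i)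
      = (\<Sum>u\<in>{..<n} - {i}. codeg i u ^ 2 - codeg i u)"
    unfolding closed4_def sum_codeg[symmetric] split[of "\<lambda>u. codeg i u ^ 2"] split[of "codeg i"]
    by (simp add: codeg_diag[OF i] sum_subtractf)
  have nn: "0 \<le> codeg i u ^ 2 - codeg i u" if "u < n" for u
    using codeg_nonneg[OF i that] by (simp add: power2_eq_square mult_le_cancel_left1)
  have "0 \<le> (\<Sum>u\<in>{..<n} - {i}. codeg i u ^ 2 - codeg i u)"
    using nn by (intro sum_nonneg) auto
  with d show "degr i ^ 2 - degr i + walks A 2 i \<le> closed4 i" by simp
  have "(\<Sum>u\<in>{..<n} - {i}. codeg i u ^ 2 - codeg i u) = 0
      \<longleftrightarrow> (\<forall>u\<in>{..<n} - {i}. codeg i u ^ 2 - codeg i u = 0)"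
    using nn by (intro sum_nonneg_eq_0_iff) auto
  moreover have "codeg i u ^ 2 - codeg i u = 0 \<longleftrightarrow> codeg i u \<le> 1" if "u < n" for u
    using codeg_nonneg[OF i that] by (auto simp: power2_eq_square)
  ultimately show "closed4 i = degr i ^ 2 - degr i + walks A 2 i
      \<longleftrightarrow> (\<forall>u<n. i \<noteq> u \<longrightarrow> codeg i u \<le> 1)"
    using d by auto
qed

text \<open>The inequalities of the preceding lemma are all equalities if and only if their sum is an equality, and
  the sum is known from \<open>r 2\<close>, \<open>r 4\<close> and the degrees.\<close>

lemma quad_free_iff:
  "quad_free \<longleftrightarrow> 2 * rc 4 = rc 2 ^ 2 - rc 2 - (\<Sum>i<n. degr i ^ 2)"
proof -
  let ?l = "\<lambda>i. degr i ^ 2 - degr i + walks A 2 i"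
  have s: "(\<Sum>i<n. ?l i) = 2 * (\<Sum>i<n. degr i ^ 2) + 2 * rc 2"
    by (simp add: sum.distrib sum_subtractf sum_walks_2 sum_degr)
  have "(\<Sum>i<n. closed4 i - ?l i) = 0 \<longleftrightarrow> (\<forall>i\<in>{..<n}. closed4 i - ?l i = 0)"
    using closed4_ge(1) by (intro sum_nonneg_eq_0_iff) auto
  also have "\<dots> \<longleftrightarrow> quad_free"
    using closed4_ge(2) unfolding quad_free_def by auto
  finally show ?thesis unfolding sum_subtractf s sum_closed4 by auto
qed

lemma quad_free_walks_2:
  assumes "quad_free" and i: "i < n"
  shows "walks A 2 i = adj_coeff A 4 i i - degr i ^ 2 + degr i - rc 2 * degr i - rc 4"
proof -
  have "closed4 i = degr i ^ 2 - degr i + walks A 2 i"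
    using closed4_ge(2)[OF i] assms unfolding quad_free_def by auto
  then show ?thesis using adj_coeff_4_diag[OF i] by simp
qed

text \<open>For \<open>n = 4\<close> the coefficient \<open>r 4\<close> is the constant term, hence not visible in the deck, and the degrees
  have to decide.  In the complement of a graph with minimum degree at least 2 the edges form a
  matching, and removing a matching from \<open>K\<^sub>4\<close> leaves a 4-cycle.\<close>

lemma quad_free_4:
  assumes n4: "n = 4"
  shows "quad_free \<longleftrightarrow> \<not> (\<forall>i<n. 2 \<le> degr i)"
proof -
  have e: "i < 4 \<Longrightarrow> j < 4 \<Longrightarrow> A $$ (i, j) = 0 \<or> A $$ (i, j) = 1" for i j
    using entry n4 by simp
  have all: "(\<forall>i<4. P i) \<longleftrightarrow> P 0 \<and> P 1 \<and> P 2 \<and> P (3::nat)" for P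
    by (auto simp: eval_nat_numeral less_Suc_eq)
  have s: "(\<Sum>t<4. f t) = f 0 + f 1 + f 2 + f (3 :: nat)" for f :: "nat \<Rightarrow> int"
    by (simp add: eval_nat_numeral)
  have z: "A $$ (0, 0) = 0" "A $$ (1, 1) = 0" "A $$ (2, 2) = 0" "A $$ (3, 3) = 0"
    using diag n4 by auto
  have y: "A $$ (1, 0) = A $$ (0, 1)" "A $$ (2, 0) = A $$ (0, 2)" "A $$ (3, 0) = A $$ (0, 3)"
    "A $$ (2, 1) = A $$ (1, 2)" "A $$ (3, 1) = A $$ (1, 3)" "A $$ (3, 2) = A $$ (2, 3)"
    using sym n4 by auto
  have "quad_free \<longleftrightarrow>
      (A $$ (0, 2) * A $$ (1, 2) + A $$ (0, 3) * A $$ (1, 3) \<le> 1 \<and>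
       A $$ (0, 1) * A $$ (1, 2) + A $$ (0, 3) * A $$ (2, 3) \<le> 1 \<and>
       A $$ (0, 1) * A $$ (1, 3) + A $$ (0, 2) * A $$ (2, 3) \<le> 1 \<and>
       A $$ (0, 1) * A $$ (0, 2) + A $$ (1, 3) * A $$ (2, 3) \<le> 1 \<and>
       A $$ (0, 1) * A $$ (0, 3) + A $$ (1, 2) * A $$ (2, 3) \<le> 1 \<and>
       A $$ (0, 2) * A $$ (0, 3) + A $$ (1, 2) * A $$ (1, 3) \<le> 1)"
    unfolding quad_free_def codeg_def unfolding n4 all s z y by (simp add: ac_simps)
  moreover have "(\<forall>i<n. 2 \<le> degr i) \<longleftrightarrow>
      (2 \<le> A $$ (0, 1) + A $$ (0, 2) + A $$ (0, 3) \<and> 2 \<le> A $$ (0, 1) + A $$ (1, 2) + A $$ (1, 3) \<and>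
       2 \<le> A $$ (0, 2) + A $$ (1, 2) + A $$ (2, 3) \<and> 2 \<le> A $$ (0, 3) + A $$ (1, 3) + A $$ (2, 3))"
    unfolding degr_def unfolding n4 all s z y by simp
  ultimately show ?thesis
    using four_vertex_arithmetic[OF e[of 0 1] e[of 0 2] e[of 0 3] e[of 1 2] e[of 1 3] e[of 2 3]]
    by simp
qed

text \<open>Linear dependence of \<open>\<one>\<close>, \<open>A \<one>\<close> and \<open>A\<^sup>2 \<one>\<close> over the rationals.\<close>

definition "walks_dependent \<longleftrightarrow> (\<exists>\<alpha> \<beta> \<gamma> :: rat. (\<alpha>, \<beta>, \<gamma>) \<noteq> (0, 0, 0) \<and>
  (\<forall>i<n. \<alpha> + \<beta> * of_int (degr i) + \<gamma> * of_int (walks A 2 i) = 0))"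

lemma walks_2_const_degr:
  assumes "\<And>j. j < n \<Longrightarrow> degr j = d" and "i < n"
  shows "walks A 2 i = d * d"
proof -
  have "walks A 2 i = (\<Sum>t<n. A $$ (i, t) * degr t)" by (simp add: numeral_2_eq_2 dim degr_def)
  also have "\<dots> = degr i * d" unfolding degr_def[of i] sum_distrib_right by (simp add: assms(1))
  finally show ?thesis by (simp add: assms)
qed

text \<open>If the degrees \<open>degr i\<close> and \<open>degr h\<close> differ, the coefficient of \<open>A\<^sup>2 \<one>\<close> in a dependency is nonzero;
  so the points \<open>(degr j, walks A 2 j)\<close> lie on a line that is not vertical, and the two points
  for \<open>h\<close> and \<open>i\<close> determine it.\<close>

lemma dependent_cross:
  assumes dep: walks_dependent and h: "h < n" and i: "i < n" and j: "j < n" and ne: "degr i \<noteq> degr h"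
  shows "(degr i - degr h) * (walks A 2 j - walks A 2 h)
    = (walks A 2 i - walks A 2 h) * (degr j - degr h)"
proof -
  obtain \<alpha> \<beta> \<gamma> :: rat where nz: "(\<alpha>, \<beta>, \<gamma>) \<noteq> (0, 0, 0)"
    and z: "\<And>i. i < n \<Longrightarrow> \<alpha> + \<beta> * of_int (degr i) + \<gamma> * of_int (walks A 2 i) = 0"
    using dep unfolding walks_dependent_def by blast
  let ?D = "of_int (degr i - degr h) :: rat" and ?F = "of_int (degr j - degr h) :: rat"
  let ?N = "of_int (walks A 2 i - walks A 2 h) :: rat" and ?E = "of_int (walks A 2 j - walks A 2 h) :: rat"
  have a: "\<gamma> * ?N = - \<beta> * ?D" using z[OF i] z[OF h] by (simp add: algebra_simps)
  have b: "\<gamma> * ?E = - \<beta> * ?F" using z[OF j] z[OF h] by (simp add: algebra_simps)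
  have D: "?D \<noteq> 0" using ne by simp
  have g: "\<gamma> \<noteq> 0"
  proof
    assume "\<gamma> = 0"
    with a D have "\<beta> = 0" by simp
    with z[OF h] \<open>\<gamma> = 0\<close> nz show False by simp
  qed
  have "\<gamma> * (?D * ?E) = ?D * (\<gamma> * ?E)" by (rule mult.left_commute)
  also have "\<dots> = (- \<beta> * ?D) * ?F" unfolding b by (simp only: mult_ac)
  also have "\<dots> = \<gamma> * (?N * ?F)" unfolding a[symmetric] by (rule mult.assoc)
  finally have "?D * ?E = ?N * ?F" using g by simp
  then show ?thesis unfolding of_int_mult[symmetric] of_int_eq_iff .
qed

lemma walks_recurrence:
  assumes r: "\<And>j. j < n \<Longrightarrow> D * walks A 2 j = N * degr j + M" and j: "j < n"
  shows "D * walks A (l + 2) j = N * walks A (l + 1) j + M * walks A l j"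
  using j
proof (induction l arbitrary: j)
  case 0
  then show ?case using r by (simp add: numeral_2_eq_2 dim degr_def)
next
  case (Suc l)
  have "D * walks A (Suc l + 2) j = (\<Sum>t<n. A $$ (j, t) * (D * walks A (l + 2) t))"
    by (simp add: dim sum_distrib_left mult_ac)
  also have "\<dots> = (\<Sum>t<n. A $$ (j, t) * (N * walks A (l + 1) t + M * walks A l t))"
    using Suc.IH by (intro sum.cong) auto
  also have "\<dots> = N * walks A (Suc l + 1) j + M * walks A (Suc l) j"
    by (simp add: dim sum_distrib_left sum.distrib algebra_simps)
  finally show ?case .
qed

lemma total_walks_recurrence:
  assumes r: "\<And>j. j < n \<Longrightarrow> D * walks A 2 j = N * degr j + M"
  shows "D * total_walks A (l + 2) = N * total_walks A (l + 1) + M * total_walks A l"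
proof -
  have "D * total_walks A (l + 2) = (\<Sum>j<n. D * walks A (l + 2) j)"
    unfolding total_walks_def dim sum_distrib_left ..
  also have "\<dots> = (\<Sum>j<n. N * walks A (l + 1) j + M * walks A l j)"
    by (rule sum.cong[OF refl]) (use walks_recurrence[OF r] in simp)
  finally show ?thesis unfolding total_walks_def dim by (simp only: sum.distrib sum_distrib_left)
qed

end

section \<open>Adjacency matrices of graphs\<close>

lemma sorted_list_of_set_eqI:
  assumes "sorted xs" "distinct xs" "set xs = S" shows "sorted_list_of_set S = xs"
  using sorted_list_of_set.idem_if_sorted_distinct[OF assms(1,2)] assms(3) by simp

lemma adj_matrix_nth:
  assumes "sorted xs" "distinct xs" "set xs = verts G"
  shows "adj_matrix G = mat (length xs) (length xs) (\<lambda>(i, j). if {xs ! i, xs ! j} \<in> edges G then 1 else 0)"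
  using sorted_list_of_set_eqI[OF assms] distinct_card[OF assms(2)] assms(3)
  by (simp add: adj_matrix_def)

lemma adj_matrix_graph_on:
  fixes G :: ugraph
  assumes "graph_on n G"
  shows "adj_matrix G = mat n n (\<lambda>(i, j). if {Suc i, Suc j} \<in> edges G then 1 else 0 :: 'a :: {zero, one})"
proof -
  have "set [1..<Suc n] = verts G"
    using assms by (simp add: graph_on_def atLeastLessThanSuc_atLeastAtMost del: upt_Suc)
  from adj_matrix_nth[OF sorted_upt distinct_upt this]
  have "adj_matrix G = mat n n (\<lambda>(i, j). if {[1..<Suc n] ! i, [1..<Suc n] ! j} \<in> edges G then 1 else 0 :: 'a)"
    by (simp only: length_upt diff_Suc_1)
  also have "\<dots> = mat n n (\<lambda>(i, j). if {Suc i, Suc j} \<in> edges G then 1 else 0 :: 'a)"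
    by (rule eq_matI) (simp_all del: upt_Suc)
  finally show ?thesis .
qed

lemma adj_matrix_delete_vertex:
  assumes G: "graph_on n G" and i: "i < n"
  shows "adj_matrix (delete_vertex G (Suc i)) = mat_delete (adj_matrix G :: 'a :: {zero, one} mat) i i"
proof -
  define f where "f j = (if j < i then Suc j else Suc (Suc j))" for j
  have f: "strict_mono f" by (auto simp: strict_mono_def f_def)
  let ?xs = "map f [0..<n - 1]"
  have "sorted_wrt (<) ?xs" using f by (simp add: sorted_wrt_iff_nth_less strict_monoD)
  then have s: "sorted ?xs" and d: "distinct ?xs" unfolding strict_sorted_iff by blast+
  have v: "set ?xs = verts (delete_vertex G (Suc i))"
  proof -
    have "x \<in> f ` {0..<n - 1}" if "1 \<le> x" "x \<le> n" "x \<noteq> Suc i" for x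
    proof (cases "x \<le> i")
      case True
      then have "x = f (x - 1)" "x - 1 \<in> {0..<n - 1}" using that i by (auto simp: f_def)
      then show ?thesis by blast
    next
      case False
      then have "x = f (x - 2)" "x - 2 \<in> {0..<n - 1}" using that i by (auto simp: f_def)
      then show ?thesis by blast
    qed
    moreover have "1 \<le> f j \<and> f j \<le> n \<and> f j \<noteq> Suc i" if "j < n - 1" for j
      using that i by (auto simp: f_def)
    moreover have "verts (delete_vertex G (Suc i)) = {1..n} - {Suc i}"
      using G by (simp add: graph_on_def delete_vertex_def)
    ultimately have "f ` {0..<n - 1} = verts (delete_vertex G (Suc i))"
      unfolding image_def by fastforce
    then show ?thesis unfolding set_map set_upt .
  qed
  have "adj_matrix (delete_vertex G (Suc i)) = mat (n - 1) (n - 1)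
      (\<lambda>(a, b). if {?xs ! a, ?xs ! b} \<in> edges (delete_vertex G (Suc i)) then 1 else 0 :: 'a)"
    using adj_matrix_nth[OF s d v] by (simp only: length_map length_upt diff_zero)
  also have "\<dots> = mat_delete (adj_matrix G :: 'a mat) i i"
    unfolding adj_matrix_graph_on[OF G]
  proof (rule eq_matI, goal_cases)
    case (1 a b)
    then have ab: "a < n - 1" "b < n - 1" by (auto simp: mat_delete_def)
    have "Suc i \<notin> {f a, f b}" by (auto simp: f_def)
    with ab show ?case by (simp add: mat_delete_def delete_vertex_def f_def)
  qed (auto simp: mat_delete_def)
  finally show ?thesis .
qed

lemma adjacency_graph_on:
  assumes G: "graph_on n G"
  shows "adjacency (adj_matrix G) n"
proof
  show "adj_matrix G \<in> carrier_mat n n" unfolding adj_matrix_graph_on[OF G] by simp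
next
  fix i assume "i < n"
  then show "adj_matrix G $$ (i, i) = (0 :: int)"
    using G unfolding adj_matrix_graph_on[OF G] by (auto simp: graph_on_def simple_graph_def)
next
  fix i j assume "i < n" "j < n"
  then show "adj_matrix G $$ (i, j) = (0 :: int) \<or> adj_matrix G $$ (i, j) = (1 :: int)"
    and "adj_matrix G $$ (i, j) = (adj_matrix G $$ (j, i) :: int)"
    unfolding adj_matrix_graph_on[OF G] using insert_commute[of "Suc i" "Suc j" "{}"] by simp_all
qed

lemma polynomial_deck_graph_on:
  assumes G: "graph_on n G"
  shows "polynomial_deck G
    = image_mset (\<lambda>i. char_poly (mat_delete (adj_matrix G) i i)) (mset_set {..<n})"
proof -
  have "verts G = Suc ` {..<n}"
    using G by (auto simp: graph_on_def image_Suc_lessThan)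
  then have "mset_set (verts G) = image_mset Suc (mset_set {..<n})"
    by (simp add: image_mset_mset_set)
  then have "polynomial_deck G = image_mset (\<lambda>i. graph_poly (delete_vertex G (Suc i))) (mset_set {..<n})"
    by (simp add: polynomial_deck_def image_mset.compositionality comp_def)
  also have "\<dots> = image_mset (\<lambda>i. char_poly (mat_delete (adj_matrix G) i i)) (mset_set {..<n})"
    by (intro image_mset_cong) (simp add: graph_poly_def adj_matrix_delete_vertex[OF G])
  finally show ?thesis .
qed

lemma graph_poly_complement:
  assumes G: "graph_on n G"
  shows "graph_poly (complement G) = (-1) ^ n * pcompose (walk_poly (adj_matrix G)) [:-1, -1:]"
proof -
  interpret adjacency "adj_matrix G" n by (rule adjacency_graph_on[OF G])
  have C: "graph_on n (complement G)"
    using G by (auto simp: graph_on_def complement_def simple_graph_def)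
  have "adj_matrix (complement G)
      = mat n n (\<lambda>(i, j). (if i = j then 0 else 1) - (adj_matrix G :: int mat) $$ (i, j))"
    unfolding adj_matrix_graph_on[OF C] adj_matrix_graph_on[OF G]
    using G by (intro eq_matI) (auto simp: complement_def graph_on_def simple_graph_def)
  then show ?thesis
    unfolding graph_poly_def walk_poly_def Let_def dim
    by (simp add: char_poly_complement_matrix[OF carrier])
qed

text \<open>Two distinct common neighbours of two distinct vertices are the same thing as a 4-cycle through
  them.\<close>

lemma quad_free_iff_no_four_cycle:
  assumes G: "graph_on n G"
  shows "adjacency.quad_free (adj_matrix G) n \<longleftrightarrow> \<not> has_four_cycle G"
proof -
  interpret adjacency "adj_matrix G" n by (rule adjacency_graph_on[OF G])
  have cd: "codeg i u = int (card {t. t < n \<and> {Suc i, Suc t} \<in> edges G \<and> {Suc t, Suc u} \<in> edges G})"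
    if "i < n" "u < n" for i u
  proof -
    have "codeg i u = (\<Sum>t<n. if {Suc i, Suc t} \<in> edges G \<and> {Suc t, Suc u} \<in> edges G then 1 else 0)"
      unfolding codeg_def unfolding adj_matrix_graph_on[OF G] using that by (intro sum.cong) auto
    also have "\<dots> = int (card {t \<in> {..<n}. {Suc i, Suc t} \<in> edges G \<and> {Suc t, Suc u} \<in> edges G})"
      by (simp add: sum.If_cases Int_def)
    finally show ?thesis by simp
  qed
  have V: "\<exists>i. x = Suc i \<and> i < n" if "x \<in> e" "e \<in> edges G" for x e
  proof -
    have sg: "simple_graph G" and v: "verts G = {1..n}" using G by (simp_all add: graph_on_def)
    from sg[unfolded simple_graph_def] have "\<forall>e\<in>edges G. e \<subseteq> verts G \<and> card e = 2"
      by (rule conjunct2)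
    from bspec[OF this that(2)] have "e \<subseteq> {1..n}" unfolding v by (rule conjunct1)
    with that(1) have "x \<in> {1..n}" by blast
    then show ?thesis by (intro exI[of _ "x - 1"]) auto
  qed
  show ?thesis
  proof
    assume q: quad_free
    show "\<not> has_four_cycle G"
    proof
      assume "has_four_cycle G"
      then obtain a b c d where dist: "distinct [a, b, c, d]"
        and E: "{a, b} \<in> edges G" "{b, c} \<in> edges G" "{c, d} \<in> edges G" "{d, a} \<in> edges G"
        unfolding has_four_cycle_def by auto
      obtain i where i: "a = Suc i" "i < n" using V[OF _ E(1), of a] by auto
      obtain j where j: "b = Suc j" "j < n" using V[OF _ E(1), of b] by auto
      obtain k where k: "c = Suc k" "k < n" using V[OF _ E(3), of c] by auto
      obtain l where l: "d = Suc l" "l < n" using V[OF _ E(3), of d] by auto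
      note s = i(1) j(1) k(1) l(1) and n = i(2) j(2) k(2) l(2)
      let ?S = "{t. t < n \<and> {Suc i, Suc t} \<in> edges G \<and> {Suc t, Suc k} \<in> edges G}"
      have "i \<noteq> k" using dist s by simp
      then have "codeg i k \<le> 1" using q n unfolding quad_free_def by blast
      then have "card ?S \<le> Suc 0" unfolding cd[OF n(1,3)] by simp
      then have "\<forall>x\<in>?S. \<forall>y\<in>?S. x = y" by (subst (asm) card_le_Suc0_iff_eq) simp_all
      moreover have "j \<in> ?S" using n E(1,2) unfolding s by simp
      moreover have "l \<in> ?S"
        using n E(3,4) insert_commute[of d a "{}"] insert_commute[of c d "{}"] unfolding s by simp
      ultimately have "j = l" by blast
      then show False using dist s by simp
    qed
  next
    assume nc: "\<not> has_four_cycle G"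
    show quad_free unfolding quad_free_def
    proof (intro allI impI)
      fix i u assume iu: "i < n" "u < n" "i \<noteq> u"
      have "t = t'" if t: "{Suc i, Suc t} \<in> edges G" "{Suc t, Suc u} \<in> edges G"
        and t': "{Suc i, Suc t'} \<in> edges G" "{Suc t', Suc u} \<in> edges G" for t t'
      proof (rule ccontr)
        assume "t \<noteq> t'"
        moreover have "x \<noteq> y" if "{x, y} \<in> edges G" for x y
          using that G by (auto simp: graph_on_def simple_graph_def)
        ultimately have "distinct [Suc i, Suc t, Suc u, Suc t']"
          using iu(3) t t' by (metis distinct_length_2_or_more distinct_singleton nat.inject)
        moreover have "{{Suc i, Suc t}, {Suc t, Suc u}, {Suc u, Suc t'}, {Suc t', Suc i}} \<subseteq> edges G"
          using t t' insert_commute[of "Suc u" "Suc t'" "{}"] insert_commute[of "Suc t'" "Suc i" "{}"] by simp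
        ultimately have "has_four_cycle G" unfolding has_four_cycle_def by (intro exI conjI)
        with nc show False ..
      qed
      then have "card {t. t < n \<and> {Suc i, Suc t} \<in> edges G \<and> {Suc t, Suc u} \<in> edges G} \<le> Suc 0"
        by (subst card_le_Suc0_iff_eq) auto
      then show "codeg i u \<le> 1" unfolding cd[OF iu(1,2)] by simp
    qed
  qed
qed

section \<open>The rank of the walk matrix\<close>

text \<open>Multiplication by \<open>A\<close> turns the walk numbers of length \<open>l\<close> into those of length \<open>l + 1\<close>.\<close>

lemma walk_matrix_graph_on:
  assumes G: "graph_on n G"
  shows "walk_matrix G \<in> carrier_mat n n"
    and "i < n \<Longrightarrow> k < n \<Longrightarrow> walk_matrix G $$ (i, k) = of_int (walks (adj_matrix G) k i)"
proof -
  interpret adjacency "adj_matrix G" n by (rule adjacency_graph_on[OF G])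
  let ?B = "adj_matrix G :: rat mat" and ?v = "\<lambda>l. vec n (\<lambda>i. of_int (walks (adj_matrix G) l i)) :: rat vec"
  have B: "?B \<in> carrier_mat n n" unfolding adj_matrix_graph_on[OF G] by simp
  have e: "?B $$ (i, j) = of_int (adj_matrix G $$ (i, j))" if "i < n" "j < n" for i j
    using that unfolding adj_matrix_graph_on[OF G] by simp
  have step: "?B *\<^sub>v ?v l = ?v (Suc l)" for l
    using B by (intro eq_vecI) (auto simp: scalar_prod_def dim e lessThan_atLeast0)
  have pow: "(?B ^\<^sub>m k) *\<^sub>v ?v l = ?v (k + l)" for k l
  proof (induction k arbitrary: l)
    case 0
    show ?case using B by (simp add: carrier_matD(1))
  next
    case (Suc k)
    have "(?B ^\<^sub>m Suc k) *\<^sub>v ?v l = (?B ^\<^sub>m k) *\<^sub>v (?B *\<^sub>v ?v l)"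
      by (simp add: assoc_mult_mat_vec[OF pow_carrier_mat[OF B] B])
    then show ?case unfolding step Suc.IH by simp
  qed
  have one: "vec n (\<lambda>_. 1) = ?v 0" by auto
  have c: "card (verts G) = n" using G by (simp add: graph_on_def)
  have W: "walk_matrix G = mat_of_cols n (map ?v [0..<n])"
    unfolding walk_matrix_def Let_def c one pow by simp
  show "walk_matrix G \<in> carrier_mat n n" unfolding W using mat_of_cols_carrier(1)[of n "map ?v [0..<n]"] by simp
  show "i < n \<Longrightarrow> k < n \<Longrightarrow> walk_matrix G $$ (i, k) = of_int (walks (adj_matrix G) k i)"
    unfolding W by (simp add: mat_of_cols_index)
qed

text \<open>In a dependency without \<open>A\<^sup>2 \<one>\<close> the degrees are constant; then \<open>A\<^sup>2 \<one>\<close> is a multiple of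
  \<open>A \<one>\<close>.\<close>

lemma (in adjacency) walks_dependent_imp_affine:
  assumes n: "n > 0" and dep: walks_dependent
  shows "\<exists>a b :: rat. \<forall>i<n. of_int (walks A 2 i) = a * of_int (degr i) + b"
proof -
  obtain \<alpha> \<beta> \<gamma> :: rat where nz: "(\<alpha>, \<beta>, \<gamma>) \<noteq> (0, 0, 0)"
    and z: "\<And>i. i < n \<Longrightarrow> \<alpha> + \<beta> * of_int (degr i) + \<gamma> * of_int (walks A 2 i) = 0"
    using dep unfolding walks_dependent_def by blast
  show ?thesis
  proof (cases "\<gamma> = 0")
    case False
    then have "of_int (walks A 2 i) = (- \<beta> / \<gamma>) * of_int (degr i) + (- \<alpha> / \<gamma>)" if "i < n" for i
      using z[OF that] by (simp add: field_simps)
    then show ?thesis by blast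
  next
    case True
    then have "\<beta> \<noteq> 0" using z[OF n] nz by auto
    then have "degr j = degr 0" if "j < n" for j
    proof -
      have "\<beta> * of_int (degr j) = \<beta> * of_int (degr 0)" using z[OF that] z[OF n] True by (simp add: add_eq_0_iff)
      then show ?thesis using \<open>\<beta> \<noteq> 0\<close> by simp
    qed
    note c = this
    have "of_int (walks A 2 i) = of_int (degr 0) * of_int (degr i) + (0 :: rat)" if "i < n" for i
    proof -
      have "walks A 2 i = degr 0 * degr 0" by (rule walks_2_const_degr[OF _ that]) (rule c)
      then show ?thesis using c[OF that] by simp
    qed
    then show ?thesis by blast
  qed
qed

text \<open>If \<open>A\<^sup>2 \<one>\<close> is a combination of \<open>A \<one>\<close> and \<open>\<one>\<close>, then so is every column of the walk matrix, which
  is therefore a sum of two matrices of rank at most 1.  Conversely, three independent columns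
  force rank at least 3.\<close>

lemma walk_rank_le_2_iff:
  assumes G: "graph_on n G" and n: "3 \<le> n"
  shows "walk_rank G \<le> 2 \<longleftrightarrow> adjacency.walks_dependent (adj_matrix G) n"
proof -
  interpret adjacency "adj_matrix G" n by (rule adjacency_graph_on[OF G])
  interpret vec_space "TYPE(rat)" n .
  let ?A = "adj_matrix G :: int mat"
  let ?W = "walk_matrix G"
  note W = walk_matrix_graph_on[OF G]
  have wr: "walk_rank G = rank ?W" using G by (simp add: walk_rank_def graph_on_def)
  show ?thesis
  proof
    assume walks_dependent
    then obtain a b :: rat where ab: "\<And>i. i < n \<Longrightarrow> of_int (walks ?A 2 i) = a * of_int (degr i) + b"
      using walks_dependent_imp_affine n by auto
    have "\<exists>p r :: rat. \<forall>i<n. of_int (walks ?A l i) = p * of_int (degr i) + r" for l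
    proof (induction l)
      case 0
      show ?case by (intro exI[of _ 0] exI[of _ 1]) simp
    next
      case (Suc l)
      then obtain p r :: rat where pr: "\<And>i. i < n \<Longrightarrow> of_int (walks ?A l i) = p * of_int (degr i) + r"
        by auto
      have "of_int (walks ?A (Suc l) i) = (p * a + r) * of_int (degr i) + p * b" if "i < n" for i
      proof -
        have "of_int (walks ?A (Suc l) i) = (\<Sum>t<n. of_int (?A $$ (i, t)) * (p * of_int (degr t) + r))"
          by (simp add: dim pr)
        also have "\<dots> = p * of_int (\<Sum>t<n. ?A $$ (i, t) * degr t) + r * of_int (\<Sum>t<n. ?A $$ (i, t))"
          by (simp add: sum.distrib sum_distrib_left algebra_simps)
        also have "(\<Sum>t<n. ?A $$ (i, t) * degr t) = walks ?A 2 i"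
          by (simp add: numeral_2_eq_2 dim degr_def)
        also have "(\<Sum>t<n. ?A $$ (i, t)) = degr i" by (simp add: degr_def)
        finally show ?thesis using ab[OF that] by (simp add: algebra_simps)
      qed
      then show ?case by blast
    qed
    then obtain p r :: "nat \<Rightarrow> rat"
      where pr: "\<And>l i. i < n \<Longrightarrow> of_int (walks ?A l i) = p l * of_int (degr i) + r l"
      by metis
    let ?P = "mat n n (\<lambda>(i, l). of_int (degr i) * p l)" and ?R = "mat n n (\<lambda>(i, l). 1 * r l)"
    have "?W = ?P + ?R"
    proof (rule eq_matI)
      fix i l assume "i < dim_row (?P + ?R)" "l < dim_col (?P + ?R)"
      then show "?W $$ (i, l) = (?P + ?R) $$ (i, l)" by (simp add: W(2) pr mult.commute)
    qed (use W(1) in auto)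
    then have "rank ?W = rank (?P + ?R)" by simp
    moreover have "rank (?P + ?R) \<le> rank ?P + rank ?R"
      by (rule rank_subadditive[of _ n]) auto
    moreover have "rank ?P \<le> 1"
      by (rule rank_le_1_product_entries[of _ n "\<lambda>i. of_int (degr i)" p]) auto
    moreover have "rank ?R \<le> 1"
      by (rule rank_le_1_product_entries[of _ n "\<lambda>_. 1" r]) auto
    ultimately show "walk_rank G \<le> 2" unfolding wr by linarith
  next
    assume le: "walk_rank G \<le> 2"
    show walks_dependent
    proof (rule ccontr)
      assume nd: "\<not> walks_dependent"
      let ?cs = "map (col ?W) [0, 1, 2]"
      let ?M = "mat_of_cols n ?cs"
      have entry: "col ?W k $ i = of_int (walks ?A k i)" if "i < n" "k < n" for i k
        using W that by simp
      have M: "?M \<in> carrier_mat n 3" using mat_of_cols_carrier(1)[of n ?cs] by (simp add: numeral_3_eq_3)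
      have cc: "cols ?M = ?cs" using W(1) by (intro cols_mat_of_cols) auto
      have dep: "walks_dependent" if nz: "(\<alpha>, \<beta>, \<gamma>) \<noteq> (0, 0, 0)"
        and rel: "\<And>i. i < n \<Longrightarrow> \<alpha> * col ?W 0 $ i + \<beta> * col ?W 1 $ i + \<gamma> * col ?W 2 $ i = 0" for \<alpha> \<beta> \<gamma>
      proof -
        have "\<alpha> + \<beta> * of_int (degr i) + \<gamma> * of_int (walks ?A 2 i) = 0" if i: "i < n" for i
        proof -
          have "\<alpha> * col ?W 0 $ i + \<beta> * col ?W (Suc 0) $ i + \<gamma> * col ?W 2 $ i = 0"
            using rel[OF i] by simp
          moreover have "0 < n" "Suc 0 < n" "2 < n" using n by simp_all
          ultimately show ?thesis by (simp only: entry[OF i] walks_1 walks.simps(1) of_int_1 mult_1_right)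
        qed
        then show ?thesis unfolding walks_dependent_def 
          by (intro exI[of _ \<alpha>] exI[of _ \<beta>] exI[of _ \<gamma>] conjI allI impI nz)
      qed
      have dist: "distinct (cols ?M)"
        unfolding cc using dep[of 1 "-1" 0] dep[of 1 0 "-1"] dep[of 0 1 "-1"] nd by auto
      have "lin_indpt (set (cols ?M))"
      proof
        assume "lin_dep (set (cols ?M))"
        then obtain v where v: "v \<in> carrier_vec 3" "v \<noteq> 0\<^sub>v 3" "?M *\<^sub>v v = 0\<^sub>v n"
          by (rule lin_depE[OF M _ dist])
        have "(v $ 0, v $ 1, v $ 2) \<noteq> (0, 0, 0)"
        proof
          assume "(v $ 0, v $ 1, v $ 2) = (0, 0, 0)"
          then have "v = 0\<^sub>v 3" using v(1) by (intro eq_vecI) (auto simp: eval_nat_numeral less_Suc_eq)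
          with v(2) show False by simp
        qed
        moreover have "v $ 0 * col ?W 0 $ i + v $ 1 * col ?W 1 $ i + v $ 2 * col ?W 2 $ i = 0"
          if "i < n" for i
        proof -
          have "(?M *\<^sub>v v) $ i = 0" using v(3) that by simp
          moreover have "(?M *\<^sub>v v) $ i = (\<Sum>k<3. ?M $$ (i, k) * v $ k)"
            using v(1) M that by (simp add: scalar_prod_def lessThan_atLeast0)
          moreover have "\<dots> = col ?W 0 $ i * v $ 0 + col ?W 1 $ i * v $ 1 + col ?W 2 $ i * v $ 2"
            using that by (simp add: eval_nat_numeral mat_of_cols_index)
          ultimately show ?thesis by (simp add: mult.commute)
        qed
        ultimately show False using dep nd by blast
      qed
      moreover have "set (cols ?M) \<subseteq> set (cols ?W)"
        unfolding cc using W(1) n by (auto simp: cols_def)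
      ultimately have "card (set (cols ?M)) \<le> rank ?W"
        using rank_ge_card_indpt[OF W(1)] by blast
      moreover have "card (set (cols ?M)) = 3" using distinct_card[OF dist] cc by simp
      ultimately show False using le wr by simp
    qed
  qed
qed

section \<open>Graphs with the same deck\<close>

text \<open>The comparison of two graphs whose decks agree after a permutation of the vertices.\<close>

context
  fixes A B :: "int mat" and n :: nat and \<pi> :: "nat \<Rightarrow> nat"
  assumes adjA: "adjacency A n" and adjB: "adjacency B n" and perm: "\<pi> permutes {..<n}"
    and deck: "\<And>i. i < n \<Longrightarrow> char_poly (mat_delete A i i) = char_poly (mat_delete B (\<pi> i) (\<pi> i))"
    and n3: "3 \<le> n"
begin

interpretation A: adjacency A n by (rule adjA)
interpretation B: adjacency B n by (rule adjB)

lemma perm_less: "i < n \<Longrightarrow> \<pi> i < n"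
  using permutes_in_image[OF perm, of i] by simp

lemma all_perm: "(\<forall>i<n. Q (\<pi> i)) \<longleftrightarrow> (\<forall>i<n. Q i)"
proof -
  have "(\<forall>i<n. Q (\<pi> i)) \<longleftrightarrow> (\<forall>i\<in>\<pi> ` {..<n}. Q i)" by auto
  then show ?thesis unfolding permutes_image[OF perm] by auto
qed

lemma sum_perm: "(\<Sum>i<n. f (\<pi> i)) = (\<Sum>i<n. f i)"
  using sum.permute[OF perm, of f] by (simp add: comp_def)

lemma matched_adj_coeff: "i < n \<Longrightarrow> adj_coeff A j i i = adj_coeff B j (\<pi> i) (\<pi> i)"
  by (simp add: adj_coeff_diag[OF A.carrier] adj_coeff_diag[OF B.carrier] perm_less deck)

lemma matched_rev_coeff:
  assumes "j \<noteq> n" shows "rev_coeff A j = rev_coeff B j"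
proof -
  have "(\<Sum>i<n. adj_coeff A j i i) = (\<Sum>i<n. adj_coeff B j i i)"
    using sum_perm[of "\<lambda>i. adj_coeff B j i i"] by (simp add: matched_adj_coeff)
  then have "(int n - int j) * rev_coeff A j = (int n - int j) * rev_coeff B j"
    unfolding sum_adj_coeff_diag[OF A.carrier] sum_adj_coeff_diag[OF B.carrier] by simp
  then show ?thesis using assms by simp
qed

lemma matched_rev_coeff_2: "rev_coeff A 2 = rev_coeff B 2"
  using matched_rev_coeff[of 2] n3 by simp

lemma matched_degr: "i < n \<Longrightarrow> A.degr i = B.degr (\<pi> i)"
  using A.adj_coeff_2_diag[of i] B.adj_coeff_2_diag[of "\<pi> i"] matched_adj_coeff[of i 2]
    matched_rev_coeff_2 perm_less[of i] by simp

lemma matched_sum_degr_sq: "(\<Sum>i<n. A.degr i ^ 2) = (\<Sum>i<n. B.degr i ^ 2)"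
  using sum_perm[of "\<lambda>i. B.degr i ^ 2"] by (simp add: matched_degr)

text \<open>The polynomial criterion needs \<open>r 4\<close>, which the deck determines for \<open>n \<noteq> 4\<close> only.\<close>

lemma matched_quad_free: "A.quad_free \<longleftrightarrow> B.quad_free"
proof (cases "n = 4")
  case True
  have "(\<forall>i<n. 2 \<le> A.degr i) \<longleftrightarrow> (\<forall>i<n. 2 \<le> B.degr (\<pi> i))" using matched_degr by auto
  also have "\<dots> \<longleftrightarrow> (\<forall>i<n. 2 \<le> B.degr i)" by (rule all_perm)
  finally show ?thesis unfolding A.quad_free_4[OF True] B.quad_free_4[OF True] by simp
next
  case False
  then have "rev_coeff A 4 = rev_coeff B 4" using matched_rev_coeff[of 4] by simp
  then show ?thesis
    unfolding A.quad_free_iff B.quad_free_iff matched_sum_degr_sq matched_rev_coeff_2 by simp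
qed

text \<open>Unlike in general, \<open>r 4\<close> is here a function of the degrees, so that \<open>n = 4\<close> is no exception.\<close>

lemma matched_walks_2:
  assumes q: "A.quad_free" and i: "i < n" shows "walks A 2 i = walks B 2 (\<pi> i)"
proof -
  have qB: "B.quad_free" using q matched_quad_free by simp
  have "2 * rev_coeff A 4 = 2 * rev_coeff B 4"
    using q qB unfolding A.quad_free_iff B.quad_free_iff matched_sum_degr_sq matched_rev_coeff_2 by simp
  then show ?thesis
    unfolding A.quad_free_walks_2[OF q i] B.quad_free_walks_2[OF qB perm_less[OF i]]
    by (simp add: matched_adj_coeff[OF i] matched_degr[OF i] matched_rev_coeff_2)
qed

lemma matched_walks_dependent:
  assumes q: "A.quad_free" shows "A.walks_dependent \<longleftrightarrow> B.walks_dependent"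
proof -
  have "(\<forall>i<n. \<alpha> + \<beta> * of_int (A.degr i) + \<gamma> * of_int (walks A 2 i) = 0)
      \<longleftrightarrow> (\<forall>i<n. \<alpha> + \<beta> * of_int (B.degr i) + \<gamma> * of_int (walks B 2 i) = 0)" for \<alpha> \<beta> \<gamma> :: rat
  proof -
    have "(\<forall>i<n. \<alpha> + \<beta> * of_int (A.degr i) + \<gamma> * of_int (walks A 2 i) = 0)
      \<longleftrightarrow> (\<forall>i<n. \<alpha> + \<beta> * of_int (B.degr (\<pi> i)) + \<gamma> * of_int (walks B 2 (\<pi> i)) = 0)"
      using matched_degr matched_walks_2[OF q] by simp
    then show ?thesis
      unfolding all_perm[of "\<lambda>i. \<alpha> + \<beta> * of_int (B.degr i) + \<gamma> * of_int (walks B 2 i) = 0"] .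
  qed
  then show ?thesis unfolding A.walks_dependent_def B.walks_dependent_def by simp
qed

end

lemma size_polynomial_deck: "graph_on n G \<Longrightarrow> size (polynomial_deck G) = n"
  by (simp add: polynomial_deck_graph_on)

lemma deck_properties:
  assumes G: "graph_on n G" and H: "graph_on n H" and n: "3 \<le> n"
    and deck: "polynomial_deck G = polynomial_deck H"
  shows "has_four_cycle G \<longleftrightarrow> has_four_cycle H"
    and "\<not> has_four_cycle G \<Longrightarrow> walk_rank G \<le> 2 \<longleftrightarrow> walk_rank H \<le> 2"
proof -
  obtain \<pi> where p: "\<pi> permutes {..<n}"
    and m: "\<forall>i\<in>{..<n}. char_poly (mat_delete (adj_matrix G) i i)
      = (char_poly (mat_delete (adj_matrix H) (\<pi> i) (\<pi> i)) :: int poly)"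
    using image_mset_eq_implies_permutes[OF finite_lessThan
        deck[unfolded polynomial_deck_graph_on[OF G] polynomial_deck_graph_on[OF H]]] by blast
  have m': "char_poly (mat_delete (adj_matrix G) i i)
      = (char_poly (mat_delete (adj_matrix H) (\<pi> i) (\<pi> i)) :: int poly)" if "i < n" for i
    using m that by simp
  note match = adjacency_graph_on[OF G] adjacency_graph_on[OF H] p m' n
  show "has_four_cycle G \<longleftrightarrow> has_four_cycle H"
    using matched_quad_free[OF match] quad_free_iff_no_four_cycle[OF G] quad_free_iff_no_four_cycle[OF H]
    by simp
  show "walk_rank G \<le> 2 \<longleftrightarrow> walk_rank H \<le> 2" if "\<not> has_four_cycle G"
    using matched_walks_dependent[OF match] quad_free_iff_no_four_cycle[OF G] that
      walk_rank_le_2_iff[OF G n] walk_rank_le_2_iff[OF H n] by simp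
qed

section \<open>Runs with bounded loops and bounded memory\<close>

definition bounded :: "nat \<Rightarrow> state \<Rightarrow> bool" where
  "bounded L s \<longleftrightarrow> (\<forall>x i. \<bar>s x i\<bar> < 2 ^ L)"

text \<open>A bound, in units of the word length, on the bit length of the value of an expression.  For
  sums it is generous, so that all binary operations are treated alike.\<close>

fun expr_size :: "expr \<Rightarrow> nat" where
  "expr_size (Const c) = int_cost c"
| "expr_size (Cell x e) = 1 + expr_size e"
| "expr_size (Add e f) = expr_size e + expr_size f"
| "expr_size (Sub e f) = expr_size e + expr_size f"
| "expr_size (Mul e f) = expr_size e + expr_size f"
| "expr_size (Quo e f) = expr_size e + expr_size f"

lemma expr_size_pos: "0 < expr_size e"
  by (induction e) (auto simp: int_cost_def)

lemma int_cost_le: assumes "\<bar>z\<bar> < 2 ^ k" shows "int_cost z \<le> 1 + k"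
proof -
  have "nat \<bar>z\<bar> < 2 ^ k" using assms by (simp add: nat_less_iff)
  then have "floorlog 2 (nat \<bar>z\<bar>) \<le> k" by (simp add: floorlog_le_iff)
  then show ?thesis by (simp add: int_cost_def)
qed

lemma abs_less_int_cost: "\<bar>z\<bar> < 2 ^ int_cost z"
proof -
  have "nat \<bar>z\<bar> < 2 ^ floorlog 2 (nat \<bar>z\<bar>)"
    using floorlog_bounds[of "nat \<bar>z\<bar>" 2] by (cases "z = 0") auto
  then have "\<bar>z\<bar> < 2 ^ floorlog 2 (nat \<bar>z\<bar>)" by (simp add: nat_less_iff)
  then show ?thesis by (simp add: int_cost_def)
qed

text \<open>Rounding towards minus infinity does not increase the absolute value, also for negative arguments
  and for the divisor 0.\<close>

lemma abs_div_le: "\<bar>a div b\<bar> \<le> \<bar>a\<bar>" for a b :: int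
proof (cases "b = 0")
  case False
  have *: "\<bar>a div b\<bar> \<le> \<bar>a\<bar>" if "b > 0" for a b :: int
  proof (cases "a \<ge> 0")
    case True
    then have "a div b \<le> a div 1" "0 \<le> a div b"
      using that zdiv_mono2[of a 1 b] by (simp_all add: pos_imp_zdiv_nonneg_iff)
    then show ?thesis by simp
  next
    case False
    have "a div b < 0" using False that by (simp add: pos_imp_zdiv_neg_iff)
    moreover have "a \<le> a div b"
    proof -
      have "a * 1 \<ge> a * b" using False that by (intro mult_left_mono_neg) auto
      then show ?thesis using zdiv_mono1[of "a * b" a b] that by simp
    qed
    ultimately show ?thesis by simp
  qed
  show ?thesis using False *[of b a] *[of "- b" "- a"] by (cases "b > 0") (auto simp: div_minus_minus)
qed simp

lemma abs_add_less:
  fixes a b :: int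
  assumes "\<bar>a\<bar> < 2 ^ x" "\<bar>b\<bar> < 2 ^ y" "0 < x" "0 < y"
  shows "\<bar>a\<bar> + \<bar>b\<bar> < 2 ^ (x + y)"
proof -
  have "(2 :: int) ^ 1 \<le> 2 ^ x" "(2 :: int) ^ 1 \<le> 2 ^ y"
    using assms by (intro power_increasing; simp)+
  then have p: "0 \<le> (2 :: int) ^ x - 2" "0 \<le> (2 :: int) ^ y - 2" by simp_all
  from mult_nonneg_nonneg[OF this] p
  have "0 \<le> ((2 :: int) ^ x - 2) * (2 ^ y - 2) + (2 ^ x - 2) + (2 ^ y - 2)" by linarith
  then have "(2 :: int) ^ x + 2 ^ y \<le> 2 ^ x * 2 ^ y" by (simp add: algebra_simps)
  then show ?thesis using assms by (simp add: power_add)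
qed

lemma val_bound:
  assumes s: "bounded L s" and L: "0 < L"
  shows "\<bar>val e s\<bar> < 2 ^ (expr_size e * L)"
proof (induction e)
  case (Const c)
  have "(2 :: int) ^ int_cost c \<le> 2 ^ (int_cost c * L)" using L by (intro power_increasing) auto
  from order.strict_trans2[OF abs_less_int_cost this] show ?case by (simp only: val.simps expr_size.simps)
next
  case (Cell x e)
  have "(2 :: int) ^ L \<le> 2 ^ (expr_size (Cell x e) * L)" by (intro power_increasing) auto
  moreover have "\<bar>s x (val e s)\<bar> < 2 ^ L" using s by (simp add: bounded_def)
  ultimately show ?case unfolding val.simps by (rule order.strict_trans2[rotated])
next
  case (Add e f)
  then have "\<bar>val e s\<bar> + \<bar>val f s\<bar> < 2 ^ (expr_size e * L + expr_size f * L)"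
    using L expr_size_pos by (intro abs_add_less) auto
  then show ?case by (simp add: algebra_simps)
next
  case (Sub e f)
  then have "\<bar>val e s\<bar> + \<bar>val f s\<bar> < 2 ^ (expr_size e * L + expr_size f * L)"
    using L expr_size_pos by (intro abs_add_less) auto
  then show ?case by (simp add: algebra_simps)
next
  case (Mul e f)
  then have "\<bar>val e s\<bar> * \<bar>val f s\<bar> < 2 ^ (expr_size e * L) * 2 ^ (expr_size f * L)"
    by (intro mult_strict_mono') auto
  then show ?case by (simp add: algebra_simps abs_mult power_add)
next
  case (Quo e f)
  have "(2 :: int) ^ (expr_size e * L) \<le> 2 ^ (expr_size (Quo e f) * L)"
    by (intro power_increasing) auto
  then show ?case unfolding val.simps by (rule le_less_trans[OF abs_div_le less_le_trans[OF Quo(1)]])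
qed

lemma expr_cost_binary:
  assumes e: "expr_cost e s \<le> 2 * expr_size e ^ 2 * L" and f: "expr_cost f s \<le> 2 * expr_size f ^ 2 * L"
    and z: "\<bar>z\<bar> < 2 ^ ((expr_size e + expr_size f) * L)" and L: "0 < L"
  shows "expr_cost e s + expr_cost f s + int_cost z \<le> 2 * (expr_size e + expr_size f) ^ 2 * L"
proof -
  let ?a = "expr_size e" and ?b = "expr_size f"
  have ab: "1 \<le> ?a" "1 \<le> ?b" using expr_size_pos[of e] expr_size_pos[of f] by auto
  have "?a \<le> ?a * ?b" "?b \<le> ?a * ?b" "1 \<le> ?a * ?b" using ab by auto
  then have "1 + (?a + ?b) \<le> 4 * (?a * ?b)" by linarith
  then have "(1 + (?a + ?b)) * L \<le> 4 * (?a * ?b) * L" by (rule mult_right_mono) simp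
  then have "L + (?a + ?b) * L \<le> 4 * (?a * ?b) * L" by (simp only: add_mult_distrib mult_1)
  moreover have "int_cost z \<le> 1 + (?a + ?b) * L" by (rule int_cost_le[OF z])
  ultimately have "int_cost z \<le> 4 * (?a * ?b) * L" using L by linarith
  with e f show ?thesis by (simp add: power2_eq_square algebra_simps)
qed

lemma expr_cost_bound:
  assumes s: "bounded L s" and L: "0 < L"
  shows "expr_cost e s \<le> 2 * expr_size e ^ 2 * L"
proof (induction e)
  case (Const c)
  have "int_cost c * 1 \<le> int_cost c * (2 * int_cost c * L)"
    using L by (intro mult_left_mono) (auto simp: int_cost_def)
  then show ?case by (simp add: power2_eq_square ac_simps)
next
  case (Cell x e)
  have "int_cost (val (Cell x e) s) \<le> 1 + L"
    by (rule int_cost_le) (use s in \<open>simp add: bounded_def\<close>)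
  with Cell L show ?case by (simp add: power2_eq_square algebra_simps)
next
  case (Add e f)
  show ?case
    using expr_cost_binary[OF Add val_bound[OF s L, of "Add e f", unfolded expr_size.simps] L] by simp
next
  case (Sub e f)
  show ?case
    using expr_cost_binary[OF Sub val_bound[OF s L, of "Sub e f", unfolded expr_size.simps] L] by simp
next
  case (Mul e f)
  show ?case
    using expr_cost_binary[OF Mul val_bound[OF s L, of "Mul e f", unfolded expr_size.simps] L] by simp
next
  case (Quo e f)
  show ?case
    using expr_cost_binary[OF Quo val_bound[OF s L, of "Quo e f", unfolded expr_size.simps] L] by simp
qed

text \<open>An upper bound for the running time, if no loop makes more than \<open>N\<close> passes and every cell keeps
  absolute values below \<open>2 ^ L\<close>.  Both branches of a conditional are charged.\<close>

fun time :: "nat \<Rightarrow> nat \<Rightarrow> com \<Rightarrow> nat" where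
  "time N L Skip = 1"
| "time N L (Store x e f) = 1 + 2 * expr_size e ^ 2 * L + 2 * expr_size f ^ 2 * L"
| "time N L (Seq c d) = 1 + time N L c + time N L d"
| "time N L (IfPos e c d) = 1 + 2 * expr_size e ^ 2 * L + time N L c + time N L d"
| "time N L (WhilePos e c) = Suc N * (1 + 2 * expr_size e ^ 2 * L + time N L c)"

text \<open>The program is fixed, so its nesting depth is a constant.\<close>

lemma time_polynomial:
  fixes N L :: "nat poly"
  shows "\<exists>p. \<forall>n. time (poly N n) (poly L n) c = poly p n"
proof (induction c)
  case Skip
  show ?case by (intro exI[of _ 1]) simp
next
  case (Store x e f)
  show ?case by (intro exI[of _ "1 + [:2 * expr_size e ^ 2:] * L + [:2 * expr_size f ^ 2:] * L"]) simp
next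
  case (Seq c d)
  then obtain p q where "\<And>n. time (poly N n) (poly L n) c = poly p n"
    "\<And>n. time (poly N n) (poly L n) d = poly q n" by auto
  then show ?case by (intro exI[of _ "1 + p + q"]) simp
next
  case (IfPos e c d)
  then obtain p q where "\<And>n. time (poly N n) (poly L n) c = poly p n"
    "\<And>n. time (poly N n) (poly L n) d = poly q n" by auto
  then show ?case by (intro exI[of _ "1 + [:2 * expr_size e ^ 2:] * L + p + q"]) simp
next
  case (WhilePos e c)
  then obtain p where "\<And>n. time (poly N n) (poly L n) c = poly p n" by auto
  then show ?case by (intro exI[of _ "(1 + N) * (1 + [:2 * expr_size e ^ 2:] * L + p)"]) simp
qed

text \<open>The weakest precondition of a program for the postcondition \<open>Q\<close>, including the time and memory
  bounds.  Boundedness of the memory is assumed and reproduced inside the definition; in proofs only the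
  stored values have to be estimated, and time never appears.\<close>

definition runs :: "nat \<Rightarrow> nat \<Rightarrow> com \<Rightarrow> (state \<Rightarrow> bool) \<Rightarrow> state \<Rightarrow> bool" where
  "runs N L c Q s \<longleftrightarrow> 0 < L \<longrightarrow> bounded L s \<longrightarrow>
     (\<exists>t s'. exec c s t s' \<and> t \<le> time N L c \<and> bounded L s' \<and> Q s')"

lemma runs_Skip: "Q s \<Longrightarrow> runs N L Skip Q s"
  unfolding runs_def by (metis exec.Skip time.simps(1) order_refl)

lemma runs_Store:
  assumes "\<bar>val f s\<bar> < 2 ^ L" and "Q (s(x := (s x)(val e s := val f s)))"
  shows "runs N L (Store x e f) Q s"
  unfolding runs_def
proof (intro impI)
  assume L: "0 < L" and b: "bounded L s"
  have "1 + expr_cost e s + expr_cost f s \<le> time N L (Store x e f)"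
    using expr_cost_bound[OF b L, of e] expr_cost_bound[OF b L, of f] by simp
  moreover have "bounded L (s(x := (s x)(val e s := val f s)))"
    using b assms(1) by (simp add: bounded_def)
  ultimately show "\<exists>t s'. exec (Store x e f) s t s' \<and> t \<le> time N L (Store x e f) \<and> bounded L s' \<and> Q s'"
    using exec.Store assms(2) by blast
qed

lemma runs_Seq:
  assumes "runs N L c (runs N L d Q) s"
  shows "runs N L (Seq c d) Q s"
  unfolding runs_def
proof (intro impI)
  assume L: "0 < L" and b: "bounded L s"
  obtain t s' where 1: "exec c s t s'" "t \<le> time N L c" "bounded L s'" "runs N L d Q s'"
    using assms L b unfolding runs_def[of N L c] by blast
  obtain u s'' where 2: "exec d s' u s''" "u \<le> time N L d" "bounded L s''" "Q s''"
    using 1(3,4) L unfolding runs_def by blast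
  have "1 + t + u \<le> time N L (Seq c d)" using 1(2) 2(2) by simp
  with exec.Seq[OF 1(1) 2(1)] 2(3,4)
  show "\<exists>t s'. exec (Seq c d) s t s' \<and> t \<le> time N L (Seq c d) \<and> bounded L s' \<and> Q s'" by blast
qed

lemma runs_IfPos:
  assumes "val e s > 0 \<Longrightarrow> runs N L c Q s" and "val e s \<le> 0 \<Longrightarrow> runs N L d Q s"
  shows "runs N L (IfPos e c d) Q s"
  unfolding runs_def
proof (intro impI)
  assume L: "0 < L" and b: "bounded L s"
  note cost = expr_cost_bound[OF b L, of e]
  show "\<exists>t s'. exec (IfPos e c d) s t s' \<and> t \<le> time N L (IfPos e c d) \<and> bounded L s' \<and> Q s'"
  proof (cases "val e s > 0")
    case True
    then obtain t s' where 1: "exec c s t s'" "t \<le> time N L c" "bounded L s'" "Q s'"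
      using assms(1) L b unfolding runs_def by blast
    moreover have "1 + expr_cost e s + t \<le> time N L (IfPos e c d)" using 1(2) cost by simp
    ultimately show ?thesis using exec.IfTrue[OF True 1(1)] by blast
  next
    case False
    then have le: "val e s \<le> 0" by simp
    then obtain t s' where 1: "exec d s t s'" "t \<le> time N L d" "bounded L s'" "Q s'"
      using assms(2) L b unfolding runs_def by blast
    moreover have "1 + expr_cost e s + t \<le> time N L (IfPos e c d)" using 1(2) cost by simp
    ultimately show ?thesis using exec.IfFalse[OF le 1(1)] by blast
  qed
qed

lemma runs_mono:
  assumes "runs N L c Q s" and "\<And>s'. Q s' \<Longrightarrow> Q' s'"
  shows "runs N L c Q' s"
  using assms unfolding runs_def by blast

lemma runs_WhilePos:
  assumes K: "K \<le> N" and I: "I 0 s"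
    and guard: "\<And>j s. j \<le> K \<Longrightarrow> I j s \<Longrightarrow> val e s = int K - int j"
    and step: "\<And>j s. j < K \<Longrightarrow> I j s \<Longrightarrow> runs N L c (I (Suc j)) s"
    and post: "\<And>s. I K s \<Longrightarrow> Q s"
  shows "runs N L (WhilePos e c) Q s"
  unfolding runs_def
proof (intro impI)
  assume L: "0 < L" and b: "bounded L s"
  let ?C = "1 + 2 * expr_size e ^ 2 * L + time N L c"
  have "\<exists>t s'. exec (WhilePos e c) s t s' \<and> t \<le> Suc m * ?C \<and> bounded L s' \<and> Q s'"
    if "m \<le> K" "I (K - m) s" "bounded L s" for m s
    using that
  proof (induction m arbitrary: s)
    case 0
    have "val e s \<le> 0" using guard[of K s] 0 by simp
    then have "exec (WhilePos e c) s (1 + expr_cost e s) s" by (rule exec.WhileFalse)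
    moreover have "1 + expr_cost e s \<le> Suc 0 * ?C" using expr_cost_bound[OF 0(3) L, of e] by simp
    ultimately show ?case using 0 post by (metis diff_zero)
  next
    case (Suc m)
    have v: "val e s > 0" using guard[OF _ Suc.prems(2)] Suc.prems(1) by simp
    have "runs N L c (I (Suc (K - Suc m))) s" using step[OF _ Suc.prems(2)] Suc.prems(1) by simp
    also have "Suc (K - Suc m) = K - m" using Suc.prems(1) by simp
    finally obtain t s' where 1: "exec c s t s'" "t \<le> time N L c" "bounded L s'" "I (K - m) s'"
      using L Suc.prems(3) unfolding runs_def by blast
    obtain u s'' where 2: "exec (WhilePos e c) s' u s''" "u \<le> Suc m * ?C" "bounded L s''" "Q s''"
      using Suc.IH[of s'] Suc.prems(1) 1 by auto
    have "1 + expr_cost e s + t + u \<le> Suc (Suc m) * ?C"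
      using 1(2) 2(2) expr_cost_bound[OF Suc.prems(3) L, of e] unfolding mult_Suc[of "Suc m"] by linarith
    with exec.WhileTrue[OF v 1(1) 2(1)] 2(3,4) show ?case by blast
  qed
  from this[of K s] I b obtain t s' where
    "exec (WhilePos e c) s t s'" "t \<le> Suc K * ?C" "bounded L s'" "Q s'" by auto
  moreover have "Suc K * ?C \<le> time N L (WhilePos e c)"
    unfolding time.simps using K by (intro mult_right_mono) auto
  ultimately show "\<exists>t s'. exec (WhilePos e c) s t s' \<and> t \<le> time N L (WhilePos e c) \<and> bounded L s' \<and> Q s'"
    by (meson order_trans)
qed

abbreviation var :: "string \<Rightarrow> expr" where
  "var x \<equiv> Cell x (Const 0)"

abbreviation assign :: "string \<Rightarrow> expr \<Rightarrow> com" where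
  "assign x e \<equiv> Store x (Const 0) e"

text \<open>A counting loop over \<open>0, \<dots>, e - 1\<close>; the expression \<open>e\<close> is evaluated anew in each pass.\<close>

definition for_loop :: "string \<Rightarrow> expr \<Rightarrow> com \<Rightarrow> com" where
  "for_loop x e c = Seq (assign x (Const 0))
     (WhilePos (Sub e (var x)) (Seq c (assign x (Add (var x) (Const 1)))))"

text \<open>The invariant \<open>I j\<close> describes the state before pass \<open>j\<close>.\<close>

lemma runs_for_loop:
  assumes K: "K \<le> N" "int N < 2 ^ L" and I: "I 0 (s(x := (s x)(0 := 0)))"
    and guard: "\<And>j s. j \<le> K \<Longrightarrow> I j s \<Longrightarrow> s x 0 = int j \<and> val e s = int K"
    and step: "\<And>j s. j < K \<Longrightarrow> I j s \<Longrightarrow>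
      runs N L c (\<lambda>s. s x 0 = int j \<and> I (Suc j) (s(x := (s x)(0 := int (Suc j))))) s"
    and post: "\<And>s. I K s \<Longrightarrow> Q s"
  shows "runs N L (for_loop x e c) Q s"
  unfolding for_loop_def
proof (intro runs_Seq runs_Store)
  show "runs N L (WhilePos (Sub e (var x)) (Seq c (assign x (Add (var x) (Const 1))))) Q
      (s(x := (s x)(val (Const 0) s := val (Const 0) s)))"
  proof (rule runs_WhilePos[OF K(1), of I])
    fix j s assume j: "j < K" "I j s"
    show "runs N L (Seq c (assign x (Add (var x) (Const 1)))) (I (Suc j)) s"
    proof (rule runs_Seq, rule runs_mono[OF step[OF j]], rule runs_Store)
      fix s' assume s': "s' x 0 = int j \<and> I (Suc j) (s'(x := (s' x)(0 := int (Suc j))))"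
      have "int j + 1 < 2 ^ L" using j(1) K by linarith
      then show "\<bar>val (Add (var x) (Const 1)) s'\<bar> < 2 ^ L" using s' by simp
      show "I (Suc j) (s'(x := (s' x)(val (Const 0) s' := val (Add (var x) (Const 1)) s')))"
        using s' by (simp add: add.commute)
    qed
  qed (use I guard post in auto)
qed simp

inductive_cases exec_SkipE: "exec Skip s t s'"
inductive_cases exec_StoreE: "exec (Store x e f) s t s'"
inductive_cases exec_SeqE: "exec (Seq c d) s t s'"
inductive_cases exec_IfPosE: "exec (IfPos e c d) s t s'"
inductive_cases exec_WhilePosE: "exec (WhilePos e c) s t s'"

text \<open>Determinism makes a program a function of its input, and so turns the existence of a
  reconstruction program into a uniqueness statement.\<close>

lemma exec_deterministic:
  assumes "exec c s t s'" "exec c s u s''" shows "s'' = s'"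
  using assms
proof (induction arbitrary: u s'' rule: exec.induct)
  case (Skip s)
  then show ?case by (elim exec_SkipE)
next
  case (Store x e f s)
  then show ?case by (elim exec_StoreE)
next
  case (Seq c s t s' d t' s2)
  from Seq.prems show ?case
  proof (rule exec_SeqE)
    fix v s1 w
    assume 1: "exec c s v s1" "exec d s1 w s''"
    from Seq.IH(1)[OF 1(1)] have "s1 = s'" .
    with 1(2) have "exec d s' w s''" by simp
    then show ?thesis by (rule Seq.IH(2))
  qed
next
  case (IfTrue e s c t s' d)
  from IfTrue.prems show ?case
  proof (rule exec_IfPosE)
    fix w assume "exec c s w s''"
    then show ?thesis by (rule IfTrue.IH)
  next
    assume "val e s \<le> 0"
    with IfTrue.hyps(1) show ?thesis by simp
  qed
next
  case (IfFalse e s d t s' c)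
  from IfFalse.prems show ?case
  proof (rule exec_IfPosE)
    assume "0 < val e s"
    with IfFalse.hyps(1) show ?thesis by simp
  next
    fix w assume "exec d s w s''"
    then show ?thesis by (rule IfFalse.IH)
  qed
next
  case (WhileFalse e s c)
  from WhileFalse.prems show ?case
  proof (rule exec_WhilePosE)
    assume "s'' = s"
    then show ?thesis .
  next
    assume "0 < val e s"
    with WhileFalse.hyps show ?thesis by simp
  qed
next
  case (WhileTrue e s c t s' t' s2)
  from WhileTrue.prems show ?case
  proof (rule exec_WhilePosE)
    assume "val e s \<le> 0"
    with WhileTrue.hyps(1) show ?thesis by simp
  next
    fix v s1 w
    assume 1: "exec c s v s1" "exec (WhilePos e c) s1 w s''"
    from WhileTrue.IH(1)[OF 1(1)] have "s1 = s'" .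
    with 1(2) have "exec (WhilePos e c) s' w s''" by simp
    then show ?thesis by (rule WhileTrue.IH(2))
  qed
qed

section \<open>The reconstruction program and its invariants\<close>

abbreviation "plus1 e \<equiv> Add e (Const 1)"

text \<open>The coefficients of \<open>\<phi>\<close> in degrees \<open>1, \<dots>, n\<close>, from the derivative.\<close>

definition coeffs_prog :: com where
  "coeffs_prog = for_loop ''k'' (var ''n'') (Seq
     (for_loop ''i'' (var ''n'') (Store ''phi'' (plus1 (var ''k''))
        (Add (Cell ''phi'' (plus1 (var ''k''))) (Cell ''deck'' (Add (Mul (var ''i'') (var ''n'')) (var ''k''))))))
     (Store ''phi'' (plus1 (var ''k'')) (Quo (Cell ''phi'' (plus1 (var ''k''))) (plus1 (var ''k'')))))"

text \<open>The degree of a vertex is \<open>m\<close> minus the number of edges that avoid it, and edge numbers are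
  the negated third coefficients from the top.\<close>

definition degrees_prog :: com where
  "degrees_prog = for_loop ''i'' (var ''n'') (Seq
     (Store ''d'' (var ''i'') (Sub (Cell ''deck'' (Add (Mul (var ''i'') (var ''n'')) (Sub (var ''n'') (Const 3))))
        (Cell ''phi'' (Sub (var ''n'') (Const 2)))))
     (assign ''S'' (Add (var ''S'') (Mul (Cell ''d'' (var ''i'')) (Cell ''d'' (var ''i''))))))"

text \<open>The entries of \<open>e = A\<^sup>2 \<one>\<close>, by \<open>quad_free_walks_2\<close> with \<open>r 4\<close> taken from \<open>quad_free_iff\<close>.  For \<open>n < 5\<close> a polynomial of the deck has no coefficient in degree
  \<open>n - 5\<close>; the value 0 has to be used, whereas the address may lie in a neighbouring row.\<close>

definition second_prog :: com where
  "second_prog = for_loop ''i'' (var ''n'') (Seq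
     (IfPos (Sub (var ''n'') (Const 4))
        (Store ''e'' (var ''i'') (Cell ''deck'' (Add (Mul (var ''i'') (var ''n'')) (Sub (var ''n'') (Const 5))))) Skip)
     (Store ''e'' (var ''i'') (Sub (Sub
        (Add (Sub (Cell ''e'' (var ''i'')) (Mul (Cell ''d'' (var ''i'')) (Cell ''d'' (var ''i'')))) (Cell ''d'' (var ''i'')))
        (Mul (Cell ''phi'' (Sub (var ''n'') (Const 2))) (Cell ''d'' (var ''i''))))
        (Quo (Sub (Sub (Mul (Cell ''phi'' (Sub (var ''n'') (Const 2))) (Cell ''phi'' (Sub (var ''n'') (Const 2))))
           (Cell ''phi'' (Sub (var ''n'') (Const 2)))) (var ''S'')) (Const 2)))))"

text \<open>Integers with \<open>D e = N d + M \<one>\<close> and \<open>D \<noteq> 0\<close>.  The initial values serve regular graphs, where \<open>e = d 0 * d\<close>;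
  otherwise every vertex \<open>i\<close> with \<open>d i \<noteq> d 0\<close> yields such numbers, and the last one prevails.\<close>

definition relation_prog :: com where
  "relation_prog = Seq (assign ''D'' (Const 1)) (Seq (assign ''N'' (var ''d'')) (Seq (assign ''M'' (Const 0))
     (for_loop ''i'' (var ''n'')
       (IfPos (Mul (Sub (Cell ''d'' (var ''i'')) (var ''d'')) (Sub (Cell ''d'' (var ''i'')) (var ''d'')))
         (Seq (assign ''D'' (Sub (Cell ''d'' (var ''i'')) (var ''d'')))
         (Seq (assign ''N'' (Sub (Cell ''e'' (var ''i'')) (var ''e'')))
              (assign ''M'' (Sub (Mul (var ''D'') (var ''e'')) (Mul (var ''N'') (var ''d''))))))
         Skip))))"

definition walks_prog :: com where
  "walks_prog = Seq (assign ''w'' (var ''n''))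
     (Seq (Store ''w'' (Const 1) (Sub (Const 0) (Mul (Const 2) (Cell ''phi'' (Sub (var ''n'') (Const 2))))))
     (for_loop ''i'' (Sub (var ''n'') (Const 1)) (Store ''w'' (Add (var ''i'') (Const 2))
        (Quo (Add (Mul (var ''N'') (Cell ''w'' (plus1 (var ''i'')))) (Mul (var ''M'') (Cell ''w'' (var ''i'')))) (var ''D'')))))"

text \<open>The constant term, from \<open>n * c 0 = - (\<Sum>k=1..n. c k * w k)\<close>.\<close>

definition constant_prog :: com where
  "constant_prog = Seq (for_loop ''i'' (var ''n'')
       (assign ''phi'' (Sub (var ''phi'') (Mul (Cell ''phi'' (plus1 (var ''i''))) (Cell ''w'' (plus1 (var ''i'')))))))
     (assign ''phi'' (Quo (var ''phi'') (var ''n'')))"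

text \<open>The sum is extended to \<open>l < n\<close> for all \<open>k\<close>; the cells of \<open>phi\<close> beyond \<open>n\<close> are 0.\<close>

definition walk_poly_prog :: com where
  "walk_poly_prog = for_loop ''k'' (plus1 (var ''n'')) (Seq
     (Store ''p'' (var ''k'') (Cell ''phi'' (var ''k'')))
     (for_loop ''i'' (var ''n'') (Store ''p'' (var ''k'') (Add (Cell ''p'' (var ''k''))
        (Mul (Cell ''phi'' (Add (plus1 (var ''k'')) (var ''i''))) (Cell ''w'' (var ''i'')))))))"

text \<open>Horner's scheme in place.  The coefficients are updated from the top, so that each step still
  finds the old value of its lower neighbour.\<close>

definition shift_prog :: com where
  "shift_prog = Seq (assign ''g'' (Const 1)) (for_loop ''k'' (plus1 (var ''n'')) (Seq
     (for_loop ''i'' (var ''n'') (Store ''cophi'' (Sub (var ''n'') (var ''i''))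
        (Add (Cell ''cophi'' (Sub (var ''n'') (var ''i'')))
             (Cell ''cophi'' (Sub (Sub (var ''n'') (var ''i'')) (Const 1))))))
     (Seq (assign ''cophi'' (Add (var ''cophi'') (Mul (var ''g'') (Cell ''p'' (Sub (var ''n'') (var ''k''))))))
          (assign ''g'' (Sub (Const 0) (var ''g''))))))"

definition reconstruct_prog :: com where
  "reconstruct_prog = Seq coeffs_prog (Seq degrees_prog (Seq second_prog (Seq relation_prog
     (Seq walks_prog (Seq constant_prog (Seq walk_poly_prog shift_prog))))))"

lemma abs_sum_le:
  fixes f :: "nat \<Rightarrow> int"
  assumes "\<And>t. t < m \<Longrightarrow> \<bar>f t\<bar> \<le> b" shows "\<bar>\<Sum>t<m. f t\<bar> \<le> int m * b"
  using order_trans[OF sum_abs sum_bounded_above[of "{..<m}" "\<lambda>t. \<bar>f t\<bar>" b]] assms by simp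

text \<open>The facts about a graph on which the program relies, in terms of the listed deck \<open>\<delta>\<close>, the coefficients
  \<open>c\<close> of \<open>\<phi>\<close>, the degrees \<open>d\<close>, the entries \<open>e\<close> of \<open>A\<^sup>2 \<one>\<close> and the walk numbers \<open>w\<close>.
  The vertices are numbered as in the list.  The number \<open>B\<close> bounds all these quantities, and
  \<open>B ^ 5\<close> bounds every value that the program stores.\<close>

locale reconstruction =
  fixes n :: nat and \<delta> :: "nat \<Rightarrow> nat \<Rightarrow> int" and c d e w :: "nat \<Rightarrow> int" and B :: int and L :: nat
  assumes n3: "3 \<le> n"
    and sum_deck: "\<And>k. k < n \<Longrightarrow> (\<Sum>i<n. \<delta> i k) = c (Suc k) * (int k + 1)"
    and c_high: "\<And>k. n < k \<Longrightarrow> c k = 0"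
    and d_eq: "\<And>i. i < n \<Longrightarrow> d i = \<delta> i (n - 3) - c (n - 2)"
    and e_eq: "\<And>i. i < n \<Longrightarrow> e i = (if 5 \<le> n then \<delta> i (n - 5) else 0) - d i * d i + d i - c (n - 2) * d i
        - (c (n - 2) * c (n - 2) - c (n - 2) - (\<Sum>i<n. d i * d i)) div 2"
    and regular: "\<And>j. (\<And>i. i < n \<Longrightarrow> d i = d 0) \<Longrightarrow> j < n \<Longrightarrow> e j = d 0 * d j"
    and cross: "\<And>i j. i < n \<Longrightarrow> j < n \<Longrightarrow> d i \<noteq> d 0 \<Longrightarrow> (d i - d 0) * (e j - e 0) = (e i - e 0) * (d j - d 0)"
    and w_0: "w 0 = int n" and w_1: "w (Suc 0) = - 2 * c (n - 2)"
    and w_rec: "\<And>D N M l. (\<And>j. j < n \<Longrightarrow> D * e j = N * d j + M) \<Longrightarrow>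
        D * w (l + 2) = N * w (l + 1) + M * w l"
    and c_0: "int n * c 0 = - (\<Sum>k<n. c (Suc k) * w (Suc k))"
    and deck_le: "\<And>i k. i < n \<Longrightarrow> k < n \<Longrightarrow> \<bar>\<delta> i k\<bar> \<le> B"
    and c_le: "\<And>k. \<bar>c k\<bar> \<le> B"
    and d_le: "\<And>i. i < n \<Longrightarrow> \<bar>d i\<bar> \<le> B" and e_le: "\<And>i. i < n \<Longrightarrow> \<bar>e i\<bar> \<le> B"
    and w_le: "\<And>l. l \<le> n \<Longrightarrow> \<bar>w l\<bar> \<le> B"
    and n_le: "2 ^ Suc n \<le> B" and L: "B ^ 5 < 2 ^ L"
begin

abbreviation "run \<equiv> runs (Suc n) L"

text \<open>The coefficients of the polynomial \<open>\<phi> + \<one>\<^sup>T adj (x I - A) \<one>\<close>.\<close>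

definition "P k = c k + (\<Sum>l<n. c (Suc k + l) * w l)"

definition "input s \<longleftrightarrow> s ''n'' (0::int) = int n \<and>
  (\<forall>i<n. \<forall>k<n. s ''deck'' (int i * int n + int k) = \<delta> i k)"

lemma n_B: "int (Suc n) \<le> B"
proof -
  have "Suc n < 2 ^ Suc n" by (rule less_exp)
  then have "int (Suc n) \<le> 2 ^ Suc n" by (metis of_nat_le_iff of_nat_numeral of_nat_power less_imp_le)
  with n_le show ?thesis by linarith
qed

lemma B4: "4 \<le> B" using n_B n3 by linarith

lemma small: assumes "\<bar>x\<bar> \<le> B ^ k" "k \<le> 5" shows "\<bar>x\<bar> < 2 ^ L"
proof -
  have "B ^ k \<le> B ^ 5" using assms(2) B4 by (intro power_increasing) auto
  with assms(1) L show ?thesis by linarith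
qed

lemma small1: "\<bar>x\<bar> \<le> B \<Longrightarrow> \<bar>x\<bar> < 2 ^ L" using small[of x 1] by simp

lemma N_L: "int (Suc n) < 2 ^ L" using small1[of "int (Suc n)"] n_B by simp

lemma prod_le: "\<bar>x\<bar> \<le> B ^ j \<Longrightarrow> \<bar>y\<bar> \<le> B ^ k \<Longrightarrow> \<bar>x * y\<bar> \<le> B ^ (j + k)"
  unfolding abs_mult power_add by (intro mult_mono) auto

lemma sum_le:
  assumes "\<And>t. t < m \<Longrightarrow> \<bar>f t\<bar> \<le> B ^ k" "m \<le> n" shows "\<bar>\<Sum>t<m. f t\<bar> \<le> B ^ Suc k"
proof -
  have "\<bar>\<Sum>t<m. f t\<bar> \<le> int m * B ^ k" using assms(1) by (rule abs_sum_le)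
  also have "\<dots> \<le> B * B ^ k" using assms(2) n_B B4 by (intro mult_right_mono) auto
  finally show ?thesis by simp
qed

lemma add_le: assumes "\<bar>x\<bar> \<le> B ^ k" "\<bar>y\<bar> \<le> B ^ k" shows "\<bar>x + y\<bar> \<le> B ^ Suc k" "\<bar>x - y\<bar> \<le> B ^ Suc k"
proof -
  have "2 * B ^ k \<le> B * B ^ k" using B4 by (intro mult_right_mono) auto
  then show "\<bar>x + y\<bar> \<le> B ^ Suc k" "\<bar>x - y\<bar> \<le> B ^ Suc k" using assms by auto
qed

lemma idx: "int k = int j + 1 \<longleftrightarrow> k = Suc j" "int k = 1 + int j \<longleftrightarrow> k = Suc j"
  by auto

lemma input_n: "input s \<Longrightarrow> s ''n'' (0::int) = int n"
  by (simp add: input_def)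

lemma input_deck: "input s \<Longrightarrow> i < n \<Longrightarrow> k < n \<Longrightarrow> s ''deck'' (int i * int n + int k) = \<delta> i k"
  by (simp add: input_def)

lemma input_frame: "input s0 \<Longrightarrow> s ''n'' = s0 ''n'' \<Longrightarrow> s ''deck'' = s0 ''deck'' \<Longrightarrow> input s"
  by (simp add: input_def)

lemma run_coeffs:
  assumes inp: "input s0" and z: "\<And>k. s0 ''phi'' (int k) = 0"
  shows "run coeffs_prog (\<lambda>s. (\<forall>k. s ''phi'' (int k) = (if k = 0 then 0 else c k)) \<and>
    (\<forall>y. y \<notin> {''i'', ''k'', ''phi''} \<longrightarrow> s y = s0 y)) s0"
proof -
  note n = input_n[OF inp] and dk = input_deck[OF inp]
  show ?thesis
    unfolding coeffs_prog_def
  proof (rule runs_for_loop[where K = n and I = "\<lambda>j s. s ''k'' 0 = int j \<and>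
      (\<forall>k. s ''phi'' (int k) = (if 0 < k \<and> k \<le> j then c k else 0)) \<and>
      (\<forall>y. y \<notin> {''i'', ''k'', ''phi''} \<longrightarrow> s y = s0 y)"], goal_cases)
    case (5 j s)
    note I = 5(2)[THEN conjunct1] 5(2)[THEN conjunct2, THEN conjunct1, rule_format]
      5(2)[THEN conjunct2, THEN conjunct2, rule_format]
    show ?case
    proof (rule runs_Seq, rule runs_for_loop[where K = n and I = "\<lambda>i t. t ''i'' 0 = int i \<and>
        (\<forall>k. t ''phi'' (int k) = (if 0 < k \<and> k \<le> j then c k else if k = Suc j then \<Sum>r<i. \<delta> r j else 0)) \<and>
        (\<forall>y. y \<notin> {''i'', ''phi''} \<longrightarrow> t y = s y)"], goal_cases)
      case (5 i t)
      note J = 5(2)[THEN conjunct1] 5(2)[THEN conjunct2, THEN conjunct1, rule_format]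
        5(2)[THEN conjunct2, THEN conjunct2, rule_format]
      have v: "t ''phi'' (int j + 1) = (\<Sum>r<i. \<delta> r j)"
        using J(2)[of "Suc j"] by (simp add: add.commute)
      have "\<bar>\<Sum>r<Suc i. \<delta> r j\<bar> \<le> B ^ Suc 1"
        using 5(1) \<open>j < n\<close> by (intro sum_le) (simp_all add: deck_le)
      then have b: "\<bar>\<Sum>r<Suc i. \<delta> r j\<bar> < 2 ^ L" by (rule small) simp
      show ?case
      proof (rule runs_Store, goal_cases)
        case 1
        show ?case using b by (simp add: J n I v dk[OF 5(1) \<open>j < n\<close>])
      next
        case 2
        show ?case using J(2)[of 0] by (simp add: J n I v dk[OF 5(1) \<open>j < n\<close>] idx)
      qed
    next
      case (6 t)
      note J = 6[THEN conjunct1] 6[THEN conjunct2, THEN conjunct1, rule_format]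
        6[THEN conjunct2, THEN conjunct2, rule_format]
      have v: "t ''phi'' (int j + 1) = (\<Sum>r<n. \<delta> r j)"
        using J(2)[of "Suc j"] by (simp add: add.commute)
      have q: "t ''phi'' (int j + 1) div (int j + 1) = c (Suc j)"
        unfolding v sum_deck[OF \<open>j < n\<close>] by simp
      show ?case
      proof (rule runs_Store, goal_cases)
        case 1
        show ?case using small1[OF c_le[of "Suc j"]] q by (simp add: J I)
      next
        case 2
        show ?case using q J(2)[of 0] by (simp add: J I idx)
      qed
    next
      case 3 then show ?case by (simp add: I)
    next
      case 4 then show ?case by (simp add: I n)
    qed (use N_L in simp_all)
  next
    case (6 s)
    then show ?case using c_high by auto
  next
    case 3 then show ?case by (simp add: z)
  next
    case (4 j s)
    then show ?case using inp by (simp add: input_def)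
  qed (use N_L in simp_all)
qed

text \<open>The state of \<open>phi\<close> while the constant term is still unknown.\<close>

definition "has_coeffs s \<longleftrightarrow> (\<forall>k. s ''phi'' (int k) = (if k = 0 then 0 else c k))"

lemma has_coeffs_second: "has_coeffs s \<Longrightarrow> s ''phi'' (int n - 2) = c (n - 2)"
proof -
  assume "has_coeffs s"
  then have "s ''phi'' (int (n - 2)) = (if n - 2 = 0 then 0 else c (n - 2))"
    unfolding has_coeffs_def by (rule spec)
  moreover have "int (n - 2) = int n - 2" "n - 2 \<noteq> 0" using n3 by auto
  ultimately show ?thesis by (simp only: if_False)
qed

lemma run_degrees:
  assumes inp: "input s0" and phi: "has_coeffs s0" and z: "s0 ''S'' 0 = 0"
  shows "run degrees_prog (\<lambda>s. (\<forall>k<n. s ''d'' (int k) = d k) \<and> s ''S'' 0 = (\<Sum>r<n. d r * d r) \<and>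
    (\<forall>y. y \<notin> {''i'', ''d'', ''S''} \<longrightarrow> s y = s0 y)) s0"
proof -
  have dk: "s0 ''deck'' (int j * int n + (int n - 3)) = \<delta> j (n - 3)" if "j < n" for j
    using input_deck[OF inp that, of "n - 3"] n3 by (simp add: of_nat_diff)
  note n = input_n[OF inp] and ph = has_coeffs_second[OF phi]
  show ?thesis
    unfolding degrees_prog_def
  proof (rule runs_for_loop[where K = n and I = "\<lambda>j s. s ''i'' 0 = int j \<and>
      (\<forall>k<j. s ''d'' (int k) = d k) \<and> s ''S'' 0 = (\<Sum>r<j. d r * d r) \<and>
      (\<forall>y. y \<notin> {''i'', ''d'', ''S''} \<longrightarrow> s y = s0 y)"], goal_cases)
    case (5 j s)
    note I = 5(2)[THEN conjunct1] 5(2)[THEN conjunct2, THEN conjunct1, rule_format]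
      5(2)[THEN conjunct2, THEN conjunct2, THEN conjunct1]
      5(2)[THEN conjunct2, THEN conjunct2, THEN conjunct2, rule_format]
    have "\<bar>\<Sum>r<Suc j. d r * d r\<bar> \<le> B ^ Suc (1 + 1)"
      using 5(1) by (intro sum_le prod_le) (simp_all add: d_le)
    then have b: "\<bar>\<Sum>r<Suc j. d r * d r\<bar> < 2 ^ L" by (rule small) simp
    show ?case
    proof (rule runs_Seq, rule runs_Store, goal_cases)
      case 1
      show ?case using small1[OF d_le[OF 5(1)]] d_eq[OF 5(1)] by (simp add: I n ph dk[OF 5(1)])
    next
      case 2
      show ?case
      proof (rule runs_Store, goal_cases)
        case 1
        show ?case using b d_eq[OF 5(1)] by (simp add: I n ph dk[OF 5(1)])
      next
        case 2
        show ?case using d_eq[OF 5(1)] by (simp add: I n ph dk[OF 5(1)] less_Suc_eq all_conj_distrib)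
      qed
    qed
  next
    case 3 then show ?case by (simp add: z)
  next
    case (4 j s) then show ?case by (simp add: n)
  qed (use N_L in simp_all)
qed

lemma run_second:
  assumes inp: "input s0" and phi: "has_coeffs s0" and z: "\<And>k. s0 ''e'' (int k) = 0"
    and dd: "\<And>k. k < n \<Longrightarrow> s0 ''d'' (int k) = d k" and S: "s0 ''S'' 0 = (\<Sum>r<n. d r * d r)"
  shows "run second_prog (\<lambda>s. (\<forall>k<n. s ''e'' (int k) = e k) \<and>
    (\<forall>y. y \<notin> {''i'', ''e''} \<longrightarrow> s y = s0 y)) s0"
  unfolding second_prog_def
proof (rule runs_for_loop[where K = n and I = "\<lambda>j s. s ''i'' 0 = int j \<and>
      (\<forall>k. s ''e'' (int k) = (if k < j then e k else 0)) \<and>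
      (\<forall>y. y \<notin> {''i'', ''e''} \<longrightarrow> s y = s0 y)"], goal_cases)
  case (5 j s)
  note I = 5(2)[THEN conjunct1] 5(2)[THEN conjunct2, THEN conjunct1, rule_format]
    5(2)[THEN conjunct2, THEN conjunct2, rule_format]
  let ?q = "if 5 \<le> n then \<delta> j (n - 5) else 0"
  note n = input_n[OF inp] and ph = has_coeffs_second[OF phi]
  have dk: "s0 ''deck'' (int j * int n + (int n - 5)) = \<delta> j (n - 5)" if "5 \<le> n"
    using input_deck[OF inp 5(1), of "n - 5"] n3 that by (simp add: of_nat_diff)
  show ?case
  proof (rule runs_Seq, rule runs_mono[where Q = "\<lambda>t. t ''i'' 0 = int j \<and>
      (\<forall>k. t ''e'' (int k) = (if k < j then e k else if k = j then ?q else 0)) \<and>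
      (\<forall>y. y \<notin> {''i'', ''e''} \<longrightarrow> t y = s0 y)"], goal_cases)
    case 1
    show ?case
    proof (rule runs_IfPos, goal_cases)
      case 1
      then have n5: "5 \<le> n" by (simp add: I n)
      show ?case
      proof (rule runs_Store, goal_cases)
        case 1
        show ?case using small1[OF deck_le[OF 5(1), of "n - 5"]] n5 by (simp add: I n dk)
      next
        case 2
        show ?case using n5 by (simp add: I n dk)
      qed
    next
      case 2
      then have n5: "\<not> 5 \<le> n" by (simp add: I n)
      show ?case by (rule runs_Skip) (use n5 in \<open>simp add: I\<close>)
    qed
  next
    case (2 t)
    note J = 2[THEN conjunct1] 2[THEN conjunct2, THEN conjunct1, rule_format]
      2[THEN conjunct2, THEN conjunct2, rule_format]
    have q: "t ''e'' (int j) = ?q" using J(2)[of j] by simp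
    have v: "?q - d j * d j + d j - c (n - 2) * d j
        - (c (n - 2) * c (n - 2) - c (n - 2) - (\<Sum>r<n. d r * d r)) div 2 = e j"
      using e_eq[OF 5(1)] by simp
    show ?case
    proof (rule runs_Store, goal_cases)
      case 1
      show ?case using small1[OF e_le[OF 5(1)]]
        by (simp only: val.simps J(1) q) (simp add: J(3) n ph dd[OF 5(1)] S v)
    next
      case 2
      have "val (Sub (Sub
        (Add (Sub (Cell ''e'' (var ''i'')) (Mul (Cell ''d'' (var ''i'')) (Cell ''d'' (var ''i'')))) (Cell ''d'' (var ''i'')))
        (Mul (Cell ''phi'' (Sub (var ''n'') (Const 2))) (Cell ''d'' (var ''i''))))
        (Quo (Sub (Sub (Mul (Cell ''phi'' (Sub (var ''n'') (Const 2))) (Cell ''phi'' (Sub (var ''n'') (Const 2))))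
           (Cell ''phi'' (Sub (var ''n'') (Const 2)))) (var ''S'')) (Const 2))) t = e j"
        by (simp only: val.simps J(1) q) (simp add: J(3) n ph dd[OF 5(1)] S v)
      then show ?case by (simp add: J less_Suc_eq del: val.simps(3-6))
    qed
  qed
next
  case 3 then show ?case by (simp add: z)
next
  case (4 j s) then show ?case by (simp add: input_n[OF inp])
qed (use N_L in simp_all)

definition "relation s \<longleftrightarrow> s ''D'' (0::int) \<noteq> 0 \<and>
  (\<forall>j<n. s ''D'' 0 * e j = s ''N'' 0 * d j + s ''M'' 0)"

lemma run_relation:
  assumes inp: "input s0" and dd: "\<And>k. k < n \<Longrightarrow> s0 ''d'' (int k) = d k"
    and ee: "\<And>k. k < n \<Longrightarrow> s0 ''e'' (int k) = e k"
  shows "run relation_prog (\<lambda>s. relation s \<and>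
    (\<forall>y. y \<notin> {''i'', ''D'', ''N'', ''M''} \<longrightarrow> s y = s0 y)) s0"
proof -
  have n0: "0 < n" using n3 by simp
  note n = input_n[OF inp] and d0 = dd[OF n0, simplified] and e0 = ee[OF n0, simplified]
  have M: "\<bar>(d j - d 0) * e 0 - (e j - e 0) * d 0\<bar> < 2 ^ L" if "j < n" for j
  proof (rule small)
    have "\<bar>d j - d 0\<bar> \<le> B ^ Suc 1" "\<bar>e j - e 0\<bar> \<le> B ^ Suc 1"
      using d_le[OF that] d_le[OF n0] e_le[OF that] e_le[OF n0] by (intro add_le; simp)+
    then have "\<bar>(d j - d 0) * e 0\<bar> \<le> B ^ (Suc 1 + 1)" "\<bar>(e j - e 0) * d 0\<bar> \<le> B ^ (Suc 1 + 1)"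
      using d_le[OF n0] e_le[OF n0] by (intro prod_le; simp)+
    then show "\<bar>(d j - d 0) * e 0 - (e j - e 0) * d 0\<bar> \<le> B ^ Suc (Suc 1 + 1)" by (rule add_le(2))
  qed simp
  have diff: "\<bar>d j - d 0\<bar> < 2 ^ L" "\<bar>e j - e 0\<bar> < 2 ^ L" if "j < n" for j
  proof -
    have "\<bar>d j - d 0\<bar> \<le> B ^ Suc 1" "\<bar>e j - e 0\<bar> \<le> B ^ Suc 1"
      using d_le[OF that] d_le[OF n0] e_le[OF that] e_le[OF n0] by (intro add_le; simp)+
    from small[OF this(1)] small[OF this(2)]
    show "\<bar>d j - d 0\<bar> < 2 ^ L" "\<bar>e j - e 0\<bar> < 2 ^ L" by simp_all
  qed
  have one: "(1::int) < 2 ^ L" using small1[of 1] B4 by simp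
  define U where "U j \<longleftrightarrow> (\<forall>i<j. d i = d 0)" for j
  \<comment> \<open>Either all vertices seen so far have the degree of the first one and the initial values stand,
    or a vertex of another degree has replaced them.\<close>
  define R where "R j s \<longleftrightarrow> (U j \<and> s ''D'' (0::int) = 1 \<and> s ''N'' (0::int) = d 0 \<and> s ''M'' (0::int) = 0) \<or>
    (\<exists>i<n. d i \<noteq> d 0 \<and> s ''D'' 0 = d i - d 0 \<and> s ''N'' 0 = e i - e 0 \<and>
      s ''M'' 0 = (d i - d 0) * e 0 - (e i - e 0) * d 0)" for j and s :: state
  have R_rel: "relation s" if "R n s" for s
    using that unfolding R_def
  proof (elim disjE exE conjE)
    assume c: "U n" "s ''D'' 0 = 1" "s ''N'' 0 = d 0" "s ''M'' 0 = 0"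
    have "e j = d 0 * d j" if "j < n" for j
      by (rule regular[OF _ that]) (use c(1) U_def in blast)
    then show ?thesis unfolding relation_def c(2-4) by simp
  next
    fix i assume i: "i < n" "d i \<noteq> d 0" "s ''D'' 0 = d i - d 0" "s ''N'' 0 = e i - e 0"
      "s ''M'' 0 = (d i - d 0) * e 0 - (e i - e 0) * d 0"
    have key: "(d i - d 0) * e j = (e i - e 0) * d j + ((d i - d 0) * e 0 - (e i - e 0) * d 0)" if "j < n" for j
      using cross[OF i(1) that i(2)] by (simp add: algebra_simps)
    show ?thesis unfolding relation_def i(3-5)
    proof (intro conjI allI impI)
      show "d i - d 0 \<noteq> 0" using i(2) by simp
    qed (rule key)
  qed
  have loop: "run (for_loop ''i'' (var ''n'')
       (IfPos (Mul (Sub (Cell ''d'' (var ''i'')) (var ''d'')) (Sub (Cell ''d'' (var ''i'')) (var ''d'')))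
         (Seq (assign ''D'' (Sub (Cell ''d'' (var ''i'')) (var ''d'')))
         (Seq (assign ''N'' (Sub (Cell ''e'' (var ''i'')) (var ''e'')))
              (assign ''M'' (Sub (Mul (var ''D'') (var ''e'')) (Mul (var ''N'') (var ''d''))))))
         Skip))
     (\<lambda>s. relation s \<and> (\<forall>y. y \<notin> {''i'', ''D'', ''N'', ''M''} \<longrightarrow> s y = s0 y)) s1"
    if s1: "s1 ''D'' 0 = 1" "s1 ''N'' 0 = d 0" "s1 ''M'' 0 = 0"
      "\<And>y. y \<notin> {''i'', ''D'', ''N'', ''M''} \<Longrightarrow> s1 y = s0 y" for s1
  proof (rule runs_for_loop[where K = n and I = "\<lambda>j s. s ''i'' 0 = int j \<and> R j s \<and>
      (\<forall>y. y \<notin> {''i'', ''D'', ''N'', ''M''} \<longrightarrow> s y = s0 y)"], goal_cases)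
    case 3 show ?case using s1 by (simp add: R_def U_def)
  next
    case (4 j s) then show ?case by (simp add: n)
  next
    case (6 s) then show ?case using R_rel by blast
  next
    case (5 j s)
    note I = 5(2)[THEN conjunct1] 5(2)[THEN conjunct2, THEN conjunct1]
      5(2)[THEN conjunct2, THEN conjunct2, rule_format]
    note sm = I(1,3) n d0 e0 dd[OF 5(1)] ee[OF 5(1)]
    show ?case
    proof (rule runs_IfPos, goal_cases)
      case 1
      then have ne: "d j \<noteq> d 0" by (auto simp: sm)
      have RS: "R (Suc j) s'" if "s' ''D'' 0 = d j - d 0" "s' ''N'' 0 = e j - e 0"
        "s' ''M'' 0 = (d j - d 0) * e 0 - (e j - e 0) * d 0" for s'
        unfolding R_def using that ne 5(1) by blast
      show ?case
      proof (intro runs_Seq runs_Store, goal_cases)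
        case 1 show ?case using diff[OF 5(1)] by (simp add: sm)
      next
        case 2 show ?case using diff[OF 5(1)] by (simp add: sm)
      next
        case 3 show ?case using M[OF 5(1)] by (simp add: sm)
      next
        case 4 show ?case by (intro conjI RS) (simp_all add: sm)
      qed
    next
      case 2
      have "d j = d 0"
      proof (rule ccontr)
        assume "d j \<noteq> d 0"
        then have "0 < (d j - d 0) * (d j - d 0)" by (auto simp: zero_less_mult_iff)
        with 2 show False by (simp add: sm)
      qed
      then have "U j \<Longrightarrow> U (Suc j)" unfolding U_def by (metis less_SucE)
      then have "R (Suc j) (s(''i'' := (s ''i'')(0 := int (Suc j))))"
        using I(2) unfolding R_def by (elim disjE) simp_all
      then show ?case by (intro runs_Skip conjI) (simp_all add: sm)
    qed
  qed (use N_L in simp_all)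
  show ?thesis unfolding relation_prog_def
  proof (intro runs_Seq runs_Store loop, goal_cases)
    case 1 show ?case using one by simp
  next
    case 2 show ?case using small1[OF d_le[OF n0]] by (simp add: d0)
  qed (simp_all add: d0)
qed

lemma run_walks:
  assumes inp: "input s0" and phi: "has_coeffs s0" and rel: "relation s0"
  shows "run walks_prog (\<lambda>s. (\<forall>k\<le>n. s ''w'' (int k) = w k) \<and>
    (\<forall>y. y \<notin> {''i'', ''w''} \<longrightarrow> s y = s0 y)) s0"
proof -
  note n = input_n[OF inp] and ph = has_coeffs_second[OF phi]
  have n1: "Suc 0 \<le> n" using n3 by simp
  have loop: "run (for_loop ''i'' (Sub (var ''n'') (Const 1)) (Store ''w'' (Add (var ''i'') (Const 2))
        (Quo (Add (Mul (var ''N'') (Cell ''w'' (plus1 (var ''i'')))) (Mul (var ''M'') (Cell ''w'' (var ''i'')))) (var ''D''))))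
     (\<lambda>s. (\<forall>k\<le>n. s ''w'' (int k) = w k) \<and> (\<forall>y. y \<notin> {''i'', ''w''} \<longrightarrow> s y = s0 y)) s1"
    if s1: "s1 ''w'' 0 = w 0" "s1 ''w'' 1 = w (Suc 0)" "\<And>y. y \<notin> {''i'', ''w''} \<Longrightarrow> s1 y = s0 y" for s1
  proof (rule runs_for_loop[where K = "n - 1" and I = "\<lambda>j s. s ''i'' 0 = int j \<and>
      (\<forall>k\<le>Suc j. s ''w'' (int k) = w k) \<and> (\<forall>y. y \<notin> {''i'', ''w''} \<longrightarrow> s y = s0 y)"], goal_cases)
    case 3 show ?case using s1 by (auto simp: le_Suc_eq)
  next
    case (4 j s) then show ?case using n1 by (simp add: n of_nat_diff)
  next
    case (6 s) then show ?case using n1 by simp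
  next
    case (5 j s)
    note I = 5(2)[THEN conjunct1] 5(2)[THEN conjunct2, THEN conjunct1, rule_format]
      5(2)[THEN conjunct2, THEN conjunct2, rule_format]
    have "s ''w'' (int (Suc j)) = w (Suc j)" by (rule I(2)) simp
    moreover have "int (Suc j) = int j + 1" by simp
    ultimately have v: "s ''w'' (int j) = w j" "s ''w'' (int j + 1) = w (Suc j)"
      using I(2)[of j] by (simp_all only: le_SucI order_refl)
    have D: "s0 ''D'' 0 \<noteq> 0" using rel by (simp add: relation_def)
    have "s0 ''D'' 0 * w (j + 2) = s0 ''N'' 0 * w (j + 1) + s0 ''M'' 0 * w j"
      by (rule w_rec) (use rel in \<open>simp add: relation_def\<close>)
    then have q: "(s0 ''N'' 0 * w (Suc j) + s0 ''M'' 0 * w j) div s0 ''D'' 0 = w (Suc (Suc j))"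
      using D by (metis Suc_eq_plus1 add_2_eq_Suc' nonzero_mult_div_cancel_left)
    have ix: "int k = int j + 2 \<longleftrightarrow> k = Suc (Suc j)" for k by auto
    show ?case
    proof (rule runs_Store, goal_cases)
      case 1
      have "Suc (Suc j) \<le> n" using 5(1) by simp
      from small1[OF w_le[OF this]] show ?case by (simp add: I v q)
    next
      case 2
      have "s ''w'' (1 + int j) = w (Suc j)" using v(2) by (simp only: add.commute)
      then show ?case by (simp add: I v q ix le_Suc_eq)
    qed
  qed (use N_L in simp_all)
  show ?thesis unfolding walks_prog_def
  proof (intro runs_Seq runs_Store loop, goal_cases)
    case 1 show ?case using small1[of "int n"] n_B by (simp add: n)
  next
    case 2 show ?case using small1[OF w_le[OF n1]] w_1 by (simp add: n ph)
  qed (use w_0 w_1 in \<open>simp_all add: n ph\<close>)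
qed

lemma run_constant:
  assumes inp: "input s0" and phi: "has_coeffs s0" and ww: "\<And>k. k \<le> n \<Longrightarrow> s0 ''w'' (int k) = w k"
  shows "run constant_prog (\<lambda>s. (\<forall>k. s ''phi'' (int k) = c k) \<and>
    (\<forall>y. y \<notin> {''i'', ''phi''} \<longrightarrow> s y = s0 y)) s0"
  unfolding constant_prog_def
proof (rule runs_Seq, rule runs_for_loop[where K = n and I = "\<lambda>j s. s ''i'' 0 = int j \<and>
    (\<forall>k. s ''phi'' (int k) = (if k = 0 then - (\<Sum>r<j. c (Suc r) * w (Suc r)) else c k)) \<and>
    (\<forall>y. y \<notin> {''i'', ''phi''} \<longrightarrow> s y = s0 y)"], goal_cases)
  case 3 show ?case using phi by (simp add: has_coeffs_def)
next
  case (4 j s) then show ?case by (simp add: input_n[OF inp])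
next
  case (5 j s)
  note I = 5(2)[THEN conjunct1] 5(2)[THEN conjunct2, THEN conjunct1, rule_format]
    5(2)[THEN conjunct2, THEN conjunct2, rule_format]
  have v: "s ''phi'' 0 = - (\<Sum>r<j. c (Suc r) * w (Suc r))" "s ''phi'' (int j + 1) = c (Suc j)"
    "s0 ''w'' (int j + 1) = w (Suc j)"
    using I(2)[of 0] I(2)[of "Suc j"] ww[of "Suc j"] 5(1) by (simp_all add: add.commute)
  have "\<bar>\<Sum>r<Suc j. c (Suc r) * w (Suc r)\<bar> \<le> B ^ Suc (1 + 1)"
    using 5(1) by (intro sum_le prod_le) (simp_all add: c_le w_le)
  then have b: "\<bar>\<Sum>r<Suc j. c (Suc r) * w (Suc r)\<bar> < 2 ^ L" by (rule small) simp
  show ?case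
  proof (rule runs_Store, goal_cases)
    case 1 show ?case using b by (simp add: I(1,3) v)
  next
    case 2 show ?case by (simp add: I v)
  qed
next
  case (6 s)
  note I = 6[THEN conjunct1] 6[THEN conjunct2, THEN conjunct1, rule_format]
    6[THEN conjunct2, THEN conjunct2, rule_format]
  have v: "s ''phi'' 0 = int n * c 0" using I(2)[of 0] c_0 by simp
  have q: "int n * c 0 div int n = c 0" using n3 by simp
  show ?case
  proof (rule runs_Store, goal_cases)
    case 1 show ?case using small1[OF c_le[of 0]] by (simp add: I(1,3) v q input_n[OF inp])
  next
    case 2 show ?case by (simp add: I v q input_n[OF inp])
  qed
qed (use N_L in simp_all)

lemma P_partial: "m \<le> n \<Longrightarrow> \<bar>c k + (\<Sum>l<m. c (Suc k + l) * w l)\<bar> \<le> B ^ 4"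
proof -
  assume m: "m \<le> n"
  have "\<bar>\<Sum>l<m. c (Suc k + l) * w l\<bar> \<le> B ^ Suc (1 + 1)"
    using m by (intro sum_le prod_le) (simp_all add: c_le w_le)
  moreover have "B ^ 1 \<le> B ^ Suc (1 + 1)" using B4 by (intro power_increasing) auto
  ultimately have "\<bar>c k + (\<Sum>l<m. c (Suc k + l) * w l)\<bar> \<le> B ^ Suc (Suc (1 + 1))"
    using c_le[of k] by (intro add_le) auto
  then show ?thesis by (simp add: eval_nat_numeral)
qed

lemma run_walk_poly:
  assumes inp: "input s0" and phi: "\<And>k. s0 ''phi'' (int k) = c k" and ww: "\<And>k. k \<le> n \<Longrightarrow> s0 ''w'' (int k) = w k"
  shows "run walk_poly_prog (\<lambda>s. (\<forall>k\<le>n. s ''p'' (int k) = P k) \<and>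
    (\<forall>y. y \<notin> {''i'', ''k'', ''p''} \<longrightarrow> s y = s0 y)) s0"
  unfolding walk_poly_prog_def
proof (rule runs_for_loop[where K = "Suc n" and I = "\<lambda>j s. s ''k'' 0 = int j \<and>
    (\<forall>k<j. s ''p'' (int k) = P k) \<and> (\<forall>y. y \<notin> {''i'', ''k'', ''p''} \<longrightarrow> s y = s0 y)"], goal_cases)
  case (5 j s)
  note I = 5(2)[THEN conjunct1] 5(2)[THEN conjunct2, THEN conjunct1, rule_format]
    5(2)[THEN conjunct2, THEN conjunct2, rule_format]
  note n = input_n[OF inp]
  let ?Q = "\<lambda>m. c j + (\<Sum>l<m. c (Suc j + l) * w l)"
  have Qn: "?Q n = P j" by (simp add: P_def)
  show ?case
  proof (rule runs_Seq, rule runs_Store, goal_cases)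
    case 1 show ?case using small1[OF c_le[of j]] by (simp add: I phi)
  next
    case 2
    show ?case
    proof (rule runs_for_loop[where K = n and I = "\<lambda>m t. t ''i'' 0 = int m \<and> t ''k'' 0 = int j \<and>
        (\<forall>k\<le>j. t ''p'' (int k) = (if k < j then P k else ?Q m)) \<and>
        (\<forall>y. y \<notin> {''i'', ''k'', ''p''} \<longrightarrow> t y = s0 y)"], goal_cases)
      case 3 show ?case by (simp add: I phi)
    next
      case (4 m t) then show ?case by (simp add: n)
    next
      case (6 t)
      note J = 6[THEN conjunct1] 6[THEN conjunct2, THEN conjunct1]
        6[THEN conjunct2, THEN conjunct2, THEN conjunct1, rule_format]
        6[THEN conjunct2, THEN conjunct2, THEN conjunct2, rule_format]
      show ?case using Qn by (simp add: J less_Suc_eq_le)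
    next
      case (5 m t)
      note J = 5(2)[THEN conjunct1] 5(2)[THEN conjunct2, THEN conjunct1]
        5(2)[THEN conjunct2, THEN conjunct2, THEN conjunct1, rule_format]
        5(2)[THEN conjunct2, THEN conjunct2, THEN conjunct2, rule_format]
      have v: "t ''p'' (int j) = ?Q m" "s0 ''phi'' (int j + 1 + int m) = c (Suc j + m)"
        "s0 ''w'' (int m) = w m"
        using J(3)[of j] phi[of "Suc j + m"] ww[of m] 5(1) by (simp_all add: ac_simps)
      have b: "\<bar>?Q (Suc m)\<bar> < 2 ^ L" using P_partial[of "Suc m" j] 5(1) by (intro small[of _ 4]) simp_all
      have e: "val (Add (Cell ''p'' (var ''k''))
        (Mul (Cell ''phi'' (Add (plus1 (var ''k'')) (var ''i''))) (Cell ''w'' (var ''i'')))) t = ?Q (Suc m)"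
        by (simp add: J(1,2,4) v)
      show ?case
      proof (rule runs_Store, goal_cases)
        case 1 show ?case unfolding e by (rule b)
      next
        case 2 show ?case unfolding e by (simp add: J)
      qed
    qed (use N_L in simp_all)
  qed
next
  case 3 then show ?case by simp
next
  case (4 j s) then show ?case by (simp add: input_n[OF inp])
next
  case (6 s) then show ?case by (simp add: less_Suc_eq_le)
qed (use N_L in simp_all)

lemma run_shift:
  assumes inp: "input s0" and pp: "\<And>k. k \<le> n \<Longrightarrow> s0 ''p'' (int k) = P k"
    and z: "\<And>k. s0 ''cophi'' (int k) = 0"
  shows "run shift_prog (\<lambda>s. (\<forall>m\<le>n. s ''cophi'' (int m) = coeff (horner_shift (\<lambda>t. P (n - t)) (Suc n)) m) \<and>
    (\<forall>y. y \<notin> {''i'', ''k'', ''g'', ''cophi''} \<longrightarrow> s y = s0 y)) s0"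
proof -
  note n = input_n[OF inp]
  let ?R = "\<lambda>t. horner_shift (\<lambda>t. P (n - t)) t"
  have R0: "coeff (?R (Suc t)) 0 = coeff (?R t) 0 + (-1) ^ t * P (n - t)"
    and RS: "coeff (?R (Suc t)) (Suc m) = coeff (?R t) (Suc m) + coeff (?R t) m" for t m
    by simp_all
  have bR: "\<bar>coeff (?R t) m\<bar> < 2 ^ L" if "t \<le> Suc n" for t m
  proof -
    have "\<bar>coeff (?R t) m\<bar> \<le> 2 ^ t * B ^ 4"
      using P_partial[of n] unfolding P_def by (intro horner_shift_bound) simp
    also have "(2::int) ^ t \<le> 2 ^ Suc n" using that by (intro power_increasing) auto
    then have "2 ^ t * B ^ 4 \<le> B * B ^ 4" using n_le B4 by (intro mult_right_mono) auto
    also have "B * B ^ 4 = B ^ 5" by (simp add: eval_nat_numeral)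
    finally show ?thesis by (rule small) simp
  qed
  have one: "(1::int) < 2 ^ L" using small1[of 1] B4 by simp
  have loop: "run (for_loop ''k'' (plus1 (var ''n'')) (Seq
     (for_loop ''i'' (var ''n'') (Store ''cophi'' (Sub (var ''n'') (var ''i''))
        (Add (Cell ''cophi'' (Sub (var ''n'') (var ''i'')))
             (Cell ''cophi'' (Sub (Sub (var ''n'') (var ''i'')) (Const 1))))))
     (Seq (assign ''cophi'' (Add (var ''cophi'') (Mul (var ''g'') (Cell ''p'' (Sub (var ''n'') (var ''k''))))))
          (assign ''g'' (Sub (Const 0) (var ''g''))))))
     (\<lambda>s. (\<forall>m\<le>n. s ''cophi'' (int m) = coeff (?R (Suc n)) m) \<and>
      (\<forall>y. y \<notin> {''i'', ''k'', ''g'', ''cophi''} \<longrightarrow> s y = s0 y)) s1"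
    if s1: "s1 ''g'' 0 = 1" "\<And>y. y \<noteq> ''g'' \<Longrightarrow> s1 y = s0 y" for s1
  proof (rule runs_for_loop[where K = "Suc n" and I = "\<lambda>j s. s ''k'' 0 = int j \<and> s ''g'' 0 = (-1) ^ j \<and>
      (\<forall>m\<le>n. s ''cophi'' (int m) = coeff (?R j) m) \<and>
      (\<forall>y. y \<notin> {''i'', ''k'', ''g'', ''cophi''} \<longrightarrow> s y = s0 y)"], goal_cases)
    case 3 show ?case using s1 by (simp add: z)
  next
    case (4 j s) then show ?case by (simp add: n)
  next
    case (6 s) then show ?case by blast
  next
    case (5 j s)
    note I = 5(2)[THEN conjunct1] 5(2)[THEN conjunct2, THEN conjunct1]
      5(2)[THEN conjunct2, THEN conjunct2, THEN conjunct1, rule_format]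
      5(2)[THEN conjunct2, THEN conjunct2, THEN conjunct2, rule_format]
    show ?case
    proof (rule runs_Seq, rule runs_for_loop[where K = n and I = "\<lambda>i t. t ''i'' 0 = int i \<and>
        (\<forall>m\<le>n. t ''cophi'' (int m) = coeff (?R (if n - i < m then Suc j else j)) m) \<and>
        (\<forall>y. y \<notin> {''i'', ''cophi''} \<longrightarrow> t y = s y)"], goal_cases)
      case 3 show ?case by (simp add: I)
    next
      case (4 i t) then show ?case by (simp add: I n)
    next
      case (5 i t)
      note J = 5(2)[THEN conjunct1] 5(2)[THEN conjunct2, THEN conjunct1, rule_format]
        5(2)[THEN conjunct2, THEN conjunct2, rule_format]
      obtain q where q: "n - i = Suc q" using 5(1) by (metis Suc_diff_Suc)
      have qi: "int n - int i = int (Suc q)" "n - Suc i = q" "Suc q \<le> n" using q 5(1) by linarith+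
      have e: "val (Add (Cell ''cophi'' (Sub (var ''n'') (var ''i'')))
             (Cell ''cophi'' (Sub (Sub (var ''n'') (var ''i'')) (Const 1)))) t = coeff (?R (Suc j)) (Suc q)"
        unfolding RS using J(2)[of "Suc q"] J(2)[of q] qi
        by (simp add: J(1,3) I(1,4) n q)
      have a: "val (Sub (var ''n'') (var ''i'')) t = int (Suc q)" using qi(1) by (simp add: J(1,3) I(1,4) n)
      show ?case
      proof (rule runs_Store, goal_cases)
        case 1 show ?case unfolding e by (rule bR) (use \<open>j < Suc n\<close> in simp)
      next
        case 2
        \<comment> \<open>Only the cell \<open>n - i\<close> changes its status in this pass.\<close>
        have "coeff (?R (if n - i < m then Suc j else j)) m = coeff (?R (if n - Suc i < m then Suc j else j)) m"
          if "m \<noteq> Suc q" for m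
        proof -
          have "n - i < m \<longleftrightarrow> n - Suc i < m" using that q qi(2) by auto
          then show ?thesis by simp
        qed
        then show ?case unfolding e a using qi(2) by (simp add: J del: horner_shift.simps of_nat_Suc)
      qed
    next
      case (6 t)
      note J = 6[THEN conjunct1] 6[THEN conjunct2, THEN conjunct1, rule_format]
        6[THEN conjunct2, THEN conjunct2, rule_format]
      have jn: "j \<le> n" using \<open>j < Suc n\<close> by simp
      have p: "s0 ''p'' (int n - int j) = P (n - j)" using pp[of "n - j"] jn by (simp add: of_nat_diff)
      have c: "t ''cophi'' 0 = coeff (?R j) 0" using J(2)[of 0] by simp
      have e: "val (Add (var ''cophi'') (Mul (var ''g'') (Cell ''p'' (Sub (var ''n'') (var ''k''))))) t
          = coeff (?R (Suc j)) 0"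
        unfolding R0 by (simp add: J(1,3) I(1,2,4) n p c)
      show ?case
      proof (rule runs_Seq, rule runs_Store, goal_cases)
        case 1 show ?case unfolding e by (rule bR) (use jn in simp)
      next
        case 2
        show ?case unfolding e
        proof (rule runs_Store, goal_cases)
          case 1 show ?case using one by (simp add: J(1,3) I(1,2,4) power_abs)
        next
          case 2
          have "coeff (?R (if n - n < m then Suc j else j)) m = coeff (?R (Suc j)) m" if "m \<noteq> 0" for m
            using that by simp
          then show ?case by (simp add: J I(1,2,4) del: horner_shift.simps)
        qed
      qed
    qed (use N_L in simp_all)
  qed (use N_L in simp_all)
  show ?thesis unfolding shift_prog_def
  proof (intro runs_Seq runs_Store loop, goal_cases)
    case 1 show ?case using one by simp
  qed simp_all
qed

lemma run_reconstruct:
  assumes inp: "input s0" and z: "\<And>x i. x \<notin> {''n'', ''deck''} \<Longrightarrow> s0 x i = 0"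
  shows "run reconstruct_prog (\<lambda>s. (\<forall>k. s ''phi'' (int k) = c k) \<and>
    (\<forall>m\<le>n. s ''cophi'' (int m) = coeff (horner_shift (\<lambda>t. P (n - t)) (Suc n)) m)) s0"
  unfolding reconstruct_prog_def
proof (rule runs_Seq, rule runs_mono[OF run_coeffs[OF inp]], goal_cases)
  case (2 s1)
  note A = 2[THEN conjunct2, rule_format] and I1 = 2[THEN conjunct1]
  have i1: "input s1" by (rule input_frame[OF inp]) (simp_all add: A)
  have h1: "has_coeffs s1" using I1 by (simp add: has_coeffs_def)
  show ?case
  proof (rule runs_Seq, rule runs_mono[OF run_degrees[OF i1 h1]], goal_cases)
    case (2 s2)
    note I2 = 2[THEN conjunct1, rule_format] 2[THEN conjunct2, THEN conjunct1]
      and A2 = 2[THEN conjunct2, THEN conjunct2, rule_format]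
    have i2: "input s2" by (rule input_frame[OF i1]) (simp_all add: A2)
    have h2: "has_coeffs s2" using h1 by (simp add: has_coeffs_def A2)
    show ?case
    proof (rule runs_Seq, rule runs_mono[OF run_second[OF i2 h2 _ I2]], goal_cases)
      case (3 s3)
      note I3 = 3[THEN conjunct1, rule_format] and A3 = 3[THEN conjunct2, rule_format]
      have i3: "input s3" by (rule input_frame[OF i2]) (simp_all add: A3)
      have h3: "has_coeffs s3" using h2 by (simp add: has_coeffs_def A3)
      have d3: "s3 ''d'' (int k) = d k" if "k < n" for k using I2(1)[OF that] by (simp add: A3)
      show ?case
      proof (rule runs_Seq, rule runs_mono[OF run_relation[OF i3 d3 I3]], goal_cases)
        case (3 s4)
        note I4 = 3[THEN conjunct1] and A4 = 3[THEN conjunct2, rule_format]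
        have i4: "input s4" by (rule input_frame[OF i3]) (simp_all add: A4)
        have h4: "has_coeffs s4" using h3 by (simp add: has_coeffs_def A4)
        show ?case
        proof (rule runs_Seq, rule runs_mono[OF run_walks[OF i4 h4 I4]], goal_cases)
          case (1 s5)
          note I5 = 1[THEN conjunct1, rule_format] and A5 = 1[THEN conjunct2, rule_format]
          have i5: "input s5" by (rule input_frame[OF i4]) (simp_all add: A5)
          have h5: "has_coeffs s5" using h4 by (simp add: has_coeffs_def A5)
          show ?case
          proof (rule runs_Seq, rule runs_mono[OF run_constant[OF i5 h5 I5]], goal_cases)
            case (2 s6)
            note I6 = 2[THEN conjunct1, rule_format] and A6 = 2[THEN conjunct2, rule_format]
            have i6: "input s6" by (rule input_frame[OF i5]) (simp_all add: A6)
            have w6: "s6 ''w'' (int k) = w k" if "k \<le> n" for k using I5[OF that] by (simp add: A6)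
            show ?case
            proof (rule runs_Seq, rule runs_mono[OF run_walk_poly[OF i6 I6 w6]], goal_cases)
              case (2 s7)
              note I7 = 2[THEN conjunct1, rule_format] and A7 = 2[THEN conjunct2, rule_format]
              have i7: "input s7" by (rule input_frame[OF i6]) (simp_all add: A7)
              have z7: "s7 ''cophi'' (int k) = 0" for k
                by (simp add: A7 A6 A5 A4 A3 A2 A z)
              show ?case
              proof (rule runs_mono[OF run_shift[OF i7 I7 z7]], goal_cases)
                case (2 s8)
                show ?case using 2[THEN conjunct1] I6
                  by (simp add: 2[THEN conjunct2, rule_format] A7 del: horner_shift.simps)
              qed
            qed
          qed
        qed
      qed
    qed (simp_all add: A2 A z)
  qed (simp add: A z)
qed (simp add: z)

end

section \<open>Reconstruction from a listed deck\<close>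

text \<open>Chosen such that \<open>B ^ 5 < 2 ^ word_length n\<close> for \<open>B = (2 * n\<^sup>2) ^ (n + 1)\<close>, by means of \<open>n \<le> 2 ^ n\<close>.\<close>

definition word_length :: "nat \<Rightarrow> nat" where
  "word_length n = 1 + 5 * ((1 + 2 * n) * (1 + n))"

text \<open>An arbitrary listing of the deck corresponds to a permutation of the vertices.\<close>

lemma deck_listing:
  assumes G: "graph_on n G" and ps: "mset ps = polynomial_deck G"
  obtains \<pi> where "\<pi> permutes {..<n}"
    and "\<And>i. i < n \<Longrightarrow> ps ! i = char_poly (mat_delete (adj_matrix G) (\<pi> i) (\<pi> i))"
proof -
  have len: "length ps = n" using size_polynomial_deck[OF G] ps by (metis size_mset)
  have "image_mset (\<lambda>i. ps ! i) (mset_set {..<n}) = mset (map ((!) ps) [0..<n])"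
    by (simp add: lessThan_atLeast0)
  also have "\<dots> = mset ps" using map_nth[of ps] len by simp
  finally have "image_mset (\<lambda>i. ps ! i) (mset_set {..<n})
      = image_mset (\<lambda>i. char_poly (mat_delete (adj_matrix G) i i)) (mset_set {..<n})"
    unfolding ps polynomial_deck_graph_on[OF G] .
  then obtain \<pi> where p: "\<pi> permutes {..<n}"
    and e: "\<forall>i\<in>{..<n}. ps ! i = char_poly (mat_delete (adj_matrix G) (\<pi> i) (\<pi> i))"
    by (rule image_mset_eq_implies_permutes[OF finite_lessThan])
  show thesis
  proof (rule that[OF p])
    fix i assume "i < n"
    then show "ps ! i = char_poly (mat_delete (adj_matrix G) (\<pi> i) (\<pi> i))"
      by (intro bspec[OF e]) simp
  qed
qed

lemma reconstruction_graph:
  assumes G: "graph_on n G" and n: "3 \<le> n" and q: "adjacency.quad_free (adj_matrix G) n"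
    and dep: "adjacency.walks_dependent (adj_matrix G) n" and p: "\<pi> permutes {..<n}"
    and ps: "\<And>i. i < n \<Longrightarrow> ps ! i = char_poly (mat_delete (adj_matrix G) (\<pi> i) (\<pi> i))"
  defines "A \<equiv> adj_matrix G"
  shows "reconstruction n (\<lambda>i k. coeff (ps ! i) k) (coeff (char_poly A))
    (\<lambda>i. adjacency.degr A n (\<pi> i)) (\<lambda>i. walks A 2 (\<pi> i)) (total_walks A)
    ((2 * int n ^ 2) ^ Suc n) (word_length n)"
proof -
  interpret adjacency A n unfolding A_def by (rule adjacency_graph_on[OF G])
  have q: quad_free and dep: walks_dependent using q dep unfolding A_def by auto
  have ps: "ps ! i = char_poly (mat_delete A (\<pi> i) (\<pi> i))" if "i < n" for i
    using ps[OF that] by (simp add: A_def)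
  let ?c = "coeff (char_poly A)" and ?b = "2 * int n ^ 2"
  have pl: "\<pi> i < n" if "i < n" for i using permutes_in_image[OF p, of i] that by simp
  \<comment> \<open>The program sees the vertices in the order of the list; statements about all vertices carry over.\<close>
  have surj: "\<exists>i<n. j = \<pi> i" if "j < n" for j
  proof -
    have "j \<in> \<pi> ` {..<n}" unfolding permutes_image[OF p] using that by simp
    then show ?thesis by auto
  qed
  have sp: "(\<Sum>i<n. f (\<pi> i)) = (\<Sum>i<n. f i)" for f :: "nat \<Rightarrow> int"
    using sum.permute[OF p, of f] by (simp add: comp_def)
  have rc: "?c k = rev_coeff A (n - k)" if "k \<le> n" for k
    using that by (simp add: rev_coeff_def dim)
  have c2: "?c (n - 2) = rc 2" using rc[of "n - 2"] n by simp
  have ac: "adj_coeff A j (\<pi> i) (\<pi> i) = (if j < n then coeff (ps ! i) (n - 1 - j) else 0)" if "i < n" for i j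
    by (simp add: adj_coeff_diag[OF carrier pl[OF that]] ps[OF that])
  have deg: "degree (char_poly A) = n" using degree_monic_char_poly[OF carrier] by simp
  have "int n \<le> int n ^ 2" using n by (intro self_le_power) simp_all
  then have b1: "1 \<le> ?b" and b2: "2 \<le> ?b" and nb: "int n \<le> ?b" using n by linarith+
  have mono: "?b ^ j \<le> ?b ^ Suc n" if "j \<le> Suc n" for j
    using that b1 by (intro power_increasing)
  have npow: "int n ^ j \<le> ?b ^ Suc n" if "j \<le> Suc n" for j
    using order_trans[OF power_mono[OF nb, of j] mono[OF that]] by simp
  have n0: "0 < n" using n by simp
  show ?thesis
  proof
    show "3 \<le> n" by (rule n)
  next
    fix k assume k: "k < n"
    have "(\<Sum>i<n. coeff (ps ! i) k) = (\<Sum>i<n. coeff (char_poly (mat_delete A (\<pi> i) (\<pi> i))) k)"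
      by (intro sum.cong) (simp_all add: ps)
    also have "\<dots> = coeff (pderiv (char_poly A)) k"
      unfolding sp[of "\<lambda>i. coeff (char_poly (mat_delete A i i)) k"] pderiv_char_poly[OF carrier] coeff_sum ..
    finally show "(\<Sum>i<n. coeff (ps ! i) k) = ?c (Suc k) * (int k + 1)"
      by (simp add: coeff_pderiv algebra_simps)
  next
    fix k assume "n < k" then show "?c k = 0" using deg by (intro coeff_eq_0) simp
  next
    fix i assume i: "i < n"
    show "degr (\<pi> i) = coeff (ps ! i) (n - 3) - ?c (n - 2)"
      using adj_coeff_2_diag[OF pl[OF i]] ac[OF i, of 2] c2 n by (simp add: numeral_3_eq_3 numeral_2_eq_2)
    have r4: "rc 4 = (?c (n - 2) * ?c (n - 2) - ?c (n - 2) - (\<Sum>i<n. degr (\<pi> i) * degr (\<pi> i))) div 2"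
      using q sp[of "\<lambda>i. degr i * degr i"] unfolding quad_free_iff c2 power2_eq_square by simp
    have a4: "adj_coeff A 4 (\<pi> i) (\<pi> i) = (if 5 \<le> n then coeff (ps ! i) (n - 5) else 0)"
      using ac[OF i, of 4] by (simp add: Suc_le_eq eval_nat_numeral)
    show "walks A 2 (\<pi> i) = (if 5 \<le> n then coeff (ps ! i) (n - 5) else 0) - degr (\<pi> i) * degr (\<pi> i)
        + degr (\<pi> i) - ?c (n - 2) * degr (\<pi> i)
        - (?c (n - 2) * ?c (n - 2) - ?c (n - 2) - (\<Sum>i<n. degr (\<pi> i) * degr (\<pi> i))) div 2"
      using quad_free_walks_2[OF q pl[OF i]] unfolding a4 r4 c2 power2_eq_square .
  next
    fix j assume d: "\<And>i. i < n \<Longrightarrow> degr (\<pi> i) = degr (\<pi> 0)" and j: "j < n"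
    have "degr i = degr (\<pi> 0)" if "i < n" for i using d surj[OF that] by blast
    from walks_2_const_degr[OF this pl[OF j]] show "walks A 2 (\<pi> j) = degr (\<pi> 0) * degr (\<pi> j)"
      using d[OF j] by simp
  next
    fix i j assume "i < n" "j < n" "degr (\<pi> i) \<noteq> degr (\<pi> 0)"
    then show "(degr (\<pi> i) - degr (\<pi> 0)) * (walks A 2 (\<pi> j) - walks A 2 (\<pi> 0))
        = (walks A 2 (\<pi> i) - walks A 2 (\<pi> 0)) * (degr (\<pi> j) - degr (\<pi> 0))"
      using dependent_cross[OF dep pl[OF n0] pl pl] by blast
  next
    show "total_walks A 0 = int n" by (simp add: total_walks_def dim)
    show "total_walks A (Suc 0) = - 2 * ?c (n - 2)"
      unfolding total_walks_def dim walks_1 c2 by (rule sum_degr)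
  next
    fix D N M :: int and l
    assume r: "\<And>j. j < n \<Longrightarrow> D * walks A 2 (\<pi> j) = N * degr (\<pi> j) + M"
    have "D * walks A 2 j = N * degr j + M" if "j < n" for j using r surj[OF that] by blast
    then show "D * total_walks A (l + 2) = N * total_walks A (l + 1) + M * total_walks A l"
      by (rule total_walks_recurrence)
  next
    have t0: "total_walks A 0 = int n" by (simp add: total_walks_def dim)
    have "(\<Sum>l<Suc n. ?c l * total_walks A l) = 0"
      using char_poly_annihilates_total_walks[OF carrier] by (simp add: lessThan_Suc_atMost)
    then show "int n * ?c 0 = - (\<Sum>k<n. ?c (Suc k) * total_walks A (Suc k))"
      unfolding sum.lessThan_Suc_shift t0 by (simp add: eq_neg_iff_add_eq_0 mult.commute)
  next
    fix i k assume ik: "i < n" "k < n"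
    have "coeff (ps ! i) k = adj_coeff A (n - 1 - k) (\<pi> i) (\<pi> i)" using ik by (simp add: ac)
    also have "\<bar>\<dots>\<bar> \<le> ?b ^ (n - 1 - k)" by (rule coeff_bounds(1)[OF carrier abs_entry pl[OF ik(1)] pl[OF ik(1)]])
    also have "\<dots> \<le> ?b ^ Suc n" by (rule mono) simp
    finally show "\<bar>coeff (ps ! i) k\<bar> \<le> ?b ^ Suc n" .
  next
    fix k show "\<bar>?c k\<bar> \<le> ?b ^ Suc n"
    proof (cases "k \<le> n")
      case True
      have "\<bar>?c k\<bar> \<le> ?b ^ (n - k)" unfolding rc[OF True] by (rule coeff_bounds(2)[OF carrier abs_entry])
      also have "\<dots> \<le> ?b ^ Suc n" by (rule mono) simp
      finally show ?thesis .
    next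
      case False
      then have "?c k = 0" using deg by (intro coeff_eq_0) simp
      then show ?thesis using b1 by simp
    qed
  next
    fix i assume i: "i < n"
    have w: "\<bar>walks A l (\<pi> i)\<bar> \<le> ?b ^ Suc n" if "l \<le> Suc n" for l
      by (rule order_trans[OF walks_bound npow[OF that]]) (fact carrier, fact abs_entry, rule pl[OF i])
    show "\<bar>degr (\<pi> i)\<bar> \<le> ?b ^ Suc n" unfolding walks_1[symmetric] by (rule w) simp
    show "\<bar>walks A 2 (\<pi> i)\<bar> \<le> ?b ^ Suc n" using n by (intro w) simp
  next
    fix l assume l: "l \<le> n"
    have "\<bar>total_walks A l\<bar> \<le> int n * int n ^ l"
      unfolding total_walks_def dim by (rule abs_sum_le, rule walks_bound[OF carrier]) (rule abs_entry)
    also have "\<dots> \<le> ?b ^ Suc n" using npow[of "Suc l"] l by simp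
    finally show "\<bar>total_walks A l\<bar> \<le> ?b ^ Suc n" .
  next
    show "2 ^ Suc n \<le> ?b ^ Suc n" using b2 by (intro power_mono) auto
  next
    have "int n \<le> 2 ^ n" using less_exp[of n] by (metis of_nat_le_iff of_nat_numeral of_nat_power less_imp_le)
    then have "int n ^ 2 \<le> (2 ^ n) ^ 2" by (intro power_mono) auto
    then have "?b \<le> 2 ^ (1 + 2 * n)" by (simp add: power_mult[symmetric] mult.commute)
    then have "(?b ^ Suc n) ^ 5 \<le> ((2 ^ (1 + 2 * n)) ^ Suc n) ^ 5" by (intro power_mono) auto
    also have "\<dots> = 2 ^ (((1 + 2 * n) * Suc n) * 5)" by (simp only: power_mult[symmetric])
    also have "\<dots> < 2 ^ word_length n"
      by (rule power_strict_increasing) (simp_all add: word_length_def mult.commute)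
    finally show "(?b ^ Suc n) ^ 5 < 2 ^ word_length n" .
  qed
qed

lemma reconstruct_prog_correct:
  assumes G: "graph_on n G" and n: "3 \<le> n" and c4: "\<not> has_four_cycle G" and wr: "walk_rank G \<le> 2"
    and ps: "mset ps = polynomial_deck G"
  shows "\<exists>t s. exec reconstruct_prog (deck_input n ps) t s \<and>
    t \<le> time (Suc n) (word_length n) reconstruct_prog \<and>
    stores_poly s ''phi'' n (graph_poly G) \<and> stores_poly s ''cophi'' n (graph_poly (complement G))"
proof -
  let ?A = "adj_matrix G :: int mat"
  interpret A: adjacency ?A n by (rule adjacency_graph_on[OF G])
  obtain \<pi> where p: "\<pi> permutes {..<n}"
    and pi: "\<And>i. i < n \<Longrightarrow> ps ! i = char_poly (mat_delete ?A (\<pi> i) (\<pi> i))"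
    using deck_listing[OF G ps] by blast
  have q: A.quad_free using quad_free_iff_no_four_cycle[OF G] c4 by simp
  have dep: A.walks_dependent using walk_rank_le_2_iff[OF G n] wr by simp
  interpret R: reconstruction n "\<lambda>i k. coeff (ps ! i) k" "coeff (char_poly ?A)"
    "\<lambda>i. A.degr (\<pi> i)" "\<lambda>i. walks ?A 2 (\<pi> i)" "total_walks ?A" "(2 * int n ^ 2) ^ Suc n" "word_length n"
    by (rule reconstruction_graph[OF G n q dep p pi])
  have inp: "R.input (deck_input n ps)"
    unfolding R.input_def
  proof (intro conjI allI impI)
    fix i k assume ik: "i < n" "k < n"
    have "i * n + k < Suc i * n" using ik by simp
    also have "\<dots> \<le> n * n" using ik by (intro mult_right_mono) simp_all
    finally have lt: "i * n + k < n * n" .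
    have e: "int i * int n + int k = int (i * n + k)" by simp
    show "deck_input n ps ''deck'' (int i * int n + int k) = coeff (ps ! i) k"
      unfolding e deck_input_def using lt ik by (simp del: of_nat_add of_nat_mult)
  qed (simp add: deck_input_def)
  have bd: "bounded (word_length n) (deck_input n ps)"
    unfolding bounded_def
  proof (intro allI)
    fix x i
    have "\<bar>coeff (ps ! (nat i div n)) (nat i mod n)\<bar> < 2 ^ word_length n" if "0 \<le> i" "i < int (n * n)"
    proof (rule R.small1, rule R.deck_le)
      have "nat i < n * n" using that by linarith
      then show "nat i div n < n" by (simp add: less_mult_imp_div_less)
      show "nat i mod n < n" using n by simp
    qed
    moreover have "int n < 2 ^ word_length n" using R.N_L by linarith
    ultimately show "\<bar>deck_input n ps x i\<bar> < 2 ^ word_length n"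
      by (simp add: deck_input_def)
  qed
  have "R.run reconstruct_prog (\<lambda>s. (\<forall>k. s ''phi'' (int k) = coeff (char_poly ?A) k) \<and>
    (\<forall>m\<le>n. s ''cophi'' (int m) = coeff (horner_shift (\<lambda>t. R.P (n - t)) (Suc n)) m)) (deck_input n ps)"
    by (rule R.run_reconstruct[OF inp]) (simp add: deck_input_def)
  then obtain t s where e: "exec reconstruct_prog (deck_input n ps) t s"
    and t: "t \<le> time (Suc n) (word_length n) reconstruct_prog"
    and phi: "\<And>k. s ''phi'' (int k) = coeff (char_poly ?A) k"
    and co: "\<And>m. m \<le> n \<Longrightarrow> s ''cophi'' (int m) = coeff (horner_shift (\<lambda>t. R.P (n - t)) (Suc n)) m"
    using bd unfolding runs_def by (auto simp: word_length_def)
  have P: "R.P k = coeff (walk_poly ?A) k" if "k \<le> n" for k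
    unfolding R.P_def coeff_walk_poly[OF A.carrier that] by simp
  have "(\<lambda>t. R.P (n - t)) = (\<lambda>t. coeff (walk_poly ?A) (n - t))" by (intro ext P) simp
  then have "horner_shift (\<lambda>t. R.P (n - t)) (Suc n) = graph_poly (complement G)"
    by (simp only: horner_shift_eq[OF degree_walk_poly[OF A.carrier]] graph_poly_complement[OF G])
  then show ?thesis using e t phi co by (auto simp: stores_poly_def graph_poly_def)
qed

lemma efficiently_reconstructible_quad_free_rank_2:
  "efficiently_reconstructible (\<lambda>n G. n \<ge> 3 \<and> graph_on n G \<and> \<not> has_four_cycle G \<and> walk_rank G \<le> 2)"
proof -
  obtain p :: "nat poly" where p: "\<And>n. time (poly [:1, 1:] n) (poly (1 + 5 * ([:1, 2:] * [:1, 1:])) n) reconstruct_prog = poly p n"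
    using time_polynomial by blast
  have "time (Suc n) (word_length n) reconstruct_prog = poly p n" for n
  proof -
    have "word_length n = poly (1 + 5 * ([:1, 2:] * [:1, 1:])) n"
      by (simp add: word_length_def algebra_simps)
    then show ?thesis unfolding p[symmetric] by simp
  qed
  then show ?thesis
    unfolding efficiently_reconstructible_def using reconstruct_prog_correct by metis
qed

lemma degree_graph_poly: "graph_on n G \<Longrightarrow> degree (graph_poly G) = n"
  using degree_monic_char_poly[OF adjacency.carrier[OF adjacency_graph_on]] by (simp add: graph_poly_def)

lemma graph_on_complement: "graph_on n G \<Longrightarrow> graph_on n (complement G)"
  by (auto simp: graph_on_def complement_def simple_graph_def)

lemma stores_poly_unique:
  assumes "stores_poly s x n p" "stores_poly s x n q" "degree p \<le> n" "degree q \<le> n"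
  shows "p = q"
proof (rule poly_eqI)
  fix k
  show "coeff p k = coeff q k"
    using assms by (cases "k \<le> n") (auto simp: stores_poly_def coeff_eq_0)
qed

text \<open>Run the program on one listing of the common deck: its final state stores the polynomials of both
  graphs.\<close>

lemma reconstruction_unique:
  assumes eff: "efficiently_reconstructible P" and P: "P n G" "P n H"
    and G: "graph_on n G" and H: "graph_on n H" and deck: "polynomial_deck G = polynomial_deck H"
  shows "graph_poly G = graph_poly H" and "graph_poly (complement G) = graph_poly (complement H)"
proof -
  obtain prog where prog: "\<And>n G ps. P n G \<Longrightarrow> mset ps = polynomial_deck G \<Longrightarrow>
      \<exists>t s. exec prog (deck_input n ps) t s \<and> stores_poly s ''phi'' n (graph_poly G) \<and>
        stores_poly s ''cophi'' n (graph_poly (complement G))"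
    using eff unfolding efficiently_reconstructible_def by metis
  obtain ps where ps: "mset ps = polynomial_deck G" using ex_mset by blast
  obtain t s where s: "exec prog (deck_input n ps) t s"
    "stores_poly s ''phi'' n (graph_poly G)" "stores_poly s ''cophi'' n (graph_poly (complement G))"
    using prog[OF P(1) ps] by blast
  obtain u r where r: "exec prog (deck_input n ps) u r"
    "stores_poly r ''phi'' n (graph_poly H)" "stores_poly r ''cophi'' n (graph_poly (complement H))"
    using prog[OF P(2) ps[unfolded deck]] by blast
  have "r = s" by (rule exec_deterministic[OF s(1) r(1)])
  with s r show "graph_poly G = graph_poly H" "graph_poly (complement G) = graph_poly (complement H)"
    using degree_graph_poly[OF G] degree_graph_poly[OF H]
      degree_graph_poly[OF graph_on_complement[OF G]] degree_graph_poly[OF graph_on_complement[OF H]]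
    by (auto intro: stores_poly_unique)
qed

theorem theorem7:
  shows
   "(\<exists>f :: int poly multiset \<Rightarrow> bool. \<forall>n G. n \<ge> 3 \<longrightarrow> graph_on n G \<longrightarrow>
        (f (polynomial_deck G) \<longleftrightarrow> \<not> has_four_cycle G)) \<and>
    (\<exists>g :: int poly multiset \<Rightarrow> bool. \<forall>n G. n \<ge> 3 \<longrightarrow> graph_on n G \<longrightarrow> \<not> has_four_cycle G \<longrightarrow>
        (g (polynomial_deck G) \<longleftrightarrow> walk_rank G \<le> 2)) \<and>
    efficiently_reconstructible
      (\<lambda>n G. n \<ge> 3 \<and> graph_on n G \<and> \<not> has_four_cycle G \<and> walk_rank G \<le> 2) \<and>
    (\<forall>n G H. n \<ge> 3 \<longrightarrow> graph_on n G \<longrightarrow> graph_on n H \<longrightarrow>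
        polynomial_deck G = polynomial_deck H \<longrightarrow>
        (\<not> has_four_cycle G \<longleftrightarrow> \<not> has_four_cycle H) \<and>
        (\<not> has_four_cycle G \<longrightarrow>
           (walk_rank G \<le> 2 \<longleftrightarrow> walk_rank H \<le> 2) \<and>
           (walk_rank G \<le> 2 \<longrightarrow>
              (graph_poly G, graph_poly (complement G)) =
              (graph_poly H, graph_poly (complement H)))))"
proof (intro conjI)
  \<comment> \<open>The size of a deck is the order of the graph; so the predicates below may ask for a graph of any
    order with the given deck.\<close>
  have same_size: "m = n" if "graph_on m G" "graph_on n H" "polynomial_deck G = polynomial_deck H" for m n G H
    using size_polynomial_deck[OF that(1)] size_polynomial_deck[OF that(2)] that(3) by simp
  show "\<exists>f :: int poly multiset \<Rightarrow> bool. \<forall>n G. n \<ge> 3 \<longrightarrow> graph_on n G \<longrightarrow>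
      (f (polynomial_deck G) \<longleftrightarrow> \<not> has_four_cycle G)"
  proof (intro exI allI impI)
    fix n G assume n: "(n::nat) \<ge> 3" and G: "graph_on n G"
    show "(\<exists>m H. graph_on m H \<and> polynomial_deck G = polynomial_deck H \<and> \<not> has_four_cycle H)
        \<longleftrightarrow> \<not> has_four_cycle G"
      using deck_properties(1)[OF G _ n] same_size[OF G] G by blast
  qed
  show "\<exists>g :: int poly multiset \<Rightarrow> bool. \<forall>n G. n \<ge> 3 \<longrightarrow> graph_on n G \<longrightarrow> \<not> has_four_cycle G \<longrightarrow>
      (g (polynomial_deck G) \<longleftrightarrow> walk_rank G \<le> 2)"
  proof (intro exI allI impI)
    fix n G assume n: "(n::nat) \<ge> 3" and G: "graph_on n G" and c: "\<not> has_four_cycle G"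
    show "(\<exists>m H. graph_on m H \<and> polynomial_deck G = polynomial_deck H \<and> walk_rank H \<le> 2)
        \<longleftrightarrow> walk_rank G \<le> 2"
      using deck_properties(2)[OF G _ n _ c] same_size[OF G] G by blast
  qed
  show "efficiently_reconstructible
      (\<lambda>n G. n \<ge> 3 \<and> graph_on n G \<and> \<not> has_four_cycle G \<and> walk_rank G \<le> 2)"
    by (rule efficiently_reconstructible_quad_free_rank_2)
  show "\<forall>n G H. n \<ge> 3 \<longrightarrow> graph_on n G \<longrightarrow> graph_on n H \<longrightarrow>
        polynomial_deck G = polynomial_deck H \<longrightarrow>
        (\<not> has_four_cycle G \<longleftrightarrow> \<not> has_four_cycle H) \<and>
        (\<not> has_four_cycle G \<longrightarrow>
           (walk_rank G \<le> 2 \<longleftrightarrow> walk_rank H \<le> 2) \<and>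
           (walk_rank G \<le> 2 \<longrightarrow>
              (graph_poly G, graph_poly (complement G)) =
              (graph_poly H, graph_poly (complement H))))"
  proof (intro allI impI conjI)
    fix n G H assume n: "(n::nat) \<ge> 3" and G: "graph_on n G" and H: "graph_on n H"
      and deck: "polynomial_deck G = polynomial_deck H"
    note same = deck_properties[OF G H n deck]
    show "\<not> has_four_cycle G \<longleftrightarrow> \<not> has_four_cycle H" using same(1) by simp
    assume c: "\<not> has_four_cycle G"
    show "walk_rank G \<le> 2 \<longleftrightarrow> walk_rank H \<le> 2" by (rule same(2)[OF c])
    assume r: "walk_rank G \<le> 2"
    have "\<not> has_four_cycle H" "walk_rank H \<le> 2" using same(1) same(2)[OF c] c r by simp_all
    then show "(graph_poly G, graph_poly (complement G)) = (graph_poly H, graph_poly (complement H))"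
      using reconstruction_unique[OF efficiently_reconstructible_quad_free_rank_2 _ _ G H deck] n G H c r
      by simp
  qed
qed

end
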